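(* Let $n\ge1$, $Y$ a real normed space, $T>0$, $M\subset\mathbb{R}^n$ open, $a_0,a_T\in M$, and let $L,\mathfrak g_1,\dots,\mathfrak g_k,\mathfrak h_1,\dots,\mathfrak h_\ell:[0,T]\times M\times\mathbb{R}^n\times Y\to\mathbb{R}$ be functions. For $\pi\in Y$ let $V(\pi)$ be the value of $$(\mathcal V,\pi):\quad\text{maximize } J(x,\pi):=\int_0^TL(t,x(t),x'(t),\pi)\,dt$$ subject to $x\in C^1([0,T],M)$, $x(0)=a_0$, $x(T)=a_T$, $G_i(x,\pi):=\int_0^T\mathfrak g_i(t,x(t),x'(t),\pi)\,dt\ge0$ $(1\le i\le k)$, $H_j(x,\pi):=\int_0^T\mathfrak h_j(t,x(t),x'(t),\pi)\,dt=0$ $(1\le j\le\ell)$. Let $\pi_0\in Y$ and $\mathcal I:=\{L,\mathfrak g_1,\dots,\mathfrak g_k,\mathfrak h_1,\dots,\mathfrak h_\ell\}$. Assume: (Sol1) there is an open neighborhood $P$ of $\pi_0$ in $Y$ such that for all $\pi\in P$ there is a solution $x(\pi)$ of $(\mathcal V,\pi)$, and the map $\pi\mapsto x(\pi)$ (into $C^1([0,T],\mathbb{R}^n)$) is continuous at $\pi_0$; (Sol2) there is $\varpi\in Y$ such that $D^+_Gx(\pi_0;\varpi)$ exists; (Int1) there are $\rho>0$ and a Borel $\mathfrak m_1$-integrable $\xi:[0,T]\to\mathbb{R}_+$ such that for all $\psi\in\mathcal I$, $t\in[0,T]$, $u,u_1\in B(x(\pi_0)(t),\rho)$, $v,v_1\in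 B(x(\pi_0)'(t),\rho)$, $\pi,\pi_1\in B(\pi_0,\rho)$: $|\psi(t,u,v,\pi)-\psi(t,u_1,v_1,\pi_1)|\le\xi(t)(\|u-u_1\|+\|v-v_1\|+\|\pi-\pi_1\|)$; (Int2) for all $\psi\in\mathcal I$, $\psi$ is continuous on $[0,T]\times M\times\mathbb{R}^n\times P$, and for all $t\in[0,T]$, $\pi\in P$, $D_{H,(2,3,4)}\psi(t,x(\pi)(t),x(\pi)'(t),\pi)$ exists; (Int3) for all $\psi\in\mathcal I$ and $t\in[0,T]$, $\pi\mapsto D_{H,(2,3)}\psi(t,x(\pi)(t),x(\pi)'(t),\pi)$ is continuous from $B(\pi_0,\rho)$ into $(\mathbb{R}^{n*})^2$; (Con) for all $(\lambda,\mu)\in\mathbb{R}^k\times\mathbb{R}^\ell$ with $(\lambda,\mu)\ne(0,0)$, putting $\psi_{\lambda,\mu}:=\sum_{i}\lambda_i\mathfrak g_i+\sum_j\mu_j\mathfrak h_j$, there is no constant $c_{\lambda,\mu}\in\mathbb{R}^{n*}$ such that for $\mathfrak m_1$-a.e. $t\in[0,T]$ $$D_{H,3}\psi_{\lambda,\mu}(t,x(\pi_0)(t),x(\pi_0)'(t),\pi_0)=\int_{[0,t]}D_{H,2}\psi_{\lambda,\mu}(s,x(\pi_0)(s),x(\pi_0)'(s),\pi_0)\,d\mathfrak m_1(s)+c_{\lambda,\mu}.$$ Then: (I) For $\varpi$ as in (Sol2), $D^+_GV(\pi_0;\varpi)$ exists and $$D^+_GV(\pi_0;\varpi)=\int_{[0,T]}D_{H,4}L(t,x(\pi_0)(t),x(\pi_0)'(t),\pi_0)\cdot\varpi\,d\mathfrak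 m_1(t)+\sum_{i=1}^k\lambda_i(\pi_0)\int_{[0,T]}D_{H,4}\mathfrak g_i(t,x(\pi_0)(t),x(\pi_0)'(t),\pi_0)\cdot\varpi\,d\mathfrak m_1(t)+\sum_{j=1}^\ell\mu_j(\pi_0)\int_{[0,T]}D_{H,4}\mathfrak h_j(t,x(\pi_0)(t),x(\pi_0)'(t),\pi_0)\cdot\varpi\,d\mathfrak m_1(t),$$ where $(\lambda_i(\pi_0))_{1\le i\le k}$, $(\mu_j(\pi_0))_{1\le j\le\ell}$ are the Karush-Kuhn-Tucker multipliers associated to the solution $x(\pi_0)$ of $(\mathcal V,\pi_0)$. (II) If (Sol2) is replaced by: $D^+_Gx(\pi_0;\varpi)$ exists for all $\varpi\in Y$, then $V$ is Gâteaux differentiable at $\pi_0$ and for all $\varpi\in Y$, $D_GV(\pi_0)\cdot\varpi$ equals the right-hand side of the formula in (I). (III) If in addition: $D^+_Gx(\pi;\varpi)$ exists for all $\pi\in P$, $\varpi\in Y$; for all $\psi\in\mathcal I$, $t\in[0,T]$, $\pi\mapsto D_{H,(2,3,4)}\psi(t,x(\pi)(t),x(\pi)'(t),\pi)$ is continuous on $B(\pi_0,\rho)$; and for all $\psi\in\mathcal I$, $\pi\in B(\pi_0,\rho)$, $t\mapsto D_{H,(2,3,4)}\psi(t,x(\pi)(t),x(\pi)'(t),\pi)$ is measurable from $([0,T],\mathcal B([0,T]))$ into $(\mathbb{R}^n\times\mathbb{R}^n\times Y)^*$ with its Borel $\sigma$-algebra; then $V$ is of class Fréchet $C^1$ on an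 open neighborhood of $\pi_0$, and for all $\pi$ in this neighborhood and all $\varpi\in Y$, $$D_FV(\pi)\cdot\varpi=\int_{[0,T]}D_{H,4}L(t,x(\pi)(t),x(\pi)'(t),\pi)\cdot\varpi\,d\mathfrak m_1(t)+\sum_{i=1}^k\lambda_i(\pi)\int_{[0,T]}D_{H,4}\mathfrak g_i(t,x(\pi)(t),x(\pi)'(t),\pi)\cdot\varpi\,d\mathfrak m_1(t)+\sum_{j=1}^\ell\mu_j(\pi)\int_{[0,T]}D_{H,4}\mathfrak h_j(t,x(\pi)(t),x(\pi)'(t),\pi)\cdot\varpi\,d\mathfrak m_1(t),$$ with $(\lambda_i(\pi))_i$, $(\mu_j(\pi))_j$ the Karush-Kuhn-Tucker multipliers associated to the solution $x(\pi)$ of $(\mathcal V,\pi)$.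
   Context: $C^1([0,T],M)$ is the set of continuously differentiable functions from $[0,T]$ into $M$, a subset of $C^1([0,T],\mathbb{R}^n)$ with its usual $C^1$ norm; $C^1_{0,0}([0,T],\mathbb{R}^n)=\{h\in C^1([0,T],\mathbb{R}^n):h(0)=h(T)=0\}$. $\mathbb{R}^{n*}$ is the dual of $\mathbb{R}^n$; $B(\cdot,r)$ are open balls; dual spaces carry their usual norms. $\mathfrak m_1$ is the Borel (Lebesgue) measure on the Borel $\sigma$-algebra $\mathcal B([0,T])$. The radius $\rho$ in (Int1) is understood to be such that $B(x(\pi_0)(t),\rho)\subset M$ for all $t\in[0,T]$ and $B(\pi_0,\rho)\subset P$. $V(\pi)$ is the supremum of $J(\cdot,\pi)$ over the admissible functions of $(\mathcal V,\pi)$, so $V(\pi)=J(x(\pi),\pi)$ for $\pi\in P$. The map $\pi\mapsto x(\pi)$ is fixed by (Sol1), and its directional derivatives are taken in $C^1([0,T],\mathbb{R}^n)$. Differentiability. Let $E,F$ be real normed spaces, $U\subset E$ (open), $\phi:U\to F$, $x\in U$, $v\in E$. $D^+_G\phi(x;v)=\lim_{\theta\to0+}\frac1\theta(\phi(x+\theta v)-\phi(x))$ when it exists; if it exists for all $v$ and is continuous linear in $v$ it is the Gâteaux differential $D_G\phi(x)$. $\phi$ has Hadamard variation $D^+_H\phi(x;v)$ if for all sequences $\theta_n>0$, $\theta_n\to0$, and $v_n\to v$, $\frac1{\theta_n}(\phi(x+\theta_nv_n)-\phi(x))\to D^+_H\phi(x;v)$; if it exists for all $v$ and is continuous linear in $v$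 it is the Hadamard differential $D_H\phi(x)$. $D_F$ is the Fréchet differential. $D_{H,k}$ is the partial Hadamard differential with respect to the $k$-th variable; $D_{H,(2,3)}$ and $D_{H,(2,3,4)}$ are the Hadamard differentials with respect to the 2nd and 3rd (resp. 2nd, 3rd and 4th) variables jointly, the others being fixed. Karush-Kuhn-Tucker multipliers associated to the solution $x(\pi)$ of $(\mathcal V,\pi)$: reals $\lambda_i(\pi),\mu_j(\pi)$ such that $\lambda_i(\pi)\ge0$ and $\lambda_i(\pi)G_i(x(\pi),\pi)=0$ for all $i$, and $\big(D_{H,1}J(x(\pi),\pi)+\sum_i\lambda_i(\pi)D_{H,1}G_i(x(\pi),\pi)+\sum_j\mu_j(\pi)D_{H,1}H_j(x(\pi),\pi)\big)\cdot h=0$ for all $h\in C^1_{0,0}([0,T],\mathbb{R}^n)$. *)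

theory Defs
  imports "HOL-Analysis.Analysis"
begin

section \<open>One-sided Gateaux and Hadamard differentiability in normed spaces\<close>

text \<open>
  A map on an open set U is represented by a total function; at points of U the notions below
  involve only its values on U.
\<close>

definition has_gateaux_variation ::
  "('e::real_normed_vector \<Rightarrow> 'f::real_normed_vector) \<Rightarrow> 'e \<Rightarrow> 'e \<Rightarrow> 'f \<Rightarrow> bool" where
  "has_gateaux_variation \<phi> x v d \<longleftrightarrow>
     ((\<lambda>\<theta>. (1 / \<theta>) *\<^sub>R (\<phi> (x + \<theta> *\<^sub>R v) - \<phi> x)) \<longlongrightarrow> d) (at_right 0)"

definition has_gateaux_differential ::
  "('e::real_normed_vector \<Rightarrow> 'f::real_normed_vector) \<Rightarrow> 'e \<Rightarrow> ('e \<Rightarrow>\<^sub>L 'f) \<Rightarrow> bool" where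
  "has_gateaux_differential \<phi> x D \<longleftrightarrow> (\<forall>v. has_gateaux_variation \<phi> x v (blinfun_apply D v))"

definition has_hadamard_variation ::
  "('e::real_normed_vector \<Rightarrow> 'f::real_normed_vector) \<Rightarrow> 'e \<Rightarrow> 'e \<Rightarrow> 'f \<Rightarrow> bool" where
  "has_hadamard_variation \<phi> x v d \<longleftrightarrow>
     (\<forall>(\<theta> :: nat \<Rightarrow> real) (w :: nat \<Rightarrow> 'e).
        (\<forall>m. \<theta> m > 0) \<longrightarrow> \<theta> \<longlonglongrightarrow> 0 \<longrightarrow> w \<longlonglongrightarrow> v \<longrightarrow>
        (\<lambda>m. (1 / \<theta> m) *\<^sub>R (\<phi> (x + \<theta> m *\<^sub>R w m) - \<phi> x)) \<longlonglongrightarrow> d)"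

definition has_hadamard_differential ::
  "('e::real_normed_vector \<Rightarrow> 'f::real_normed_vector) \<Rightarrow> 'e \<Rightarrow> ('e \<Rightarrow>\<^sub>L 'f) \<Rightarrow> bool" where
  "has_hadamard_differential \<phi> x D \<longleftrightarrow> (\<forall>v. has_hadamard_variation \<phi> x v (blinfun_apply D v))"

definition hadamard_differential ::
  "('e::real_normed_vector \<Rightarrow> 'f::real_normed_vector) \<Rightarrow> 'e \<Rightarrow> ('e \<Rightarrow>\<^sub>L 'f)" where
  "hadamard_differential \<phi> x = (THE D. has_hadamard_differential \<phi> x D)"


section \<open>The space of continuously differentiable functions on a compact interval\<close>

text \<open>
  An element of C^1([0,T], R^n) is represented by a total function, only the values of which on
  [0,T] matter: every notion below is invariant under changes outside [0,T]. Derivatives at the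
  end points are one-sided. On these representatives the C^1 norm is formally a seminorm, which
  vanishes exactly on the functions representing zero.
\<close>

definition C1_space :: "real \<Rightarrow> (real \<Rightarrow> 'a::real_normed_vector) set" where
  "C1_space T = {x. \<exists>x'. (\<forall>t\<in>{0..T}. (x has_vector_derivative x' t) (at t within {0..T})) \<and>
                         continuous_on {0..T} x'}"

definition C1_into :: "real \<Rightarrow> 'a::real_normed_vector set \<Rightarrow> (real \<Rightarrow> 'a) set" where
  "C1_into T M = {x \<in> C1_space T. x ` {0..T} \<subseteq> M}"

definition C1_space_00 :: "real \<Rightarrow> (real \<Rightarrow> 'a::real_normed_vector) set" where
  "C1_space_00 T = {h \<in> C1_space T. h 0 = 0 \<and> h T = 0}"

definition deriv_on :: "real \<Rightarrow> (real \<Rightarrow> 'a::real_normed_vector) \<Rightarrow> real \<Rightarrow> 'a" where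
  "deriv_on T x t = vector_derivative x (at t within {0..T})"

definition C1_norm :: "real \<Rightarrow> (real \<Rightarrow> 'a::real_normed_vector) \<Rightarrow> real" where
  "C1_norm T x = (SUP t\<in>{0..T}. norm (x t)) + (SUP t\<in>{0..T}. norm (deriv_on T x t))"

text \<open>Continuity and one-sided Gateaux variation of a map with values in C^1([0,T], R^n).\<close>

definition C1_continuous_at ::
  "real \<Rightarrow> ('e::real_normed_vector \<Rightarrow> real \<Rightarrow> 'a::real_normed_vector) \<Rightarrow> 'e \<Rightarrow> bool" where
  "C1_continuous_at T X p \<longleftrightarrow> ((\<lambda>q. C1_norm T (\<lambda>t. X q t - X p t)) \<longlongrightarrow> 0) (at p)"

definition has_gateaux_variation_into_C1 ::
  "real \<Rightarrow> ('e::real_normed_vector \<Rightarrow> real \<Rightarrow> 'a::real_normed_vector) \<Rightarrow>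
   'e \<Rightarrow> 'e \<Rightarrow> (real \<Rightarrow> 'a) \<Rightarrow> bool" where
  "has_gateaux_variation_into_C1 T X p v d \<longleftrightarrow>
     d \<in> C1_space T \<and>
     ((\<lambda>\<theta>. C1_norm T (\<lambda>t. (1 / \<theta>) *\<^sub>R (X (p + \<theta> *\<^sub>R v) t - X p t) - d t)) \<longlongrightarrow> 0) (at_right 0)"

text \<open>Hadamard variation and Hadamard differential of a real function on C^1([0,T], R^n).\<close>

definition has_hadamard_variation_on_C1 ::
  "real \<Rightarrow> ((real \<Rightarrow> 'a::real_normed_vector) \<Rightarrow> real) \<Rightarrow> (real \<Rightarrow> 'a) \<Rightarrow> (real \<Rightarrow> 'a) \<Rightarrow> real \<Rightarrow> bool"
  where
  "has_hadamard_variation_on_C1 T \<Phi> x v d \<longleftrightarrow>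
     (\<forall>(\<theta> :: nat \<Rightarrow> real) (w :: nat \<Rightarrow> real \<Rightarrow> 'a).
        (\<forall>m. \<theta> m > 0) \<longrightarrow> \<theta> \<longlonglongrightarrow> 0 \<longrightarrow>
        (\<forall>m. w m \<in> C1_space T) \<longrightarrow> (\<lambda>m. C1_norm T (\<lambda>t. w m t - v t)) \<longlonglongrightarrow> 0 \<longrightarrow>
        (\<lambda>m. (1 / \<theta> m) * (\<Phi> (\<lambda>t. x t + \<theta> m *\<^sub>R w m t) - \<Phi> x)) \<longlonglongrightarrow> d)"

definition has_hadamard_differential_on_C1 ::
  "real \<Rightarrow> ((real \<Rightarrow> 'a::real_normed_vector) \<Rightarrow> real) \<Rightarrow> (real \<Rightarrow> 'a) \<Rightarrow> ((real \<Rightarrow> 'a) \<Rightarrow> real) \<Rightarrow> bool"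
  where
  "has_hadamard_differential_on_C1 T \<Phi> x D \<longleftrightarrow>
     (\<forall>h\<in>C1_space T. has_hadamard_variation_on_C1 T \<Phi> x h (D h)) \<and>
     (\<forall>h1\<in>C1_space T. \<forall>h2\<in>C1_space T. D (\<lambda>t. h1 t + h2 t) = D h1 + D h2) \<and>
     (\<forall>c. \<forall>h\<in>C1_space T. D (\<lambda>t. c *\<^sub>R h t) = c * D h) \<and>
     (\<exists>K. \<forall>h\<in>C1_space T. \<bar>D h\<bar> \<le> K * C1_norm T h)"


section \<open>Integrands and their partial Hadamard differentials\<close>

type_synonym ('n, 'y) integrand = "real \<Rightarrow> real ^ 'n \<Rightarrow> real ^ 'n \<Rightarrow> 'y \<Rightarrow> real"

definition DH2 :: "('n::finite, 'y) integrand \<Rightarrow> real \<Rightarrow> real ^ 'n \<Rightarrow> real ^ 'n \<Rightarrow> 'y \<Rightarrow>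
    (real ^ 'n) \<Rightarrow>\<^sub>L real" where
  "DH2 \<psi> t u v p = hadamard_differential (\<lambda>u. \<psi> t u v p) u"

definition DH3 :: "('n::finite, 'y) integrand \<Rightarrow> real \<Rightarrow> real ^ 'n \<Rightarrow> real ^ 'n \<Rightarrow> 'y \<Rightarrow>
    (real ^ 'n) \<Rightarrow>\<^sub>L real" where
  "DH3 \<psi> t u v p = hadamard_differential (\<lambda>v. \<psi> t u v p) v"

definition DH4 :: "('n::finite, 'y::real_normed_vector) integrand \<Rightarrow>
    real \<Rightarrow> real ^ 'n \<Rightarrow> real ^ 'n \<Rightarrow> 'y \<Rightarrow> 'y \<Rightarrow>\<^sub>L real" where
  "DH4 \<psi> t u v p = hadamard_differential (\<lambda>p. \<psi> t u v p) p"

definition DH23 :: "('n::finite, 'y) integrand \<Rightarrow> real \<Rightarrow> real ^ 'n \<Rightarrow> real ^ 'n \<Rightarrow> 'y \<Rightarrow>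
    ((real ^ 'n) \<times> (real ^ 'n)) \<Rightarrow>\<^sub>L real" where
  "DH23 \<psi> t u v p = hadamard_differential (\<lambda>(u, v). \<psi> t u v p) (u, v)"

definition has_DH234 :: "('n::finite, 'y::real_normed_vector) integrand \<Rightarrow>
    real \<Rightarrow> real ^ 'n \<Rightarrow> real ^ 'n \<Rightarrow> 'y \<Rightarrow> (((real ^ 'n) \<times> (real ^ 'n) \<times> 'y) \<Rightarrow>\<^sub>L real) \<Rightarrow> bool" where
  "has_DH234 \<psi> t u v p D \<longleftrightarrow> has_hadamard_differential (\<lambda>(u, v, p). \<psi> t u v p) (u, v, p) D"

definition DH234 :: "('n::finite, 'y::real_normed_vector) integrand \<Rightarrow>
    real \<Rightarrow> real ^ 'n \<Rightarrow> real ^ 'n \<Rightarrow> 'y \<Rightarrow> ((real ^ 'n) \<times> (real ^ 'n) \<times> 'y) \<Rightarrow>\<^sub>L real" where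
  "DH234 \<psi> t u v p = hadamard_differential (\<lambda>(u, v, p). \<psi> t u v p) (u, v, p)"

definition combined_integrand ::
  "nat \<Rightarrow> (nat \<Rightarrow> ('n, 'y) integrand) \<Rightarrow> nat \<Rightarrow> (nat \<Rightarrow> ('n, 'y) integrand) \<Rightarrow>
   (nat \<Rightarrow> real) \<Rightarrow> (nat \<Rightarrow> real) \<Rightarrow> ('n, 'y) integrand" where
  "combined_integrand k g l h lam mu =
     (\<lambda>t u v p. (\<Sum>i=1..k. lam i * g i t u v p) + (\<Sum>j=1..l. mu j * h j t u v p))"


section \<open>The parametrized variational problem\<close>

definition int_functional ::
  "real \<Rightarrow> ('n::finite, 'y) integrand \<Rightarrow> (real \<Rightarrow> real ^ 'n) \<Rightarrow> 'y \<Rightarrow> real" where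
  "int_functional T \<psi> x p = (LINT t:{0..T}|lborel. \<psi> t (x t) (deriv_on T x t) p)"

definition admissible ::
  "real \<Rightarrow> (real ^ 'n::finite) set \<Rightarrow> real ^ 'n \<Rightarrow> real ^ 'n \<Rightarrow>
   nat \<Rightarrow> (nat \<Rightarrow> ('n, 'y) integrand) \<Rightarrow> nat \<Rightarrow> (nat \<Rightarrow> ('n, 'y) integrand) \<Rightarrow>
   'y \<Rightarrow> (real \<Rightarrow> real ^ 'n) set" where
  "admissible T M a0 aT k g l h p =
     {x \<in> C1_into T M. x 0 = a0 \<and> x T = aT \<and>
        (\<forall>i\<in>{1..k}. int_functional T (g i) x p \<ge> 0) \<and>
        (\<forall>j\<in>{1..l}. int_functional T (h j) x p = 0)}"

definition is_solution ::
  "real \<Rightarrow> (real ^ 'n::finite) set \<Rightarrow> real ^ 'n \<Rightarrow> real ^ 'n \<Rightarrow> ('n, 'y) integrand \<Rightarrow>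
   nat \<Rightarrow> (nat \<Rightarrow> ('n, 'y) integrand) \<Rightarrow> nat \<Rightarrow> (nat \<Rightarrow> ('n, 'y) integrand) \<Rightarrow>
   'y \<Rightarrow> (real \<Rightarrow> real ^ 'n) \<Rightarrow> bool" where
  "is_solution T M a0 aT L k g l h p x \<longleftrightarrow>
     x \<in> admissible T M a0 aT k g l h p \<and>
     (\<forall>y\<in>admissible T M a0 aT k g l h p. int_functional T L y p \<le> int_functional T L x p)"

text \<open>
  The supremum is that of the reals, which is unspecified if the problem is infeasible or
  unbounded; neither happens at parameters for which there is a solution.
\<close>

definition value_function ::
  "real \<Rightarrow> (real ^ 'n::finite) set \<Rightarrow> real ^ 'n \<Rightarrow> real ^ 'n \<Rightarrow> ('n, 'y) integrand \<Rightarrow>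
   nat \<Rightarrow> (nat \<Rightarrow> ('n, 'y) integrand) \<Rightarrow> nat \<Rightarrow> (nat \<Rightarrow> ('n, 'y) integrand) \<Rightarrow> 'y \<Rightarrow> real" where
  "value_function T M a0 aT L k g l h p =
     (SUP y\<in>admissible T M a0 aT k g l h p. int_functional T L y p)"

text \<open>
  The differentials of J, G and H with respect to the first variable are required to exist;
  they are unique on C^1([0,T], R^n).
\<close>

definition KKT_multipliers ::
  "real \<Rightarrow> ('n::finite, 'y) integrand \<Rightarrow>
   nat \<Rightarrow> (nat \<Rightarrow> ('n, 'y) integrand) \<Rightarrow> nat \<Rightarrow> (nat \<Rightarrow> ('n, 'y) integrand) \<Rightarrow>
   'y \<Rightarrow> (real \<Rightarrow> real ^ 'n) \<Rightarrow> (nat \<Rightarrow> real) \<Rightarrow> (nat \<Rightarrow> real) \<Rightarrow> bool" where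
  "KKT_multipliers T L k g l h p x lam mu \<longleftrightarrow>
     (\<forall>i\<in>{1..k}. lam i \<ge> 0 \<and> lam i * int_functional T (g i) x p = 0) \<and>
     (\<exists>DJ DG DH.
        has_hadamard_differential_on_C1 T (\<lambda>y. int_functional T L y p) x DJ \<and>
        (\<forall>i\<in>{1..k}. has_hadamard_differential_on_C1 T (\<lambda>y. int_functional T (g i) y p) x (DG i)) \<and>
        (\<forall>j\<in>{1..l}. has_hadamard_differential_on_C1 T (\<lambda>y. int_functional T (h j) y p) x (DH j)) \<and>
        (\<forall>\<eta>\<in>C1_space_00 T.
           DJ \<eta> + (\<Sum>i=1..k. lam i * DG i \<eta>) + (\<Sum>j=1..l. mu j * DH j \<eta>) = 0))"

text \<open>
  ``The'' multipliers: they exist and are unique. Only the entries with indices in 1..k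
  (respectively 1..l) are meaningful.
\<close>

definition the_KKT_multipliers ::
  "real \<Rightarrow> ('n::finite, 'y) integrand \<Rightarrow>
   nat \<Rightarrow> (nat \<Rightarrow> ('n, 'y) integrand) \<Rightarrow> nat \<Rightarrow> (nat \<Rightarrow> ('n, 'y) integrand) \<Rightarrow>
   'y \<Rightarrow> (real \<Rightarrow> real ^ 'n) \<Rightarrow> (nat \<Rightarrow> real) \<Rightarrow> (nat \<Rightarrow> real) \<Rightarrow> bool" where
  "the_KKT_multipliers T L k g l h p x lam mu \<longleftrightarrow>
     KKT_multipliers T L k g l h p x lam mu \<and>
     (\<forall>lam' mu'. KKT_multipliers T L k g l h p x lam' mu' \<longrightarrow>
        (\<forall>i\<in>{1..k}. lam' i = lam i) \<and> (\<forall>j\<in>{1..l}. mu' j = mu j))"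

definition DH4_along ::
  "real \<Rightarrow> ('n::finite, 'y::real_normed_vector) integrand \<Rightarrow> (real \<Rightarrow> real ^ 'n) \<Rightarrow>
   'y \<Rightarrow> 'y \<Rightarrow> real \<Rightarrow> real" where
  "DH4_along T \<psi> x p \<omega> t = blinfun_apply (DH4 \<psi> t (x t) (deriv_on T x t) p) \<omega>"

definition envelope_rhs ::
  "real \<Rightarrow> ('n::finite, 'y::real_normed_vector) integrand \<Rightarrow>
   nat \<Rightarrow> (nat \<Rightarrow> ('n, 'y) integrand) \<Rightarrow> nat \<Rightarrow> (nat \<Rightarrow> ('n, 'y) integrand) \<Rightarrow>
   'y \<Rightarrow> (real \<Rightarrow> real ^ 'n) \<Rightarrow> (nat \<Rightarrow> real) \<Rightarrow> (nat \<Rightarrow> real) \<Rightarrow> 'y \<Rightarrow> real" where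
  "envelope_rhs T L k g l h p x lam mu \<omega> =
     (LINT t:{0..T}|lborel. DH4_along T L x p \<omega> t)
     + (\<Sum>i=1..k. lam i * (LINT t:{0..T}|lborel. DH4_along T (g i) x p \<omega> t))
     + (\<Sum>j=1..l. mu j * (LINT t:{0..T}|lborel. DH4_along T (h j) x p \<omega> t))"

end

theory Submission
  imports Defs
begin

text \<open>
  The integral functionals are Lipschitz near the solution and, by dominated convergence, jointly
  Hadamard differentiable there. Condition (Con) and the du Bois-Reymond lemma make the differentials
  of the constraints linearly independent, so there are test functions \<open>e b\<close> dual to them. Along the
  span of the \<open>e b\<close> the Poincare-Miranda theorem solves the constraints exactly, which
  yields the multiplier rule with multipliers \<open>- dL (e a)\<close> and, at a perturbed parameter, an admissible
  competitor that bounds the directional derivative of the value from below by the envelope formula.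
  The upper bound follows by differentiating along the given solutions, whose constraint values have the
  right signs. Near the reference parameter the dual basis persists, the multipliers and the
  differential depend continuously on the parameter, and a continuous Gateaux differential is a
  Frechet differential.
\<close>

section \<open>A Poincare--Miranda theorem on cubes of variable dimension\<close>

text \<open>Differentiability is available only along the given solutions, so the implicit function
  theorem cannot be used; around a solution the functionals are still continuous, which is what a
  Brouwer-type argument needs. Inequality and equality constraints are treated alike, as coordinates
  of one map into a cube of dimension \<open>k + l\<close>. Since inactive inequalities are
  coordinates too, every multiplier is determined by testing stationarity with its own dual
  function. The topological argument yields competitors only along some sequence of steps tending to
  0. That is enough: the value is the objective along the solutions, so the variation of the
  solution map already makes the directional derivative of the value exist, and one sequence
  identifies a limit. In the opposite inequality, the products of multiplier and constraint
  derivative along the solutions are nonnegative: an active inequality cannot decrease, an inactive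
  one has multiplier 0, an equality does not move. For (III), the dual bases at different parameters
  are unrelated choices, so continuity of the multipliers is drawn from the stationarity equations
  tested on one fixed basis.\<close>

lemma bounded_coordinates_convergent_subseq:
  fixes c :: "nat \<Rightarrow> nat \<Rightarrow> real"
  assumes "\<And>m i. i < N \<Longrightarrow> \<bar>c m i\<bar> \<le> B"
  obtains r c' where "strict_mono (r :: nat \<Rightarrow> nat)"
    "\<And>i. i < N \<Longrightarrow> (\<lambda>m. c (r m) i) \<longlonglongrightarrow> c' i" "\<And>i. i < N \<Longrightarrow> \<bar>c' i\<bar> \<le> B"
proof -
  have "\<exists>r c'. strict_mono (r :: nat \<Rightarrow> nat) \<and> (\<forall>i<N. (\<lambda>m. c (r m) i) \<longlonglongrightarrow> c' i)"
    using assms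
  proof (induction N)
    case 0
    then show ?case
      by (auto intro!: exI[of _ id] simp: strict_mono_def)
  next
    case (Suc N)
    then obtain r c' where r: "strict_mono (r :: nat \<Rightarrow> nat)" "\<forall>i<N. (\<lambda>m. c (r m) i) \<longlonglongrightarrow> c' i"
      by (metis less_Suc_eq)
    have "bounded (range (\<lambda>m. c (r m) N))"
      using Suc.prems unfolding bounded_iff by auto
    then obtain l s where s: "strict_mono (s :: nat \<Rightarrow> nat)" "((\<lambda>m. c (r m) N) \<circ> s) \<longlonglongrightarrow> l"
      using bounded_imp_convergent_subsequence by blast
    have "(\<lambda>m. c ((r \<circ> s) m) i) \<longlonglongrightarrow> (c'(N := l)) i" if "i < Suc N" for i
    proof (cases "i = N")
      case True
      then show ?thesis using s by (simp add: o_def)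
    next
      case False
      then have "i < N" using that by simp
      then show ?thesis
        using LIMSEQ_subseq_LIMSEQ[OF r(2)[rule_format] s(1)] by (auto simp: o_def)
    qed
    moreover have "strict_mono (r \<circ> s)"
      using r s by (simp add: strict_mono_o)
    ultimately show ?case by blast
  qed
  then obtain r c' where r: "strict_mono (r :: nat \<Rightarrow> nat)"
    "\<And>i. i < N \<Longrightarrow> (\<lambda>m. c (r m) i) \<longlonglongrightarrow> c' i" by blast
  moreover have "\<bar>c' i\<bar> \<le> B" if "i < N" for i
  proof (rule LIMSEQ_le_const2)
    show "(\<lambda>m. \<bar>c (r m) i\<bar>) \<longlonglongrightarrow> \<bar>c' i\<bar>" using r(2)[OF that] by (rule tendsto_rabs)
  qed (use assms that in auto)
  ultimately show ?thesis using that by blast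
qed

text \<open>
  The dimension is a term, not a type, because the number of constraints is a variable of the theorem.
\<close>

theorem poincare_miranda:
  fixes f :: "nat \<Rightarrow> (nat \<Rightarrow> real) \<Rightarrow> real"
  assumes \<delta>: "\<delta> > 0"
    and cont: "\<And>i c c'. i < N \<Longrightarrow> \<forall>m. \<forall>j<N. \<bar>c m j\<bar> \<le> \<delta> \<Longrightarrow> \<forall>j<N. \<bar>c' j\<bar> \<le> \<delta> \<Longrightarrow>
       \<forall>j<N. (\<lambda>m. c m j) \<longlonglongrightarrow> c' j \<Longrightarrow> (\<lambda>m. f i (c m)) \<longlonglongrightarrow> f i c'"
    and neg: "\<And>i c. i < N \<Longrightarrow> \<forall>j<N. \<bar>c j\<bar> \<le> \<delta> \<Longrightarrow> c i = - \<delta> \<Longrightarrow> f i c \<le> 0"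
    and pos: "\<And>i c. i < N \<Longrightarrow> \<forall>j<N. \<bar>c j\<bar> \<le> \<delta> \<Longrightarrow> c i = \<delta> \<Longrightarrow> f i c \<ge> 0"
  obtains c where "\<And>j. j < N \<Longrightarrow> \<bar>c j\<bar> \<le> \<delta>" "\<And>i. i < N \<Longrightarrow> f i c = 0"
proof -
  \<comment> \<open>The integer grid with coordinates from 0 to \<open>p\<close> is mapped affinely
    onto the cube; the coordinates 0 and \<open>p\<close> become the faces \<open>- \<delta>\<close>
    and \<open>\<delta>\<close>.\<close>
  define grid :: "nat \<Rightarrow> (nat \<Rightarrow> nat) \<Rightarrow> nat \<Rightarrow> real"
    where "grid p y j = 2 * \<delta> * (real (y j) / real p) - \<delta>" for p y j
  have grid_le: "\<bar>grid p y j\<bar> \<le> \<delta>" if "0 < p" "y j \<le> p" for p y j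
  proof -
    have "real (y j) / real p \<le> 1" "0 \<le> real (y j) / real p" using that by auto
    then have "2 * \<delta> * (real (y j) / real p) \<le> 2 * \<delta> * 1" "0 \<le> 2 * \<delta> * (real (y j) / real p)"
      using \<delta> by (intro mult_left_mono mult_nonneg_nonneg; simp)+
    then show ?thesis unfolding grid_def by linarith
  qed
  have near: "\<bar>grid p y j - grid p z j\<bar> \<le> 2 * \<delta> / real p"
    if "0 < p" "z j \<le> y j" "y j \<le> z j + 1" for p y z j
  proof -
    have "grid p y j - grid p z j = 2 * \<delta> / real p * (real (y j) - real (z j))"
      unfolding grid_def by (simp add: field_simps diff_divide_distrib)
    moreover have "\<bar>real (y j) - real (z j)\<bar> \<le> 1" using that by linarith
    then have "\<bar>2 * \<delta> / real p\<bar> * \<bar>real (y j) - real (z j)\<bar> \<le> \<bar>2 * \<delta> / real p\<bar>"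
      by (simp only: mult_left_le abs_ge_zero)
    ultimately show ?thesis
      using \<delta> by (simp add: abs_mult)
  qed
  \<comment> \<open>At mesh \<open>1 / p\<close> each coordinate gets its own pair
    \<open>u i\<close>, \<open>v i\<close> with opposite weak signs of \<open>f i\<close>, all in
    one small cell around a common point \<open>q\<close>. Letting \<open>p\<close> grow merges
    these points.\<close>
  have "\<exists>q u v. (\<forall>j<N. \<bar>q j\<bar> \<le> \<delta>) \<and>
      (\<forall>i<N. (\<forall>j<N. \<bar>u i j\<bar> \<le> \<delta> \<and> \<bar>u i j - q j\<bar> \<le> 2 * \<delta> / real p) \<and>
             (\<forall>j<N. \<bar>v i j\<bar> \<le> \<delta> \<and> \<bar>v i j - q j\<bar> \<le> 2 * \<delta> / real p) \<and>
             f i (u i) \<ge> 0 \<and> f i (v i) \<le> 0)" if p: "0 < p" for p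
  proof -
    \<comment> \<open>Kuhn's lemma demands label 0 on the face \<open>y i = 0\<close> and label 1 on
      \<open>y i = p\<close>. There the label ignores \<open>f\<close>, but \<open>neg\<close> and
      \<open>pos\<close> supply the matching sign, so label 1 always means
      \<open>f i \<ge> 0\<close> and label 0 always means \<open>f i \<le> 0\<close>.\<close>
    define label where "label y i =
      (if y i = p \<or> (y i \<noteq> 0 \<and> f i (grid p y) > 0) then 1 else 0 :: nat)" for y :: "nat \<Rightarrow> nat" and i
    obtain q where q: "\<forall>i<N. q i < p"
      and rs: "\<forall>i<N. \<exists>r s. (\<forall>j<N. q j \<le> r j \<and> r j \<le> q j + 1) \<and>
        (\<forall>j<N. q j \<le> s j \<and> s j \<le> q j + 1) \<and> label r i \<noteq> label s i"
      by (rule kuhn_lemma[of p N label]) (use p in \<open>auto simp: label_def\<close>)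
    have "\<exists>u v. (\<forall>j<N. \<bar>u j\<bar> \<le> \<delta> \<and> \<bar>u j - grid p q j\<bar> \<le> 2 * \<delta> / real p) \<and>
             (\<forall>j<N. \<bar>v j\<bar> \<le> \<delta> \<and> \<bar>v j - grid p q j\<bar> \<le> 2 * \<delta> / real p) \<and>
             f i u \<ge> 0 \<and> f i v \<le> 0" if i: "i < N" for i
    proof -
      obtain r s where r: "\<forall>j<N. q j \<le> r j \<and> r j \<le> q j + 1"
        and s: "\<forall>j<N. q j \<le> s j \<and> s j \<le> q j + 1" and "label r i = 1" "label s i = 0"
      proof -
        obtain r s where "\<forall>j<N. q j \<le> r j \<and> r j \<le> q j + 1"
          "\<forall>j<N. q j \<le> s j \<and> s j \<le> q j + 1" "label r i \<noteq> label s i"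
          using rs i by blast
        moreover have "label y i = 0 \<or> label y i = 1" for y by (simp add: label_def)
        ultimately show ?thesis using that by metis
      qed
      have r_p: "\<forall>j<N. r j \<le> p" and s_p: "\<forall>j<N. s j \<le> p"
        using q r s by fastforce+
      have "f i (grid p r) \<ge> 0"
      proof (cases "r i = p")
        case True
        then have "grid p r i = \<delta>" using p by (simp add: grid_def)
        then show ?thesis using pos[OF i] grid_le[OF p] r_p by blast
      next
        case False
        then show ?thesis using \<open>label r i = 1\<close> by (simp add: label_def split: if_splits)
      qed
      moreover have "f i (grid p s) \<le> 0"
      proof (cases "s i = 0")
        case True
        then have "grid p s i = - \<delta>" by (simp add: grid_def)
        then show ?thesis using neg[OF i] grid_le[OF p] s_p by blast
      next
        case False
        then show ?thesis using \<open>label s i = 0\<close> by (simp add: label_def split: if_splits)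
      qed
      moreover have "\<forall>j<N. \<bar>grid p y j\<bar> \<le> \<delta> \<and> \<bar>grid p y j - grid p q j\<bar> \<le> 2 * \<delta> / real p"
        if "\<forall>j<N. q j \<le> y j \<and> y j \<le> q j + 1" "\<forall>j<N. y j \<le> p" for y
        using grid_le[OF p] near[OF p] that by simp
      ultimately show ?thesis
        using r s r_p s_p by (intro exI[of _ "grid p r"] exI[of _ "grid p s"] conjI) simp_all
    qed
    then obtain u v where "\<forall>i<N. (\<forall>j<N. \<bar>u i j\<bar> \<le> \<delta> \<and> \<bar>u i j - grid p q j\<bar> \<le> 2 * \<delta> / real p) \<and>
             (\<forall>j<N. \<bar>v i j\<bar> \<le> \<delta> \<and> \<bar>v i j - grid p q j\<bar> \<le> 2 * \<delta> / real p) \<and>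
             f i (u i) \<ge> 0 \<and> f i (v i) \<le> 0" by metis
    moreover have "\<forall>j<N. \<bar>grid p q j\<bar> \<le> \<delta>" using grid_le[OF p] q by (simp add: less_imp_le)
    ultimately show ?thesis by blast
  qed
  then have "\<forall>m. \<exists>q u v. (\<forall>j<N. \<bar>q j\<bar> \<le> \<delta>) \<and>
      (\<forall>i<N. (\<forall>j<N. \<bar>u i j\<bar> \<le> \<delta> \<and> \<bar>u i j - q j\<bar> \<le> 2 * \<delta> / real (Suc m)) \<and>
             (\<forall>j<N. \<bar>v i j\<bar> \<le> \<delta> \<and> \<bar>v i j - q j\<bar> \<le> 2 * \<delta> / real (Suc m)) \<and>
             f i (u i) \<ge> 0 \<and> f i (v i) \<le> 0)"
    by blast
  then obtain q u v where quv: "\<And>m. (\<forall>j<N. \<bar>q m j\<bar> \<le> \<delta>) \<and>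
      (\<forall>i<N. (\<forall>j<N. \<bar>u m i j\<bar> \<le> \<delta> \<and> \<bar>u m i j - q m j\<bar> \<le> 2 * \<delta> / real (Suc m)) \<and>
             (\<forall>j<N. \<bar>v m i j\<bar> \<le> \<delta> \<and> \<bar>v m i j - q m j\<bar> \<le> 2 * \<delta> / real (Suc m)) \<and>
             f i (u m i) \<ge> 0 \<and> f i (v m i) \<le> 0)"
    by metis
  \<comment> \<open>Compactness is applied to the cell points \<open>q\<close> only;
    \<open>u\<close> and \<open>v\<close> follow because their distance to \<open>q\<close> tends to
    0.\<close>
  obtain r c where r: "strict_mono (r :: nat \<Rightarrow> nat)" and
    c: "\<And>i. i < N \<Longrightarrow> (\<lambda>m. q (r m) i) \<longlonglongrightarrow> c i" "\<And>i. i < N \<Longrightarrow> \<bar>c i\<bar> \<le> \<delta>"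
    using bounded_coordinates_convergent_subseq[of N q \<delta>] quv by metis
  have z: "(\<lambda>m. 2 * \<delta> / real (Suc (r m))) \<longlonglongrightarrow> 0"
    using LIMSEQ_subseq_LIMSEQ[OF lim_const_over_n[of "2 * \<delta>", THEN LIMSEQ_Suc] r]
    by (simp add: o_def)
  have close_lim: "(\<lambda>m. w (r m) j) \<longlonglongrightarrow> c j"
    if "j < N" "\<And>m. \<bar>w m j - q m j\<bar> \<le> 2 * \<delta> / real (Suc m)" for w :: "nat \<Rightarrow> nat \<Rightarrow> real" and j
  proof -
    have "(\<lambda>m. w (r m) j - q (r m) j) \<longlonglongrightarrow> 0"
      by (rule Lim_null_comparison[OF _ z]) (use that in \<open>auto intro!: always_eventually\<close>)
    from tendsto_add[OF this c(1)[OF that(1)]] show ?thesis by simp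
  qed
  have "f i c = 0" if i: "i < N" for i
  proof (rule antisym)
    have "(\<lambda>m. f i (u (r m) i)) \<longlonglongrightarrow> f i c"
      by (rule cont[OF i]) (use quv i c close_lim[of _ "\<lambda>m. u m i"] in auto)
    then show "0 \<le> f i c"
      by (rule LIMSEQ_le_const) (use quv i in auto)
    have "(\<lambda>m. f i (v (r m) i)) \<longlonglongrightarrow> f i c"
      by (rule cont[OF i]) (use quv i c close_lim[of _ "\<lambda>m. v m i"] in auto)
    then show "f i c \<le> 0"
      by (rule LIMSEQ_le_const2) (use quv i in auto)
  qed
  then show ?thesis using that c(2) by blast
qed

text \<open>
  A surjectivity statement under mere differentiability: \<open>f i s c\<close> is a difference quotient
  with step \<open>s\<close> which tends to the coordinate \<open>c i\<close>. On a small cube it has the signs required by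
  \<open>poincare_miranda\<close>.
\<close>

lemma zeros_of_perturbed_coordinates:
  fixes f :: "nat \<Rightarrow> real \<Rightarrow> (nat \<Rightarrow> real) \<Rightarrow> real"
  assumes s0: "s0 > 0" and \<delta>0: "\<delta>0 > 0"
    and cont: "\<And>i s c c'. i < N \<Longrightarrow> 0 < s \<Longrightarrow> s < s0 \<Longrightarrow> \<forall>m. \<forall>j<N. \<bar>c m j\<bar> \<le> \<delta>0 \<Longrightarrow>
       \<forall>j<N. \<bar>c' j\<bar> \<le> \<delta>0 \<Longrightarrow> \<forall>j<N. (\<lambda>m. c m j) \<longlonglongrightarrow> c' j \<Longrightarrow> (\<lambda>m. f i s (c m)) \<longlonglongrightarrow> f i s c'"
    and lim: "\<And>i s c c'. i < N \<Longrightarrow> \<forall>m. 0 < s m \<Longrightarrow> s \<longlonglongrightarrow> 0 \<Longrightarrow>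
       \<forall>m. \<forall>j<N. \<bar>c m j\<bar> \<le> \<delta>0 \<Longrightarrow> \<forall>j<N. (\<lambda>m. c m j) \<longlonglongrightarrow> c' j \<Longrightarrow> (\<lambda>m. f i (s m) (c m)) \<longlonglongrightarrow> c' i"
  obtains s c where "\<And>m. 0 < s m" "\<And>m. s m < s0" "s \<longlonglongrightarrow> 0"
    "\<And>m j. j < N \<Longrightarrow> \<bar>c m j\<bar> \<le> \<delta>0" "\<And>j. j < N \<Longrightarrow> (\<lambda>m. c m j) \<longlonglongrightarrow> 0"
    "\<And>m i. i < N \<Longrightarrow> f i (s m) (c m) = 0"
proof -
  have ex: "\<exists>s c. 0 < s \<and> s < \<epsilon> \<and> (\<forall>j<N. \<bar>c j\<bar> \<le> \<epsilon>) \<and> (\<forall>i<N. f i s c = 0)"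
    if \<epsilon>: "0 < \<epsilon>" "\<epsilon> \<le> s0" "\<epsilon> \<le> \<delta>0" for \<epsilon>
  proof (rule ccontr)
    assume none: "\<not> ?thesis"
    \<comment> \<open>The ways in which Poincare-Miranda can fail at step \<open>s\<close>: a point
      on a face of the cube where \<open>f i\<close> has strictly the wrong sign.\<close>
    define bad where "bad s i c \<longleftrightarrow> i < N \<and> (\<forall>j<N. \<bar>c j\<bar> \<le> \<epsilon>) \<and>
      (c i = - \<epsilon> \<and> f i s c > 0 \<or> c i = \<epsilon> \<and> f i s c < 0)" for s i c
    have "\<exists>i c. bad s i c" if s: "0 < s" "s < \<epsilon>" for s
    proof (rule ccontr)
      assume nb: "\<not> ?thesis"
      have "\<exists>c. (\<forall>j<N. \<bar>c j\<bar> \<le> \<epsilon>) \<and> (\<forall>i<N. f i s c = 0)"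
      proof (rule poincare_miranda[OF \<epsilon>(1), of N "\<lambda>i. f i s"])
        fix i :: nat and c :: "nat \<Rightarrow> nat \<Rightarrow> real" and c' :: "nat \<Rightarrow> real"
        assume "i < N" "\<forall>m. \<forall>j<N. \<bar>c m j\<bar> \<le> \<epsilon>" "\<forall>j<N. \<bar>c' j\<bar> \<le> \<epsilon>"
          "\<forall>j<N. (\<lambda>m. c m j) \<longlonglongrightarrow> c' j"
        then show "(\<lambda>m. f i s (c m)) \<longlonglongrightarrow> f i s c'"
          using s \<epsilon> by (intro cont) (auto intro: order_trans)
      next
        fix i :: nat and c :: "nat \<Rightarrow> real"
        assume "i < N" "\<forall>j<N. \<bar>c j\<bar> \<le> \<epsilon>" "c i = - \<epsilon>"
        then show "f i s c \<le> 0" using nb bad_def[of s i c] by (metis linorder_not_le)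
      next
        fix i :: nat and c :: "nat \<Rightarrow> real"
        assume "i < N" "\<forall>j<N. \<bar>c j\<bar> \<le> \<epsilon>" "c i = \<epsilon>"
        then show "0 \<le> f i s c" using nb bad_def[of s i c] by (metis linorder_not_le)
      qed blast
      then show False using none s by blast
    qed
    moreover have "0 < \<epsilon> / real (m + 2)" "\<epsilon> / real (m + 2) < \<epsilon>" for m
      using \<epsilon> by (simp_all add: field_simps add_pos_nonneg)
    ultimately have "\<forall>m. \<exists>i c. bad (\<epsilon> / real (m + 2)) i c" by blast
    then obtain i c where ic: "\<And>m. bad (\<epsilon> / real (m + 2)) (i m) (c m)" by metis
    have "i m < N" for m using ic[of m] by (simp add: bad_def)
    \<comment> \<open>There are only finitely many coordinates, so a single \<open>i0\<close> is to
      blame for infinitely many of the steps.\<close>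
    then have "finite (range i)" by (meson finite_lessThan finite_subset image_subsetI lessThan_iff)
    then obtain m0 where "infinite {m \<in> UNIV. i m = i m0}"
      using pigeonhole_infinite[of UNIV i] by auto
    define i0 where "i0 = i m0"
    obtain r where r: "strict_mono (r :: nat \<Rightarrow> nat)" "\<And>m. i (r m) = i0"
      using infinite_enumerate[OF \<open>infinite {m \<in> UNIV. i m = i m0}\<close>] i0_def by blast
    have "i0 < N" using r(2) \<open>\<And>m. i m < N\<close> by metis
    have "\<bar>c (r m) j\<bar> \<le> \<epsilon>" if "j < N" for m j
      using ic[of "r m"] that by (simp add: bad_def)
    then obtain r' c' where r': "strict_mono (r' :: nat \<Rightarrow> nat)"
      "\<And>j. j < N \<Longrightarrow> (\<lambda>m. c (r (r' m)) j) \<longlonglongrightarrow> c' j" "\<And>j. j < N \<Longrightarrow> \<bar>c' j\<bar> \<le> \<epsilon>"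
      using bounded_coordinates_convergent_subseq[of N "\<lambda>m. c (r m)" \<epsilon>] by metis
    define \<sigma> where "\<sigma> m = \<epsilon> / real (r (r' m) + 2)" for m
    define d where "d m = c (r (r' m))" for m
    have bd: "bad (\<sigma> m) i0 (d m)" for m
      using ic[of "r (r' m)"] r(2) by (simp add: \<sigma>_def d_def)
    have "(\<lambda>m. \<epsilon> / real (m + 2)) \<longlonglongrightarrow> 0"
      using LIMSEQ_ignore_initial_segment[OF lim_const_over_n[of \<epsilon>], of 2] by simp
    then have \<sigma>0: "\<sigma> \<longlonglongrightarrow> 0"
      using LIMSEQ_subseq_LIMSEQ[OF _ strict_mono_o[OF r(1) r'(1)]] unfolding \<sigma>_def o_def by blast
    have conv: "(\<lambda>m. f i0 (\<sigma> m) (d m)) \<longlonglongrightarrow> c' i0"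
    proof (rule lim[OF \<open>i0 < N\<close> _ \<sigma>0])
      show "\<forall>m. 0 < \<sigma> m" using \<epsilon> by (simp add: \<sigma>_def add_nonneg_pos)
      show "\<forall>m. \<forall>j<N. \<bar>d m j\<bar> \<le> \<delta>0"
        using bd \<epsilon>(3) unfolding bad_def by (metis order_trans)
      show "\<forall>j<N. (\<lambda>m. d m j) \<longlonglongrightarrow> c' j" using r' by (simp add: d_def)
    qed
    have dconv: "(\<lambda>m. d m i0) \<longlonglongrightarrow> c' i0" using r'(2)[OF \<open>i0 < N\<close>] by (simp add: d_def)
    \<comment> \<open>The wrong sign makes this product nonpositive, whereas \<open>lim\<close>
      turns its limit into a square; the modulus of \<open>d m i0\<close> is always \<epsilon>, so
      that square is positive.\<close>
    have "(\<lambda>m. d m i0 * f i0 (\<sigma> m) (d m)) \<longlonglongrightarrow> c' i0 * c' i0"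
      by (intro tendsto_intros conv dconv)
    moreover have "d m i0 * f i0 (\<sigma> m) (d m) \<le> 0" for m
      using bd[of m] \<epsilon>(1) unfolding bad_def by (auto simp: mult_le_0_iff)
    ultimately have "c' i0 * c' i0 \<le> 0"
      by (meson LIMSEQ_le_const2)
    moreover have "(\<lambda>m. \<bar>d m i0\<bar>) \<longlonglongrightarrow> \<bar>c' i0\<bar>" using dconv by (rule tendsto_rabs)
    moreover have "\<bar>d m i0\<bar> = \<epsilon>" for m
      using bd[of m] \<epsilon>(1) unfolding bad_def by auto
    ultimately show False
      using \<epsilon>(1) by (auto simp: LIMSEQ_const_iff mult_le_0_iff)
  qed
  define \<mu> where "\<mu> = min s0 \<delta>0"
  have \<mu>: "0 < \<mu>" "\<mu> \<le> s0" "\<mu> \<le> \<delta>0" using s0 \<delta>0 by (auto simp: \<mu>_def)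
  \<comment> \<open>One zero is taken in each of a sequence of shrinking cubes with shrinking step
    bounds, which sends both the steps and the coefficients to 0.\<close>
  define e where "e m = \<mu> / real (Suc m)" for m
  have e: "0 < e m" "e m \<le> s0" "e m \<le> \<delta>0" for m
  proof -
    have "\<mu> * 1 \<le> \<mu> * real (Suc m)" using \<mu> by (intro mult_left_mono) auto
    then have "e m \<le> \<mu>" by (simp add: e_def divide_le_eq)
    then show "0 < e m" "e m \<le> s0" "e m \<le> \<delta>0" using \<mu> by (auto simp: e_def)
  qed
  have e0: "e \<longlonglongrightarrow> 0"
    unfolding e_def using lim_const_over_n[of \<mu>, THEN LIMSEQ_Suc] by simp
  obtain s c where sc: "\<And>m. 0 < s m \<and> s m < e m \<and> (\<forall>j<N. \<bar>c m j\<bar> \<le> e m) \<and> (\<forall>i<N. f i (s m) (c m) = 0)"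
    using ex[OF e] by metis
  show ?thesis
  proof (rule that[of s c])
    show "s \<longlonglongrightarrow> 0"
      by (rule Lim_null_comparison[OF _ e0]) (use sc in \<open>auto intro!: always_eventually simp: less_imp_le\<close>)
    show "(\<lambda>m. c m j) \<longlonglongrightarrow> 0" if "j < N" for j
      by (rule Lim_null_comparison[OF _ e0]) (use sc that in \<open>auto intro!: always_eventually\<close>)
    show "s m < s0" for m using sc[of m] e(2)[of m] by linarith
    show "\<bar>c m j\<bar> \<le> \<delta>0" if "j < N" for m j using sc[of m] e(3)[of m] that by fastforce
  qed (use sc in auto)
qed

section \<open>Dual bases\<close>

text \<open>Gram-Schmidt-like induction on the number of functionals: a new vector is projected into
  the common kernel of the old functionals and normalized, and then the old vectors are corrected so
  that the new functional vanishes on them. Linearity is assumed on the set \<open>X\<close> only,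
  because the functionals are integrals over representatives.\<close>

lemma dual_basis:
  fixes \<phi> :: "nat \<Rightarrow> ('b \<Rightarrow> 'a::real_vector) \<Rightarrow> real"
  assumes add: "\<And>x y. x \<in> X \<Longrightarrow> y \<in> X \<Longrightarrow> (\<lambda>t. x t + y t) \<in> X"
    and scale: "\<And>c x. x \<in> X \<Longrightarrow> (\<lambda>t. c *\<^sub>R x t) \<in> X"
    and zero: "(\<lambda>t. 0) \<in> X"
    and phi_add: "\<And>a x y. a < N \<Longrightarrow> x \<in> X \<Longrightarrow> y \<in> X \<Longrightarrow> \<phi> a (\<lambda>t. x t + y t) = \<phi> a x + \<phi> a y"
    and phi_scale: "\<And>a c x. a < N \<Longrightarrow> x \<in> X \<Longrightarrow> \<phi> a (\<lambda>t. c *\<^sub>R x t) = c * \<phi> a x"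
    and indep: "\<And>\<nu>. \<forall>x\<in>X. (\<Sum>a<N. \<nu> a * \<phi> a x) = 0 \<Longrightarrow> \<forall>a<N. \<nu> a = 0"
  shows "\<exists>e. (\<forall>b<N. e b \<in> X) \<and> (\<forall>a<N. \<forall>b<N. \<phi> a (e b) = (if a = b then 1 else 0))"
  using phi_add phi_scale indep
proof (induction N)
  case 0
  then show ?case by simp
next
  case (Suc N)
  note padd = Suc.prems(1) and pscale = Suc.prems(2)
  have "\<exists>e. (\<forall>b<N. e b \<in> X) \<and> (\<forall>a<N. \<forall>b<N. \<phi> a (e b) = (if a = b then 1 else 0))"
  proof (rule Suc.IH)
    fix \<nu> :: "nat \<Rightarrow> real" assume *: "\<forall>x\<in>X. (\<Sum>a<N. \<nu> a * \<phi> a x) = 0"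
    have "\<forall>x\<in>X. (\<Sum>a<Suc N. (\<nu>(N := 0)) a * \<phi> a x) = 0" using * by simp
    from Suc.prems(3)[OF this] show "\<forall>a<N. \<nu> a = 0"
      by (metis fun_upd_other less_Suc_eq less_irrefl)
  qed (use Suc.prems in auto)
  then obtain e where eX: "\<And>b. b < N \<Longrightarrow> e b \<in> X"
    and dual: "\<And>a b. a < N \<Longrightarrow> b < N \<Longrightarrow> \<phi> a (e b) = (if a = b then 1 else 0)" by metis
  have sumX: "(\<lambda>t. \<Sum>b<n. c b *\<^sub>R e b t) \<in> X" if "n \<le> N" for c n
    using that
  proof (induction n)
    case (Suc n)
    then show ?case using add[OF Suc.IH scale[OF eX]] by simp
  qed (simp add: zero)
  have phi_sum: "\<phi> a (\<lambda>t. \<Sum>b<n. c b *\<^sub>R e b t) = (\<Sum>b<n. c b * \<phi> a (e b))"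
    if "n \<le> N" "a < Suc N" for a c n
    using that
  proof (induction n)
    case 0
    have "\<phi> a (\<lambda>t. 0 *\<^sub>R 0) = 0 * \<phi> a (\<lambda>t. 0)" using pscale[OF that(2) zero] .
    then show ?case by simp
  next
    case (Suc n)
    then show ?case
      using padd[OF that(2) sumX[of n] scale[OF eX[of n]]] pscale[OF that(2) eX[of n]] by simp
  qed
  \<comment> \<open>These are the coefficients of \<open>\<phi> N\<close> minus its combination of
    the old functionals that agrees with it on all \<open>e b\<close>. Independence provides an
    \<open>x\<close> where this difference is nonzero, and its value there is
    \<open>\<phi> N y\<close> for the projection \<open>y\<close> below.\<close>
  define \<nu> where "\<nu> a = (if a = N then 1 else - \<phi> N (e a))" for a
  have "\<not> (\<forall>a<Suc N. \<nu> a = 0)" by (auto simp: \<nu>_def)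
  then obtain x where x: "x \<in> X" "(\<Sum>a<Suc N. \<nu> a * \<phi> a x) \<noteq> 0"
    using Suc.prems(3) by blast
  define y where "y t = x t + (\<Sum>b<N. (- \<phi> b x) *\<^sub>R e b t)" for t
  have yX: "y \<in> X"
    unfolding y_def by (rule add[OF x(1) sumX]) simp
  have phi_y: "\<phi> a y = \<phi> a x + (\<Sum>b<N. (- \<phi> b x) * \<phi> a (e b))" if "a < Suc N" for a
    unfolding y_def by (subst padd[OF that x(1) sumX]) (simp_all only: order_refl phi_sum[OF _ that])
  have y0: "\<phi> a y = 0" if "a < N" for a
    using that by (simp add: phi_y dual if_distrib cong: if_cong)
  have yN: "\<phi> N y \<noteq> 0"
    using x(2) by (simp add: phi_y \<nu>_def sum_negf mult.commute algebra_simps)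
  define eN where "eN t = (1 / \<phi> N y) *\<^sub>R y t" for t
  have eNX: "eN \<in> X" unfolding eN_def by (rule scale[OF yX])
  have phi_eN: "\<phi> a eN = (if a = N then 1 else 0)" if "a < Suc N" for a
    unfolding eN_def using pscale[OF that yX] y0[of a] yN that by auto
  \<comment> \<open>Adding a multiple of \<open>eN\<close> does not disturb the old functionals,
    which vanish on \<open>eN\<close>.\<close>
  define e' where "e' b = (if b = N then eN else (\<lambda>t. e b t + (- \<phi> N (e b)) *\<^sub>R eN t))" for b
  show ?case
  proof (intro exI[of _ e'] conjI allI impI)
    fix b assume "b < Suc N"
    then show "e' b \<in> X"
      using add[OF eX[of b] scale[OF eNX, of "- \<phi> N (e b)"]] eNX by (auto simp: e'_def)
  next
    fix a b assume ab: "a < Suc N" "b < Suc N"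
    show "\<phi> a (e' b) = (if a = b then 1 else 0)"
    proof (cases "b = N")
      case True
      then show ?thesis using phi_eN[OF ab(1)] by (simp add: e'_def)
    next
      case False
      then have "\<phi> a (e' b) = \<phi> a (e b) - \<phi> N (e b) * \<phi> a eN"
        using padd[OF ab(1) eX[of b] scale[OF eNX, of "- \<phi> N (e b)"]]
          pscale[OF ab(1) eNX, of "- \<phi> N (e b)"] ab by (simp add: e'_def)
      then show ?thesis using phi_eN[OF ab(1)] dual[of a b] ab False by (cases "a = N") auto
    qed
  qed
qed

section \<open>The space of continuously differentiable functions\<close>

lemma C1_spaceI:
  assumes "\<And>t. t \<in> {0..T} \<Longrightarrow> (x has_vector_derivative x' t) (at t within {0..T})"
    "continuous_on {0..T} x'"
  shows "x \<in> C1_space T"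
  using assms unfolding C1_space_def by blast

lemma deriv_on_eqI:
  fixes x :: "real \<Rightarrow> 'a::real_normed_vector"
  assumes "T > 0" "t \<in> {0..T}" "(x has_vector_derivative d) (at t within {0..T})"
  shows "deriv_on T x t = d"
  unfolding deriv_on_def
proof (rule vector_derivative_within)
  show "at t within {0..T} \<noteq> bot"
    using assms by (simp add: trivial_limit_within islimpt_Icc)
qed (rule assms(3))

lemma has_vector_derivative_deriv_on:
  assumes "T > 0" "x \<in> C1_space T" "t \<in> {0..T}"
  shows "(x has_vector_derivative deriv_on T x t) (at t within {0..T})"
  using assms deriv_on_eqI[of T t x] unfolding C1_space_def by fastforce

lemma continuous_on_deriv_on:
  assumes "T > 0" "x \<in> C1_space T"
  shows "continuous_on {0..T} (deriv_on T x)"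
proof -
  obtain x' where x': "\<forall>t\<in>{0..T}. (x has_vector_derivative x' t) (at t within {0..T})"
    "continuous_on {0..T} x'"
    using assms(2) unfolding C1_space_def by auto
  then have "deriv_on T x t = x' t" if "t \<in> {0..T}" for t
    using deriv_on_eqI[OF assms(1) that] that by blast
  then show ?thesis using x'(2) continuous_on_cong by metis
qed

lemma C1_space_continuous_on:
  assumes "x \<in> C1_space T"
  shows "continuous_on {0..T} x"
  using assms unfolding C1_space_def
  by (auto simp: continuous_on_eq_continuous_within intro: has_vector_derivative_continuous)

lemma C1_space_const: "(\<lambda>t. c) \<in> C1_space T"
  by (rule C1_spaceI[where x' = "\<lambda>t. 0"]) auto

context
  fixes T :: real
  assumes T: "T > 0"
begin

lemma C1_space_add:
  assumes "x \<in> C1_space T" "y \<in> C1_space T"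
  shows "(\<lambda>t. x t + y t) \<in> C1_space T"
    and deriv_on_add: "t \<in> {0..T} \<Longrightarrow> deriv_on T (\<lambda>t. x t + y t) t = deriv_on T x t + deriv_on T y t"
proof -
  have *: "((\<lambda>t. x t + y t) has_vector_derivative deriv_on T x t + deriv_on T y t) (at t within {0..T})"
    if "t \<in> {0..T}" for t
    by (intro derivative_intros has_vector_derivative_deriv_on T assms that)
  show "(\<lambda>t. x t + y t) \<in> C1_space T"
    by (rule C1_spaceI[OF *]) (auto intro!: continuous_intros continuous_on_deriv_on T assms)
  show "t \<in> {0..T} \<Longrightarrow> deriv_on T (\<lambda>t. x t + y t) t = deriv_on T x t + deriv_on T y t"
    by (rule deriv_on_eqI[OF T _ *])
qed

lemma C1_space_scaleR:
  assumes "x \<in> C1_space T"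
  shows "(\<lambda>t. c *\<^sub>R x t) \<in> C1_space T"
    and deriv_on_scaleR: "t \<in> {0..T} \<Longrightarrow> deriv_on T (\<lambda>t. c *\<^sub>R x t) t = c *\<^sub>R deriv_on T x t"
proof -
  have *: "((\<lambda>t. c *\<^sub>R x t) has_vector_derivative c *\<^sub>R deriv_on T x t) (at t within {0..T})"
    if "t \<in> {0..T}" for t
    using bounded_linear.has_vector_derivative[OF bounded_linear_scaleR_right
        has_vector_derivative_deriv_on[OF T assms that]] .
  show "(\<lambda>t. c *\<^sub>R x t) \<in> C1_space T"
    by (rule C1_spaceI[OF *]) (auto intro!: continuous_intros continuous_on_deriv_on T assms)
  show "t \<in> {0..T} \<Longrightarrow> deriv_on T (\<lambda>t. c *\<^sub>R x t) t = c *\<^sub>R deriv_on T x t"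
    by (rule deriv_on_eqI[OF T _ *])
qed

lemma C1_space_diff:
  assumes "x \<in> C1_space T" "y \<in> C1_space T"
  shows "(\<lambda>t. x t - y t) \<in> C1_space T"
    and deriv_on_diff: "t \<in> {0..T} \<Longrightarrow> deriv_on T (\<lambda>t. x t - y t) t = deriv_on T x t - deriv_on T y t"
  using C1_space_add[OF assms(1) C1_space_scaleR(1)[OF assms(2), of "-1"]]
    deriv_on_add[OF assms(1) C1_space_scaleR(1)[OF assms(2), of "-1"], of t]
    deriv_on_scaleR[OF assms(2), of t "-1"] by simp_all

lemma C1_space_sum:
  fixes n :: nat
  assumes "\<And>b. b < n \<Longrightarrow> e b \<in> C1_space T"
  shows "(\<lambda>t. \<Sum>b<n. c b *\<^sub>R e b t) \<in> C1_space T"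
  using assms
proof (induction n)
  case (Suc n)
  then show ?case using C1_space_add(1)[OF Suc.IH C1_space_scaleR(1)[of "e n"]] by simp
qed (simp add: C1_space_const)

lemma norm_le_C1_norm:
  assumes "x \<in> C1_space T" "t \<in> {0..T}"
  shows "norm (x t) \<le> C1_norm T x" and norm_deriv_on_le_C1_norm: "norm (deriv_on T x t) \<le> C1_norm T x"
proof -
  have bdd: "bdd_above ((\<lambda>t. norm (f t)) ` {0..T})" if "continuous_on {0..T} f" for f :: "real \<Rightarrow> 'a"
    using that by (intro bounded_imp_bdd_above compact_imp_bounded compact_continuous_image
        continuous_intros) auto
  have 1: "norm (x t) \<le> (SUP t\<in>{0..T}. norm (x t))"
    by (rule cSUP_upper[OF assms(2) bdd[OF C1_space_continuous_on[OF assms(1)]]])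
  have 2: "norm (deriv_on T x t) \<le> (SUP t\<in>{0..T}. norm (deriv_on T x t))"
    by (rule cSUP_upper[OF assms(2) bdd[OF continuous_on_deriv_on[OF T assms(1)]]])
  have "0 \<le> (SUP t\<in>{0..T}. norm (x t))" "0 \<le> (SUP t\<in>{0..T}. norm (deriv_on T x t))"
    using 1 2 norm_ge_zero order_trans by blast+
  with 1 2 show "norm (x t) \<le> C1_norm T x" "norm (deriv_on T x t) \<le> C1_norm T x"
    unfolding C1_norm_def by linarith+
qed

lemma C1_norm_nonneg: "x \<in> C1_space T \<Longrightarrow> 0 \<le> C1_norm T x"
  using norm_le_C1_norm(1)[of x 0] T by (meson atLeastAtMost_iff le_less norm_ge_zero order_trans)

lemma C1_norm_le:
  assumes "\<And>t. t \<in> {0..T} \<Longrightarrow> norm (x t) \<le> a" "\<And>t. t \<in> {0..T} \<Longrightarrow> norm (deriv_on T x t) \<le> b"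
  shows "C1_norm T x \<le> a + b"
  unfolding C1_norm_def using T assms by (intro add_mono cSUP_least) auto

lemma C1_norm_triangle:
  assumes "x \<in> C1_space T" "y \<in> C1_space T"
  shows "C1_norm T (\<lambda>t. x t + y t) \<le> C1_norm T x + C1_norm T y"
proof -
  have bdd: "bdd_above ((\<lambda>t. norm (f t)) ` {0..T})" if "continuous_on {0..T} f" for f :: "real \<Rightarrow> 'a"
    using that by (intro bounded_imp_bdd_above compact_imp_bounded compact_continuous_image
        continuous_intros) auto
  have "norm (x t + y t) \<le> (SUP t\<in>{0..T}. norm (x t)) + (SUP t\<in>{0..T}. norm (y t))" if "t \<in> {0..T}" for t
    using cSUP_upper[OF that bdd[OF C1_space_continuous_on[OF assms(1)]]]
      cSUP_upper[OF that bdd[OF C1_space_continuous_on[OF assms(2)]]] norm_triangle_ineq[of "x t" "y t"]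
    by linarith
  moreover have "norm (deriv_on T (\<lambda>t. x t + y t) t)
      \<le> (SUP t\<in>{0..T}. norm (deriv_on T x t)) + (SUP t\<in>{0..T}. norm (deriv_on T y t))"
    if "t \<in> {0..T}" for t
    using cSUP_upper[OF that bdd[OF continuous_on_deriv_on[OF T assms(1)]]] deriv_on_add[OF assms that]
      cSUP_upper[OF that bdd[OF continuous_on_deriv_on[OF T assms(2)]]]
      norm_triangle_ineq[of "deriv_on T x t" "deriv_on T y t"]
    by simp
  ultimately have "C1_norm T (\<lambda>t. x t + y t) \<le>
      ((SUP t\<in>{0..T}. norm (x t)) + (SUP t\<in>{0..T}. norm (y t))) +
      ((SUP t\<in>{0..T}. norm (deriv_on T x t)) + (SUP t\<in>{0..T}. norm (deriv_on T y t)))"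
    by (rule C1_norm_le)
  then show ?thesis unfolding C1_norm_def[of T x] C1_norm_def[of T y] by linarith
qed

text \<open>The factor 2 is not sharp: each of the two suprema is bounded by the whole norm. Only
  convergence to 0 and crude bounds are drawn from it.\<close>

lemma C1_norm_scaleR_le:
  assumes "x \<in> C1_space T"
  shows "C1_norm T (\<lambda>t. c *\<^sub>R x t) \<le> \<bar>c\<bar> * (2 * C1_norm T x)"
proof -
  have "C1_norm T (\<lambda>t. c *\<^sub>R x t) \<le> \<bar>c\<bar> * C1_norm T x + \<bar>c\<bar> * C1_norm T x"
    using norm_le_C1_norm(1)[OF assms] norm_deriv_on_le_C1_norm[OF assms] deriv_on_scaleR[OF assms]
    by (intro C1_norm_le) (auto intro!: mult_left_mono)
  then show ?thesis by (simp add: algebra_simps)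
qed

lemma C1_norm_zero: "C1_norm T (\<lambda>t. 0 :: 'a::real_normed_vector) = 0"
  using C1_norm_scaleR_le[OF C1_space_const[of "0 :: 'a" T], of 0] C1_norm_nonneg[OF C1_space_const[of "0 :: 'a" T]]
  by simp

lemma C1_norm_sum_tendsto_0:
  fixes n :: nat and e :: "nat \<Rightarrow> real \<Rightarrow> 'a::real_normed_vector"
  assumes "\<And>b. b < n \<Longrightarrow> e b \<in> C1_space T" "\<And>b. b < n \<Longrightarrow> (\<lambda>m. c m b) \<longlonglongrightarrow> 0"
  shows "(\<lambda>m. C1_norm T (\<lambda>t. \<Sum>b<n. c m b *\<^sub>R e b t)) \<longlonglongrightarrow> 0"
  using assms
proof (induction n)
  case 0
  then show ?case by (simp add: C1_norm_zero)
next
  case (Suc n)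
  have eC: "(\<lambda>t. \<Sum>b<n. c m b *\<^sub>R e b t) \<in> C1_space T" "e n \<in> C1_space T" for m
    using Suc.prems by (auto intro: C1_space_sum)
  have le: "C1_norm T (\<lambda>t. \<Sum>b<Suc n. c m b *\<^sub>R e b t)
      \<le> C1_norm T (\<lambda>t. \<Sum>b<n. c m b *\<^sub>R e b t) + \<bar>c m n\<bar> * (2 * C1_norm T (e n))" for m
    using C1_norm_triangle[OF eC(1) C1_space_scaleR(1)[OF eC(2)], of m "c m n"]
      C1_norm_scaleR_le[OF eC(2), of "c m n"] by simp
  have ge: "0 \<le> C1_norm T (\<lambda>t. \<Sum>b<Suc n. c m b *\<^sub>R e b t)" for m
    using C1_space_sum[of "Suc n" e "c m"] Suc.prems(1) by (intro C1_norm_nonneg) auto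
  have "(\<lambda>m. \<bar>c m n\<bar>) \<longlonglongrightarrow> \<bar>0\<bar>" using Suc.prems(2)[of n] by (intro tendsto_rabs) simp
  then have "(\<lambda>m. C1_norm T (\<lambda>t. \<Sum>b<n. c m b *\<^sub>R e b t) + \<bar>c m n\<bar> * (2 * C1_norm T (e n))) \<longlonglongrightarrow> 0 + \<bar>0\<bar> * (2 * C1_norm T (e n))"
    using Suc by (intro tendsto_intros) auto
  then have "(\<lambda>m. C1_norm T (\<lambda>t. \<Sum>b<n. c m b *\<^sub>R e b t) + \<bar>c m n\<bar> * (2 * C1_norm T (e n))) \<longlonglongrightarrow> 0" by simp
  then show ?case
    by (rule Lim_null_comparison[rotated]) (use le ge in \<open>auto intro!: always_eventually\<close>)
qed

lemma C1_convergence_pointwise: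
  assumes "\<And>m. w m \<in> C1_space T" "v \<in> C1_space T" "(\<lambda>m. C1_norm T (\<lambda>t. w m t - v t)) \<longlonglongrightarrow> 0" "t \<in> {0..T}"
  shows "(\<lambda>m. w m t) \<longlonglongrightarrow> v t" and "(\<lambda>m. deriv_on T (w m) t) \<longlonglongrightarrow> deriv_on T v t"
proof -
  have d: "(\<lambda>t. w m t - v t) \<in> C1_space T" for m using assms by (intro C1_space_diff(1))
  have "(\<lambda>m. w m t - v t) \<longlonglongrightarrow> 0"
    by (rule Lim_null_comparison[OF _ assms(3)])
      (use norm_le_C1_norm(1)[OF d assms(4)] in \<open>auto intro!: always_eventually\<close>)
  then show "(\<lambda>m. w m t) \<longlonglongrightarrow> v t" by (rule LIM_zero_cancel)
  have "(\<lambda>m. deriv_on T (w m) t - deriv_on T v t) \<longlonglongrightarrow> 0"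
    by (rule Lim_null_comparison[OF _ assms(3)])
      (use norm_deriv_on_le_C1_norm[OF d assms(4)] deriv_on_diff[OF assms(1,2,4)] in \<open>auto intro!: always_eventually\<close>)
  then show "(\<lambda>m. deriv_on T (w m) t) \<longlonglongrightarrow> deriv_on T v t" by (rule LIM_zero_cancel)
qed

lemma C1_convergence_bounded:
  assumes "\<And>m. w m \<in> C1_space T" "v \<in> C1_space T" "(\<lambda>m. C1_norm T (\<lambda>t. w m t - v t)) \<longlonglongrightarrow> 0"
  obtains B where "\<And>m t. t \<in> {0..T} \<Longrightarrow> norm (w m t) \<le> B"
    "\<And>m t. t \<in> {0..T} \<Longrightarrow> norm (deriv_on T (w m) t) \<le> B"
proof -
  obtain K where K: "\<And>m. C1_norm T (\<lambda>t. w m t - v t) \<le> K"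
  proof -
    obtain K where "\<And>m. norm (C1_norm T (\<lambda>t. w m t - v t)) \<le> K"
      using convergent_imp_Bseq[OF convergentI[OF assms(3)]] unfolding Bseq_def by blast
    then show ?thesis using that abs_le_D1 real_norm_def by metis
  qed
  have d: "(\<lambda>t. w m t - v t) \<in> C1_space T" for m using assms by (intro C1_space_diff(1))
  show ?thesis
  proof (rule that[of "K + C1_norm T v"])
    fix m t assume t: "t \<in> {0..T}"
    show "norm (w m t) \<le> K + C1_norm T v"
      using norm_le_C1_norm(1)[OF d t, of m] K[of m] norm_le_C1_norm(1)[OF assms(2) t]
        norm_triangle_ineq[of "w m t - v t" "v t"] by simp
    show "norm (deriv_on T (w m) t) \<le> K + C1_norm T v"
      using norm_deriv_on_le_C1_norm[OF d t, of m] K[of m] norm_deriv_on_le_C1_norm[OF assms(2) t]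
        norm_triangle_ineq[of "deriv_on T (w m) t - deriv_on T v t" "deriv_on T v t"]
        deriv_on_diff[OF assms(1,2) t, of m] by simp
  qed
qed

end

section \<open>Hadamard differentials\<close>

lemma has_hadamard_differential_unique:
  assumes "has_hadamard_differential \<phi> x D" "has_hadamard_differential \<phi> x D'"
  shows "D = D'"
proof (rule blinfun_eqI)
  fix v
  have *: "\<forall>m. (0::real) < 1 / real (Suc m)" "(\<lambda>m. 1 / real (Suc m)) \<longlonglongrightarrow> 0"
    using LIMSEQ_Suc[OF lim_1_over_n] by simp_all
  show "blinfun_apply D v = blinfun_apply D' v"
    using assms * tendsto_const[of v sequentially] LIMSEQ_unique
    unfolding has_hadamard_differential_def has_hadamard_variation_def by meson
qed

lemma hadamard_differential_eqI:
  assumes "has_hadamard_differential \<phi> x D"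
  shows "hadamard_differential \<phi> x = D"
  unfolding hadamard_differential_def
  using assms has_hadamard_differential_unique by blast

text \<open>With \<open>A\<close> the inclusion of one factor of the product, this extracts the
  partial differentials from the joint one.\<close>

lemma has_hadamard_differential_compose_affine:
  fixes A :: "'e::real_normed_vector \<Rightarrow>\<^sub>L 'f::real_normed_vector"
  assumes "has_hadamard_differential \<phi> y D" "\<And>z. \<psi> z = \<phi> (y + A (z - x))"
  shows "has_hadamard_differential \<psi> x (D o\<^sub>L A)"
  unfolding has_hadamard_differential_def has_hadamard_variation_def
proof (intro allI impI)
  fix v and \<theta> :: "nat \<Rightarrow> real" and w :: "nat \<Rightarrow> 'e"
  assume *: "\<forall>m. 0 < \<theta> m" "\<theta> \<longlonglongrightarrow> 0" "w \<longlonglongrightarrow> v"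
  have "(\<lambda>m. blinfun_apply A (w m)) \<longlonglongrightarrow> blinfun_apply A v"
    using *(3) by (intro tendsto_intros)
  with * assms(1) have "(\<lambda>m. (1 / \<theta> m) *\<^sub>R (\<phi> (y + \<theta> m *\<^sub>R A (w m)) - \<phi> y)) \<longlonglongrightarrow> D (A v)"
    unfolding has_hadamard_differential_def has_hadamard_variation_def by blast
  then show "(\<lambda>m. (1 / \<theta> m) *\<^sub>R (\<psi> (x + \<theta> m *\<^sub>R w m) - \<psi> x)) \<longlonglongrightarrow> (D o\<^sub>L A) v"
    by (simp add: assms(2) blinfun.scaleR_right)
qed

lemma has_hadamard_differential_scaleR:
  fixes D :: "'e::real_normed_vector \<Rightarrow>\<^sub>L 'f::real_normed_vector"
  assumes "has_hadamard_differential \<phi> x D"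
  shows "has_hadamard_differential (\<lambda>z. c *\<^sub>R \<phi> z) x (c *\<^sub>R D)"
  unfolding has_hadamard_differential_def has_hadamard_variation_def
proof (intro allI impI)
  fix v and \<theta> :: "nat \<Rightarrow> real" and w :: "nat \<Rightarrow> 'e"
  assume *: "\<forall>m. 0 < \<theta> m" "\<theta> \<longlonglongrightarrow> 0" "w \<longlonglongrightarrow> v"
  with assms have "(\<lambda>m. c *\<^sub>R ((1 / \<theta> m) *\<^sub>R (\<phi> (x + \<theta> m *\<^sub>R w m) - \<phi> x))) \<longlonglongrightarrow> c *\<^sub>R D v"
    unfolding has_hadamard_differential_def has_hadamard_variation_def by (intro tendsto_intros) blast
  then show "(\<lambda>m. (1 / \<theta> m) *\<^sub>R (c *\<^sub>R \<phi> (x + \<theta> m *\<^sub>R w m) - c *\<^sub>R \<phi> x)) \<longlonglongrightarrow> (c *\<^sub>R D) v"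
    by (simp add: blinfun.scaleR_left algebra_simps)
qed

lemma has_hadamard_differential_sum:
  fixes D :: "'i \<Rightarrow> 'e::real_normed_vector \<Rightarrow>\<^sub>L 'f::real_normed_vector"
  assumes "\<And>i. i \<in> I \<Longrightarrow> has_hadamard_differential (\<phi> i) x (D i)"
  shows "has_hadamard_differential (\<lambda>z. \<Sum>i\<in>I. \<phi> i z) x (\<Sum>i\<in>I. D i)"
  unfolding has_hadamard_differential_def has_hadamard_variation_def
proof (intro allI impI)
  fix v and \<theta> :: "nat \<Rightarrow> real" and w :: "nat \<Rightarrow> 'e"
  assume *: "\<forall>m. 0 < \<theta> m" "\<theta> \<longlonglongrightarrow> 0" "w \<longlonglongrightarrow> v"
  with assms have "(\<lambda>m. \<Sum>i\<in>I. (1 / \<theta> m) *\<^sub>R (\<phi> i (x + \<theta> m *\<^sub>R w m) - \<phi> i x)) \<longlonglongrightarrow> (\<Sum>i\<in>I. D i v)"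
    unfolding has_hadamard_differential_def has_hadamard_variation_def by (intro tendsto_sum) blast
  then show "(\<lambda>m. (1 / \<theta> m) *\<^sub>R ((\<Sum>i\<in>I. \<phi> i (x + \<theta> m *\<^sub>R w m)) - (\<Sum>i\<in>I. \<phi> i x))) \<longlonglongrightarrow> (\<Sum>i\<in>I. D i) v"
    by (simp add: blinfun.sum_left scaleR_sum_right sum_subtractf algebra_simps)
qed

section \<open>Integral functionals at a regular point\<close>

text \<open>The joint derivative of the integral functional in the curve direction \<open>v\<close>
  and the parameter direction \<omega>. With \<omega> = 0 it is the differential in the curve, which
  enters the multiplier rule; with \<open>v\<close> zero it is the integral of the partial
  differential in the parameter, which enters the envelope formula.\<close>

definition int_differential ::
  "real \<Rightarrow> ('n::finite, 'y::real_normed_vector) integrand \<Rightarrow> (real \<Rightarrow> real ^ 'n) \<Rightarrow> 'y \<Rightarrow>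
   (real \<Rightarrow> real ^ 'n) \<Rightarrow> 'y \<Rightarrow> real" where
  "int_differential T \<psi> x p v \<omega> =
     (LINT t:{0..T}|lborel. DH234 \<psi> t (x t) (deriv_on T x t) p (v t, deriv_on T v t, \<omega>))"

text \<open>One integrand at one curve and one parameter: differentiability along that curve only, a
  Lipschitz bound in a tube around it. The radius and the point are parameters, so the same results
  can be reused at neighbouring solutions with a smaller radius and the same \<xi>.\<close>

locale regular_integrand =
  fixes T r :: real
    and M :: "(real ^ 'n::finite) set"
    and P :: "'y::real_normed_vector set"
    and \<psi> :: "('n, 'y) integrand"
    and x :: "real \<Rightarrow> real ^ 'n"
    and p :: 'y
    and \<xi> :: "real \<Rightarrow> real"
  assumes T: "T > 0" and r: "r > 0"
    and x: "x \<in> C1_space T"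
    and tube_M: "\<And>t. t \<in> {0..T} \<Longrightarrow> ball (x t) r \<subseteq> M"
    and ball_P: "ball p r \<subseteq> P"
    and cont: "continuous_on ({0..T} \<times> M \<times> UNIV \<times> P) (\<lambda>(t, u, v, q). \<psi> t u v q)"
    and xi: "set_integrable lborel {0..T} \<xi>"
    and xi_nonneg: "\<And>t. t \<in> {0..T} \<Longrightarrow> 0 \<le> \<xi> t"
    and lipschitz: "\<And>t u u1 v v1 q q1. t \<in> {0..T} \<Longrightarrow>
       u \<in> ball (x t) r \<Longrightarrow> u1 \<in> ball (x t) r \<Longrightarrow>
       v \<in> ball (deriv_on T x t) r \<Longrightarrow> v1 \<in> ball (deriv_on T x t) r \<Longrightarrow>
       q \<in> ball p r \<Longrightarrow> q1 \<in> ball p r \<Longrightarrow>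
       \<bar>\<psi> t u v q - \<psi> t u1 v1 q1\<bar> \<le> \<xi> t * (norm (u - u1) + norm (v - v1) + norm (q - q1))"
    and DH234_exists: "\<And>t. t \<in> {0..T} \<Longrightarrow> \<exists>D. has_DH234 \<psi> t (x t) (deriv_on T x t) p D"
begin

abbreviation D :: "real \<Rightarrow> ((real ^ 'n) \<times> (real ^ 'n) \<times> 'y) \<Rightarrow>\<^sub>L real" where
  "D t \<equiv> DH234 \<psi> t (x t) (deriv_on T x t) p"

abbreviation differential :: "(real \<Rightarrow> real ^ 'n) \<Rightarrow> 'y \<Rightarrow> real" where
  "differential \<equiv> int_differential T \<psi> x p"

lemmas differential_def = int_differential_def[of T \<psi> x p]

lemma D: "t \<in> {0..T} \<Longrightarrow> has_DH234 \<psi> t (x t) (deriv_on T x t) p (D t)"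
  using DH234_exists[of t] hadamard_differential_eqI unfolding has_DH234_def DH234_def by metis

lemma differential_quotient_tendsto:
  assumes "t \<in> {0..T}" "\<And>m. 0 < \<theta> m" "\<theta> \<longlonglongrightarrow> 0" "a \<longlonglongrightarrow> a'" "b \<longlonglongrightarrow> b'"
  shows "(\<lambda>m. (1 / \<theta> m) * (\<psi> t (x t + \<theta> m *\<^sub>R a m) (deriv_on T x t + \<theta> m *\<^sub>R b m) (p + \<theta> m *\<^sub>R \<omega>)
      - \<psi> t (x t) (deriv_on T x t) p)) \<longlonglongrightarrow> D t (a', b', \<omega>)"
proof -
  have "(\<lambda>m. (a m, b m, \<omega>)) \<longlonglongrightarrow> (a', b', \<omega>)"
    using assms by (intro tendsto_intros)
  moreover note D[OF assms(1), unfolded has_DH234_def has_hadamard_differential_def has_hadamard_variation_def,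
      rule_format, of \<theta>, OF assms(2,3)]
  ultimately show ?thesis by fastforce
qed

lemma quotient_bound:
  assumes t: "t \<in> {0..T}" and \<theta>: "0 < \<theta>" "\<theta> * norm a < r" "\<theta> * norm b < r" "\<theta> * norm \<omega> < r"
  shows "\<bar>(1 / \<theta>) * (\<psi> t (x t + \<theta> *\<^sub>R a) (deriv_on T x t + \<theta> *\<^sub>R b) (p + \<theta> *\<^sub>R \<omega>)
      - \<psi> t (x t) (deriv_on T x t) p)\<bar> \<le> \<xi> t * (norm a + norm b + norm \<omega>)"
proof -
  have "\<bar>\<psi> t (x t + \<theta> *\<^sub>R a) (deriv_on T x t + \<theta> *\<^sub>R b) (p + \<theta> *\<^sub>R \<omega>) - \<psi> t (x t) (deriv_on T x t) p\<bar>
     \<le> \<xi> t * (norm (x t + \<theta> *\<^sub>R a - x t) + norm (deriv_on T x t + \<theta> *\<^sub>R b - deriv_on T x t) + norm (p + \<theta> *\<^sub>R \<omega> - p))"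
    using \<theta> r by (intro lipschitz[OF t]) (auto simp: dist_norm)
  also have "\<dots> = \<theta> * (\<xi> t * (norm a + norm b + norm \<omega>))"
    using \<theta> by (simp add: algebra_simps)
  finally show ?thesis
    using \<theta> by (simp add: abs_mult field_simps)
qed

text \<open>The Lipschitz bound holds for every difference quotient with a small step and passes to
  the limit.\<close>

lemma D_bound:
  assumes t: "t \<in> {0..T}"
  shows "\<bar>D t (a, b, \<omega>)\<bar> \<le> \<xi> t * (norm a + norm b + norm \<omega>)"
proof -
  \<comment> \<open>The denominators start at 2, so that each step times any of the three norms is
    strictly below \<open>r\<close>, as \<open>quotient_bound\<close> requires.\<close>
  define \<theta> where "\<theta> m = (r / (norm a + norm b + norm \<omega> + 1)) / real (Suc (Suc m))" for m
  have n: "0 < norm a + norm b + norm \<omega> + 1" by (simp add: add_nonneg_pos)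
  have pos: "0 < \<theta> m" for m using r n by (simp add: \<theta>_def)
  have lim: "\<theta> \<longlonglongrightarrow> 0"
    unfolding \<theta>_def using LIMSEQ_Suc[OF LIMSEQ_Suc[OF lim_const_over_n]] .
  have small: "\<theta> m * s < r" if s: "0 \<le> s" "s \<le> norm a + norm b + norm \<omega>" for m s
  proof -
    have "\<theta> m * s \<le> \<theta> m * (norm a + norm b + norm \<omega> + 1)"
      using pos[of m] s by (intro mult_left_mono) auto
    also have "\<dots> = r / real (Suc (Suc m))" using n by (simp add: \<theta>_def)
    also have "\<dots> < r" using r by (simp add: field_simps add_pos_nonneg)
    finally show ?thesis .
  qed
  have "(\<lambda>m. \<bar>(1 / \<theta> m) * (\<psi> t (x t + \<theta> m *\<^sub>R a) (deriv_on T x t + \<theta> m *\<^sub>R b) (p + \<theta> m *\<^sub>R \<omega>)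
      - \<psi> t (x t) (deriv_on T x t) p)\<bar>) \<longlonglongrightarrow> \<bar>D t (a, b, \<omega>)\<bar>"
    by (intro tendsto_rabs differential_quotient_tendsto t pos lim tendsto_const)
  then show ?thesis
    by (rule LIMSEQ_le_const2) (use quotient_bound[OF t pos small small small] in auto)
qed

lemma continuous_on_integrand:
  assumes "continuous_on {0..T} y" "continuous_on {0..T} z" "\<And>t. t \<in> {0..T} \<Longrightarrow> norm (y t - x t) < r"
    "q \<in> ball p r"
  shows "continuous_on {0..T} (\<lambda>t. \<psi> t (y t) (z t) q)"
proof -
  have "continuous_on {0..T} (\<lambda>t. (t, y t, z t, q))"
    using assms by (intro continuous_intros)
  moreover have "(\<lambda>t. (t, y t, z t, q)) ` {0..T} \<subseteq> {0..T} \<times> M \<times> UNIV \<times> P"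
    using assms(3,4) tube_M ball_P by (force simp: dist_norm norm_minus_commute)
  ultimately show ?thesis
    using continuous_on_compose2[OF cont] by fastforce
qed

text \<open>Dominated convergence with majorant \<open>\<xi> t * (B + B + norm \<omega>)\<close>.
  Measurability of the limit integrand is part of the result: it is a pointwise limit of difference
  quotients that are continuous on the interval.\<close>

lemma dominated_differential:
  fixes a b :: "nat \<Rightarrow> real \<Rightarrow> real ^ 'n"
  assumes ca: "\<And>m. continuous_on {0..T} (a m)" and cb: "\<And>m. continuous_on {0..T} (b m)"
    and Ba: "\<And>m t. t \<in> {0..T} \<Longrightarrow> norm (a m t) \<le> B" and Bb: "\<And>m t. t \<in> {0..T} \<Longrightarrow> norm (b m t) \<le> B"
    and la: "\<And>t. t \<in> {0..T} \<Longrightarrow> (\<lambda>m. a m t) \<longlonglongrightarrow> a' t" and lb: "\<And>t. t \<in> {0..T} \<Longrightarrow> (\<lambda>m. b m t) \<longlonglongrightarrow> b' t"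
    and \<theta>: "\<And>m. 0 < \<theta> m" "\<theta> \<longlonglongrightarrow> 0"
  shows "set_integrable lborel {0..T} (\<lambda>t. D t (a' t, b' t, \<omega>))"
    and "(\<lambda>m. LINT t:{0..T}|lborel. (1 / \<theta> m) * (\<psi> t (x t + \<theta> m *\<^sub>R a m t) (deriv_on T x t + \<theta> m *\<^sub>R b m t) (p + \<theta> m *\<^sub>R \<omega>)
      - \<psi> t (x t) (deriv_on T x t) p)) \<longlonglongrightarrow> (LINT t:{0..T}|lborel. D t (a' t, b' t, \<omega>))"
proof -
  define f where "f m t = (1 / \<theta> m) * (\<psi> t (x t + \<theta> m *\<^sub>R a m t) (deriv_on T x t + \<theta> m *\<^sub>R b m t) (p + \<theta> m *\<^sub>R \<omega>)
      - \<psi> t (x t) (deriv_on T x t) p)" for m t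
  have B0: "0 \<le> B" using Ba[of 0 0] T by (meson atLeastAtMost_iff less_imp_le norm_ge_zero order_refl order_trans)
  have "eventually (\<lambda>m. \<theta> m * (B + norm \<omega> + 1) < r) sequentially"
  proof (rule order_tendstoD(2)[OF _ r])
    show "(\<lambda>m. \<theta> m * (B + norm \<omega> + 1)) \<longlonglongrightarrow> 0"
      using tendsto_mult_left_zero[OF \<theta>(2)] by simp
  qed
  \<comment> \<open>Early steps may leave the tube, where neither continuity nor the Lipschitz bound
    is known; from here on all sequences are shifted by \<open>N\<close>.\<close>
  then obtain N where N: "\<And>m. m \<ge> N \<Longrightarrow> \<theta> m * (B + norm \<omega> + 1) < r"
    unfolding eventually_sequentially by blast
  have small: "\<theta> (m + N) * s < r" if "s \<le> B + norm \<omega> + 1" for m s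
    using mult_left_mono[OF that, of "\<theta> (m + N)"] \<theta>(1)[of "m + N"] N[of "m + N"] by linarith
  have sa: "\<theta> (m + N) * norm (a (m + N) t) < r" and sb: "\<theta> (m + N) * norm (b (m + N) t) < r"
    if "t \<in> {0..T}" for m t
    using Ba[OF that, of "m + N"] Bb[OF that, of "m + N"] by (intro small; simp add: add_increasing2)+
  have sw: "\<theta> (m + N) * norm \<omega> < r" for m
    using B0 by (intro small) simp
  have bound: "\<bar>f (m + N) t\<bar> \<le> \<xi> t * (B + B + norm \<omega>)" if t: "t \<in> {0..T}" for m t
  proof -
    have "\<bar>f (m + N) t\<bar> \<le> \<xi> t * (norm (a (m + N) t) + norm (b (m + N) t) + norm \<omega>)"
      unfolding f_def using sa[OF t] sb[OF t] sw by (intro quotient_bound t \<theta>(1))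
    also have "\<dots> \<le> \<xi> t * (B + B + norm \<omega>)"
      using Ba[OF t] Bb[OF t] by (intro mult_left_mono xi_nonneg t add_mono) auto
    finally show ?thesis .
  qed
  have contf: "continuous_on {0..T} (f (m + N))" for m
    unfolding f_def
  proof (intro continuous_intros continuous_on_integrand ca cb C1_space_continuous_on[OF x]
      continuous_on_deriv_on[OF T x])
    show "norm (x t + \<theta> (m + N) *\<^sub>R a (m + N) t - x t) < r" if "t \<in> {0..T}" for t
      using sa[OF that, of m] \<theta>(1)[of "m + N"] by simp
    show "p + \<theta> (m + N) *\<^sub>R \<omega> \<in> ball p r"
      using sw[of m] \<theta>(1)[of "m + N"] by (simp add: dist_norm)
  qed (use r in auto)
  have meas: "(\<lambda>t. indicator {0..T} t *\<^sub>R f (m + N) t) \<in> borel_measurable lborel" for m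
    using borel_measurable_continuous_on_indicator[OF _ contf] by simp
  have lim: "(\<lambda>m. indicator {0..T} t *\<^sub>R f (m + N) t) \<longlonglongrightarrow> indicator {0..T} t *\<^sub>R D t (a' t, b' t, \<omega>)" for t
  proof (cases "t \<in> {0..T}")
    case True
    have "(\<lambda>m. f m t) \<longlonglongrightarrow> D t (a' t, b' t, \<omega>)"
      unfolding f_def using True by (intro differential_quotient_tendsto \<theta> la lb)
    then show ?thesis
      using True LIMSEQ_ignore_initial_segment by (simp add: LIMSEQ_ignore_initial_segment)
  qed simp
  have dom: "integrable lborel (\<lambda>t. indicator {0..T} t *\<^sub>R (\<xi> t * (B + B + norm \<omega>)))"
    using set_integrable_mult_left[of "B + B + norm \<omega>"] xi unfolding set_integrable_def by blast
  have ae: "AE t in lborel. norm (indicator {0..T} t *\<^sub>R f (m + N) t) \<le> indicator {0..T} t *\<^sub>R (\<xi> t * (B + B + norm \<omega>))" for m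
    using bound by (intro AE_I2) (auto simp: indicator_def)
  have limm: "(\<lambda>t. indicator {0..T} t *\<^sub>R D t (a' t, b' t, \<omega>)) \<in> borel_measurable lborel"
    by (rule borel_measurable_LIMSEQ_real[OF lim meas])
  show "set_integrable lborel {0..T} (\<lambda>t. D t (a' t, b' t, \<omega>))"
    unfolding set_integrable_def
    using integrable_dominated_convergence[OF limm meas dom AE_I2[OF lim] ae] .
  have "(\<lambda>m. LINT t:{0..T}|lborel. f (m + N) t) \<longlonglongrightarrow> (LINT t:{0..T}|lborel. D t (a' t, b' t, \<omega>))"
    unfolding set_lebesgue_integral_def
    using integral_dominated_convergence[OF limm meas dom AE_I2[OF lim] ae] .
  then show "(\<lambda>m. LINT t:{0..T}|lborel. f m t) \<longlonglongrightarrow> (LINT t:{0..T}|lborel. D t (a' t, b' t, \<omega>))"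
    by (rule LIMSEQ_offset)
qed

text \<open>\<open>dominated_differential\<close> with constant sequences of directions.\<close>

lemma integrable_D:
  assumes "continuous_on {0..T} a" "continuous_on {0..T} b"
  shows "set_integrable lborel {0..T} (\<lambda>t. D t (a t, b t, \<omega>))"
proof -
  have "bounded (a ` {0..T})" "bounded (b ` {0..T})"
    using assms by (auto intro!: compact_imp_bounded compact_continuous_image)
  then obtain Ba Bb where "\<forall>t\<in>{0..T}. norm (a t) \<le> Ba" "\<forall>t\<in>{0..T}. norm (b t) \<le> Bb"
    unfolding bounded_iff by auto
  then have "\<And>t. t \<in> {0..T} \<Longrightarrow> norm (a t) \<le> max Ba Bb" "\<And>t. t \<in> {0..T} \<Longrightarrow> norm (b t) \<le> max Ba Bb"
    by (auto simp: le_max_iff_disj)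
  moreover have "\<And>m. (0::real) < 1 / real (Suc m)" "(\<lambda>m. 1 / real (Suc m)) \<longlonglongrightarrow> 0"
    using LIMSEQ_Suc[OF lim_1_over_n] by simp_all
  ultimately show ?thesis
    using assms by (intro dominated_differential(1)[of "\<lambda>m. a" "\<lambda>m. b" "max Ba Bb" a b "\<lambda>m. 1 / real (Suc m)"]) auto
qed

lemma integrable_differential:
  assumes "v \<in> C1_space T"
  shows "set_integrable lborel {0..T} (\<lambda>t. D t (v t, deriv_on T v t, \<omega>))"
  using assms T by (intro integrable_D C1_space_continuous_on continuous_on_deriv_on)

definition in_tube :: "(real \<Rightarrow> real ^ 'n) \<Rightarrow> 'y \<Rightarrow> bool" where
  "in_tube y q \<longleftrightarrow> y \<in> C1_space T \<and> q \<in> ball p r \<and>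
     (\<forall>t\<in>{0..T}. norm (y t - x t) < r \<and> norm (deriv_on T y t - deriv_on T x t) < r)"

lemma in_tube_base: "in_tube x p"
  using x r by (simp add: in_tube_def)

lemma integrable_in_tube:
  assumes "in_tube y q"
  shows "set_integrable lborel {0..T} (\<lambda>t. \<psi> t (y t) (deriv_on T y t) q)"
  using assms unfolding in_tube_def
  by (intro borel_integrable_atLeastAtMost' continuous_on_integrand C1_space_continuous_on
      continuous_on_deriv_on T) auto

text \<open>Supplies the continuity in the coefficients that Poincare-Miranda needs at points of the
  tube where nothing is differentiable.\<close>

lemma functional_lipschitz:
  assumes y: "in_tube y q" and z: "in_tube z q"
  shows "\<bar>int_functional T \<psi> y q - int_functional T \<psi> z q\<bar>
    \<le> (LINT t:{0..T}|lborel. \<xi> t) * (2 * C1_norm T (\<lambda>t. y t - z t))"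
proof -
  have C: "y \<in> C1_space T" "z \<in> C1_space T" using y z by (auto simp: in_tube_def)
  note d = C1_space_diff[OF T C]
  have "\<bar>int_functional T \<psi> y q - int_functional T \<psi> z q\<bar>
      = \<bar>LINT t:{0..T}|lborel. \<psi> t (y t) (deriv_on T y t) q - \<psi> t (z t) (deriv_on T z t) q\<bar>"
    unfolding int_functional_def
    by (subst set_integral_diff(2)[OF integrable_in_tube[OF y] integrable_in_tube[OF z]]) simp
  also have "\<dots> \<le> (LINT t:{0..T}|lborel. \<bar>\<psi> t (y t) (deriv_on T y t) q - \<psi> t (z t) (deriv_on T z t) q\<bar>)"
    using set_integral_norm_bound[OF set_integral_diff(1)[OF integrable_in_tube[OF y] integrable_in_tube[OF z]]]
    by simp
  also have "\<dots> \<le> (LINT t:{0..T}|lborel. \<xi> t * (2 * C1_norm T (\<lambda>t. y t - z t)))"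
  proof (rule set_integral_mono)
    show "set_integrable lborel {0..T} (\<lambda>t. \<bar>\<psi> t (y t) (deriv_on T y t) q - \<psi> t (z t) (deriv_on T z t) q\<bar>)"
      using set_integrable_abs[OF set_integral_diff(1)[OF integrable_in_tube[OF y] integrable_in_tube[OF z]]] .
    show "set_integrable lborel {0..T} (\<lambda>t. \<xi> t * (2 * C1_norm T (\<lambda>t. y t - z t)))"
      using xi by simp
    fix t assume t: "t \<in> {0..T}"
    have "\<bar>\<psi> t (y t) (deriv_on T y t) q - \<psi> t (z t) (deriv_on T z t) q\<bar>
       \<le> \<xi> t * (norm (y t - z t) + norm (deriv_on T y t - deriv_on T z t) + norm (q - q))"
      using y z t unfolding in_tube_def
      by (intro lipschitz) (auto simp: dist_norm norm_minus_commute)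
    also have "\<dots> \<le> \<xi> t * (2 * C1_norm T (\<lambda>t. y t - z t))"
      using norm_le_C1_norm(1)[OF T d(1) t] norm_deriv_on_le_C1_norm[OF T d(1) t] d(2)[OF t]
      by (intro mult_left_mono xi_nonneg t) simp
    finally show "\<bar>\<psi> t (y t) (deriv_on T y t) q - \<psi> t (z t) (deriv_on T z t) q\<bar> \<le> \<dots>" .
  qed
  also have "\<dots> = (LINT t:{0..T}|lborel. \<xi> t) * (2 * C1_norm T (\<lambda>t. y t - z t))"
    by simp
  finally show ?thesis .
qed

lemma in_tube_step:
  assumes "w \<in> C1_space T" "0 < \<theta>" "\<theta> * C1_norm T w < r" "\<theta> * norm \<omega> < r"
  shows "in_tube (\<lambda>t. x t + \<theta> *\<^sub>R w t) (p + \<theta> *\<^sub>R \<omega>)"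
proof -
  have "\<theta> * norm (w t) < r" "\<theta> * norm (deriv_on T w t) < r" if "t \<in> {0..T}" for t
    using mult_left_mono[OF norm_le_C1_norm(1)[OF T assms(1) that], of \<theta>]
      mult_left_mono[OF norm_deriv_on_le_C1_norm[OF T assms(1) that], of \<theta>] assms by linarith+
  then show ?thesis
    using assms x T C1_space_add(1)[OF T x C1_space_scaleR(1)[OF T assms(1), of \<theta>]]
    unfolding in_tube_def
    by (simp add: dist_norm deriv_on_add[OF T x C1_space_scaleR(1)[OF T assms(1), of \<theta>]]
        deriv_on_scaleR[OF T assms(1)])
qed

text \<open>The directions must be allowed to vary with the step: they come either from difference
  quotients of the solution map or from competitors with corrected coefficients, and in both cases
  they converge to \<open>v\<close> without being equal to it.\<close>

theorem functional_variation:
  assumes w: "\<And>m. w m \<in> C1_space T" and v: "v \<in> C1_space T"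
    and conv: "(\<lambda>m. C1_norm T (\<lambda>t. w m t - v t)) \<longlonglongrightarrow> 0"
    and \<theta>: "\<And>m. 0 < \<theta> m" "\<theta> \<longlonglongrightarrow> 0"
  shows "(\<lambda>m. (1 / \<theta> m) * (int_functional T \<psi> (\<lambda>t. x t + \<theta> m *\<^sub>R w m t) (p + \<theta> m *\<^sub>R \<omega>)
      - int_functional T \<psi> x p)) \<longlonglongrightarrow> differential v \<omega>"
proof -
  obtain B where B: "\<And>m t. t \<in> {0..T} \<Longrightarrow> norm (w m t) \<le> B"
    "\<And>m t. t \<in> {0..T} \<Longrightarrow> norm (deriv_on T (w m) t) \<le> B"
    using C1_convergence_bounded[OF T w v conv] by metis
  have lim: "(\<lambda>m. LINT t:{0..T}|lborel. (1 / \<theta> m) * (\<psi> t (x t + \<theta> m *\<^sub>R w m t)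
      (deriv_on T x t + \<theta> m *\<^sub>R deriv_on T (w m) t) (p + \<theta> m *\<^sub>R \<omega>)
      - \<psi> t (x t) (deriv_on T x t) p)) \<longlonglongrightarrow> differential v \<omega>"
    unfolding differential_def
    by (rule dominated_differential(2)[where B = B])
      (use B \<theta> C1_convergence_pointwise[OF T w v conv] C1_space_continuous_on[OF w]
        continuous_on_deriv_on[OF T w] in auto)
  have "eventually (\<lambda>m. \<theta> m * (2 * B + norm \<omega> + 1) < r) sequentially"
  proof (rule order_tendstoD(2)[OF _ r])
    show "(\<lambda>m. \<theta> m * (2 * B + norm \<omega> + 1)) \<longlonglongrightarrow> 0"
      using tendsto_mult_left_zero[OF \<theta>(2)] by simp
  qed
  then have "eventually (\<lambda>m. (LINT t:{0..T}|lborel. (1 / \<theta> m) * (\<psi> t (x t + \<theta> m *\<^sub>R w m t)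
      (deriv_on T x t + \<theta> m *\<^sub>R deriv_on T (w m) t) (p + \<theta> m *\<^sub>R \<omega>)
      - \<psi> t (x t) (deriv_on T x t) p)) =
      (1 / \<theta> m) * (int_functional T \<psi> (\<lambda>t. x t + \<theta> m *\<^sub>R w m t) (p + \<theta> m *\<^sub>R \<omega>)
      - int_functional T \<psi> x p)) sequentially"
  proof eventually_elim
    case (elim m)
    have nn: "0 \<le> C1_norm T (w m)" by (rule C1_norm_nonneg[OF T w])
    have "C1_norm T (w m) \<le> B + B" using B by (intro C1_norm_le[OF T])
    then have "\<theta> m * C1_norm T (w m) \<le> \<theta> m * (2 * B + norm \<omega> + 1)"
      "\<theta> m * norm \<omega> \<le> \<theta> m * (2 * B + norm \<omega> + 1)"
      using \<theta>(1)[of m] nn by (auto intro!: mult_left_mono simp: add_increasing2)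
    then have tube: "in_tube (\<lambda>t. x t + \<theta> m *\<^sub>R w m t) (p + \<theta> m *\<^sub>R \<omega>)"
      using elim by (intro in_tube_step w \<theta>(1)) linarith+
    have "int_functional T \<psi> (\<lambda>t. x t + \<theta> m *\<^sub>R w m t) (p + \<theta> m *\<^sub>R \<omega>) - int_functional T \<psi> x p
      = (LINT t:{0..T}|lborel. \<psi> t (x t + \<theta> m *\<^sub>R w m t) (deriv_on T (\<lambda>t. x t + \<theta> m *\<^sub>R w m t) t) (p + \<theta> m *\<^sub>R \<omega>)
          - \<psi> t (x t) (deriv_on T x t) p)"
      unfolding int_functional_def
      by (rule set_integral_diff(2)[OF integrable_in_tube[OF tube] integrable_in_tube[OF in_tube_base], symmetric])
    also have "\<dots> = (LINT t:{0..T}|lborel. \<psi> t (x t + \<theta> m *\<^sub>R w m t) (deriv_on T x t + \<theta> m *\<^sub>R deriv_on T (w m) t) (p + \<theta> m *\<^sub>R \<omega>)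
          - \<psi> t (x t) (deriv_on T x t) p)"
      by (rule set_lebesgue_integral_cong)
        (use deriv_on_add[OF T x C1_space_scaleR(1)[OF T w]] deriv_on_scaleR[OF T w] in auto)
    finally show ?case by simp
  qed
  from Lim_transform_eventually[OF lim this] show ?thesis .
qed

lemma differential_add:
  assumes "v \<in> C1_space T" "w \<in> C1_space T"
  shows "differential (\<lambda>t. v t + w t) (\<omega> + \<omega>') = differential v \<omega> + differential w \<omega>'"
proof -
  have "differential (\<lambda>t. v t + w t) (\<omega> + \<omega>') =
      (LINT t:{0..T}|lborel. D t (v t, deriv_on T v t, \<omega>) + D t (w t, deriv_on T w t, \<omega>'))"
    unfolding differential_def
    by (rule set_lebesgue_integral_cong)
      (auto simp: deriv_on_add[OF T assms] blinfun.add_right[symmetric])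
  then show ?thesis
    unfolding differential_def using set_integral_add(2)[OF integrable_differential[OF assms(1)] integrable_differential[OF assms(2)]]
    by simp
qed

lemma differential_scaleR:
  assumes "v \<in> C1_space T"
  shows "differential (\<lambda>t. c *\<^sub>R v t) (c *\<^sub>R \<omega>) = c * differential v \<omega>"
proof -
  have "differential (\<lambda>t. c *\<^sub>R v t) (c *\<^sub>R \<omega>) = (LINT t:{0..T}|lborel. c * D t (v t, deriv_on T v t, \<omega>))"
    unfolding differential_def
    by (rule set_lebesgue_integral_cong)
      (use blinfun.scaleR_right[of "D _" c "(_, _, _)"] in \<open>auto simp: deriv_on_scaleR[OF T assms]\<close>)
  then show ?thesis unfolding differential_def by simp
qed

lemma differential_bound:
  assumes "v \<in> C1_space T"
  shows "\<bar>differential v \<omega>\<bar> \<le> (LINT t:{0..T}|lborel. \<xi> t) * (2 * C1_norm T v + norm \<omega>)"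
proof -
  have "\<bar>differential v \<omega>\<bar> \<le> (LINT t:{0..T}|lborel. \<bar>D t (v t, deriv_on T v t, \<omega>)\<bar>)"
    unfolding differential_def
    using set_integral_norm_bound[OF integrable_differential[OF assms]] by simp
  also have "\<dots> \<le> (LINT t:{0..T}|lborel. \<xi> t * (2 * C1_norm T v + norm \<omega>))"
  proof (rule set_integral_mono)
    show "set_integrable lborel {0..T} (\<lambda>t. \<bar>D t (v t, deriv_on T v t, \<omega>)\<bar>)"
      using set_integrable_abs[OF integrable_differential[OF assms]] .
    show "set_integrable lborel {0..T} (\<lambda>t. \<xi> t * (2 * C1_norm T v + norm \<omega>))"
      using xi by simp
    fix t assume t: "t \<in> {0..T}"
    have "\<bar>D t (v t, deriv_on T v t, \<omega>)\<bar> \<le> \<xi> t * (norm (v t) + norm (deriv_on T v t) + norm \<omega>)"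
      by (rule D_bound[OF t])
    also have "\<dots> \<le> \<xi> t * (2 * C1_norm T v + norm \<omega>)"
      using norm_le_C1_norm(1)[OF T assms t] norm_deriv_on_le_C1_norm[OF T assms t]
      by (intro mult_left_mono xi_nonneg t) simp
    finally show "\<bar>D t (v t, deriv_on T v t, \<omega>)\<bar> \<le> \<dots>" .
  qed
  finally show ?thesis by simp
qed

lemma has_hadamard_differential_on_C1_functional:
  "has_hadamard_differential_on_C1 T (\<lambda>y. int_functional T \<psi> y p) x (\<lambda>v. differential v 0)"
  unfolding has_hadamard_differential_on_C1_def
proof (intro conjI ballI allI)
  fix h :: "real \<Rightarrow> real ^ 'n" assume h: "h \<in> C1_space T"
  show "has_hadamard_variation_on_C1 T (\<lambda>y. int_functional T \<psi> y p) x h (differential h 0)"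
    unfolding has_hadamard_variation_on_C1_def
    using functional_variation[OF _ h, where \<omega> = 0] by simp
next
  fix h1 h2 :: "real \<Rightarrow> real ^ 'n" assume "h1 \<in> C1_space T" "h2 \<in> C1_space T"
  then show "differential (\<lambda>t. h1 t + h2 t) 0 = differential h1 0 + differential h2 0"
    using differential_add[of h1 h2 0 0] by simp
next
  fix c and h :: "real \<Rightarrow> real ^ 'n" assume "h \<in> C1_space T"
  then show "differential (\<lambda>t. c *\<^sub>R h t) 0 = c * differential h 0"
    using differential_scaleR[of h c 0] by simp
next
  show "\<exists>K. \<forall>h\<in>C1_space T. \<bar>differential h 0\<bar> \<le> K * C1_norm T h"
    using differential_bound[where \<omega> = 0]
    by (intro exI[of _ "(LINT t:{0..T}|lborel. \<xi> t) * 2"]) (simp add: algebra_simps)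
qed

lemma differential_add_sum:
  fixes n :: nat
  assumes "v \<in> C1_space T" "\<And>b. b < n \<Longrightarrow> e b \<in> C1_space T"
  shows "differential (\<lambda>t. v t + (\<Sum>b<n. c b *\<^sub>R e b t)) \<omega>
    = differential v \<omega> + (\<Sum>b<n. c b * differential (e b) 0)"
  using assms(2)
proof (induction n)
  case (Suc n)
  have e: "e n \<in> C1_space T" and *: "(\<lambda>t. v t + (\<Sum>b<n. c b *\<^sub>R e b t)) \<in> C1_space T"
    using Suc.prems assms(1) by (auto intro!: C1_space_add(1)[OF T] C1_space_sum[OF T])
  show ?case
    using differential_add[OF * C1_space_scaleR(1)[OF T e, of "c n"], of \<omega> 0]
      differential_scaleR[OF e, of "c n" 0] Suc by (simp add: add.assoc)
qed simp

text \<open>Separates the part governed by stationarity from the part that forms the envelope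
  formula.\<close>

lemma differential_split:
  assumes "v \<in> C1_space T"
  shows "differential v \<omega> = differential v 0 + differential (\<lambda>t. 0) \<omega>"
  using differential_add[OF assms C1_space_const[of 0], of 0 \<omega>] by simp

lemma
  assumes t: "t \<in> {0..T}"
  shows has_DH2: "has_hadamard_differential (\<lambda>u. \<psi> t u (deriv_on T x t) p) (x t)
        (D t o\<^sub>L Blinfun (\<lambda>u. (u, 0, 0)))"
    and has_DH3: "has_hadamard_differential (\<lambda>v. \<psi> t (x t) v p) (deriv_on T x t)
        (D t o\<^sub>L Blinfun (\<lambda>v. (0, v, 0)))"
    and has_DH4: "has_hadamard_differential (\<lambda>q. \<psi> t (x t) (deriv_on T x t) q) p
        (D t o\<^sub>L Blinfun (\<lambda>q. (0, 0, q)))"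
proof -
  note D' = D[OF t, unfolded has_DH234_def]
  have [simp]: "bounded_linear (\<lambda>u::real^'n. (u, 0 :: real^'n, 0 :: 'y))"
    "bounded_linear (\<lambda>u::real^'n. (0 :: real^'n, u, 0 :: 'y))"
    "bounded_linear (\<lambda>q::'y. (0 :: real^'n, 0 :: real^'n, q))"
    by (auto intro!: bounded_linear_intros)
  show "has_hadamard_differential (\<lambda>u. \<psi> t u (deriv_on T x t) p) (x t) (D t o\<^sub>L Blinfun (\<lambda>u. (u, 0, 0)))"
    by (rule has_hadamard_differential_compose_affine[OF D']) (simp add: bounded_linear_Blinfun_apply)
  show "has_hadamard_differential (\<lambda>v. \<psi> t (x t) v p) (deriv_on T x t) (D t o\<^sub>L Blinfun (\<lambda>v. (0, v, 0)))"
    by (rule has_hadamard_differential_compose_affine[OF D']) (simp add: bounded_linear_Blinfun_apply)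
  show "has_hadamard_differential (\<lambda>q. \<psi> t (x t) (deriv_on T x t) q) p (D t o\<^sub>L Blinfun (\<lambda>q. (0, 0, q)))"
    by (rule has_hadamard_differential_compose_affine[OF D']) (simp add: bounded_linear_Blinfun_apply)
qed

lemma DH4_along_eq:
  assumes "t \<in> {0..T}"
  shows "DH4_along T \<psi> x p \<omega> t = D t (0, 0, \<omega>)"
proof -
  have "bounded_linear (\<lambda>q::'y. (0 :: real^'n, 0 :: real^'n, q))"
    by (auto intro!: bounded_linear_intros)
  then show ?thesis
    unfolding DH4_along_def DH4_def
    by (simp add: hadamard_differential_eqI[OF has_DH4[OF assms]] bounded_linear_Blinfun_apply)
qed

lemma deriv_on_zero: "t \<in> {0..T} \<Longrightarrow> deriv_on T (\<lambda>t. 0) t = 0"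
  by (rule deriv_on_eqI[OF T]) auto

lemma integrable_DH4_along: "set_integrable lborel {0..T} (DH4_along T \<psi> x p \<omega>)"
  using integrable_D[of "\<lambda>t. 0" "\<lambda>t. 0" \<omega>] DH4_along_eq
  by (subst set_integrable_cong[OF refl]) auto

lemma integral_DH4_along:
  "(LINT t:{0..T}|lborel. DH4_along T \<psi> x p \<omega> t) = differential (\<lambda>t. 0) \<omega>"
  unfolding differential_def
  by (rule set_lebesgue_integral_cong) (auto simp: DH4_along_eq deriv_on_zero)

end

section \<open>Multipliers and the envelope formula at a point with independent constraints\<close>

text \<open>One family indexed from 0: inequalities at indices below \<open>k\<close>, equalities
  from \<open>k\<close> to \<open>k + l - 1\<close>. The original families are indexed from 1, hence
  the shifts by one in what follows.\<close>

definition constraint :: "nat \<Rightarrow> (nat \<Rightarrow> 'f) \<Rightarrow> (nat \<Rightarrow> 'f) \<Rightarrow> nat \<Rightarrow> 'f" where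
  "constraint k g h a = (if a < k then g (Suc a) else h (Suc (a - k)))"

lemma sum_constraint:
  fixes F :: "'f \<Rightarrow> real"
  shows "(\<Sum>a<k + l. \<nu> a * F (constraint k g h a))
    = (\<Sum>i=1..k. \<nu> (i - 1) * F (g i)) + (\<Sum>j=1..l. \<nu> (k + j - 1) * F (h j))"
proof -
  have "(\<Sum>a<k + l. \<nu> a * F (constraint k g h a))
      = (\<Sum>a<k. \<nu> a * F (constraint k g h a)) + (\<Sum>a<l. \<nu> (k + a) * F (constraint k g h (k + a)))"
    by (induction l) (simp_all add: add.assoc)
  also have "(\<Sum>a<k. \<nu> a * F (constraint k g h a)) = (\<Sum>i=1..k. \<nu> (i - 1) * F (g i))"
    by (rule sum.reindex_bij_witness[of _ "\<lambda>i. i - 1" Suc]) (auto simp: constraint_def)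
  also have "(\<Sum>a<l. \<nu> (k + a) * F (constraint k g h (k + a))) = (\<Sum>j=1..l. \<nu> (k + j - 1) * F (h j))"
    by (rule sum.reindex_bij_witness[of _ "\<lambda>i. i - 1" Suc]) (auto simp: constraint_def)
  finally show ?thesis .
qed

lemma constraint_mem: "a < k + l \<Longrightarrow> constraint k g h a \<in> g ` {1..k} \<union> h ` {1..l}"
  unfolding constraint_def by auto

lemma admissible_iff_constraint:
  "y \<in> admissible T M a0 aT k g l h q \<longleftrightarrow>
     y \<in> C1_into T M \<and> y 0 = a0 \<and> y T = aT \<and>
     (\<forall>a<k. int_functional T (constraint k g h a) y q \<ge> 0) \<and>
     (\<forall>a. k \<le> a \<and> a < k + l \<longrightarrow> int_functional T (constraint k g h a) y q = 0)"
proof -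
  have 1: "(\<forall>i\<in>{1..k}. int_functional T (g i) y q \<ge> 0) \<longleftrightarrow> (\<forall>a<k. int_functional T (constraint k g h a) y q \<ge> 0)"
    unfolding constraint_def
    by (auto simp: Ball_def) (metis Suc_le_eq Suc_pred diff_Suc_less le_less_trans less_Suc_eq_le zero_less_Suc order_less_le_trans)
  have 2: "(\<forall>j\<in>{1..l}. int_functional T (h j) y q = 0) \<longleftrightarrow>
      (\<forall>a. k \<le> a \<and> a < k + l \<longrightarrow> int_functional T (constraint k g h a) y q = 0)"
  proof
    assume "\<forall>j\<in>{1..l}. int_functional T (h j) y q = 0"
    then show "\<forall>a. k \<le> a \<and> a < k + l \<longrightarrow> int_functional T (constraint k g h a) y q = 0"
      unfolding constraint_def by auto
  next
    assume *: "\<forall>a. k \<le> a \<and> a < k + l \<longrightarrow> int_functional T (constraint k g h a) y q = 0"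
    show "\<forall>j\<in>{1..l}. int_functional T (h j) y q = 0"
    proof
      fix j assume "j \<in> {1..l}"
      then have "k \<le> k + j - 1 \<and> k + j - 1 < k + l" "constraint k g h (k + j - 1) = h j"
        by (auto simp: constraint_def)
      then show "int_functional T (h j) y q = 0" using * by metis
    qed
  qed
  show ?thesis unfolding admissible_def using 1 2 by auto
qed

lemma C1_space_00D: "v \<in> C1_space_00 T \<Longrightarrow> v \<in> C1_space T"
  by (simp add: C1_space_00_def)

lemma C1_space_00_add_sum:
  fixes n :: nat
  assumes "T > 0" "v \<in> C1_space_00 T" "\<And>b. b < n \<Longrightarrow> e b \<in> C1_space_00 T"
  shows "(\<lambda>t. v t + (\<Sum>b<n. c b *\<^sub>R e b t)) \<in> C1_space_00 T"
  using assms C1_space_add(1)[OF assms(1) _ C1_space_sum[OF assms(1)], of v n e c]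
  by (simp add: C1_space_00_def)

lemma value_function_eq:
  assumes "is_solution T M a0 aT L k g l h q y"
  shows "value_function T M a0 aT L k g l h q = int_functional T L y q"
  using assms unfolding value_function_def is_solution_def by (intro cSup_eq_maximum) auto

text \<open>Surjectivity of the constraint derivative at the solution \<open>X p\<close>, recorded
  by finitely many test functions \<open>e b\<close> dual to the constraint differentials. They
  vanish at both ends, so moving along them keeps the boundary values.\<close>

locale independent_constraints =
  fixes T r :: real
    and M :: "(real ^ 'n::finite) set"
    and P :: "'y::real_normed_vector set"
    and a0 aT :: "real ^ 'n"
    and L :: "('n, 'y) integrand"
    and k l :: nat
    and g h :: "nat \<Rightarrow> ('n, 'y) integrand"
    and X :: "'y \<Rightarrow> real \<Rightarrow> real ^ 'n"
    and p :: 'y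
    and \<xi> :: "real \<Rightarrow> real"
    and e :: "nat \<Rightarrow> real \<Rightarrow> real ^ 'n"
  assumes regular: "\<And>\<psi>. \<psi> \<in> {L} \<union> g ` {1..k} \<union> h ` {1..l} \<Longrightarrow> regular_integrand T r M P \<psi> (X p) p \<xi>"
    and solution: "\<And>q. q \<in> P \<Longrightarrow> is_solution T M a0 aT L k g l h q (X q)"
    and e: "\<And>b. b < k + l \<Longrightarrow> e b \<in> C1_space_00 T"
    and dual: "\<And>a b. a < k + l \<Longrightarrow> b < k + l \<Longrightarrow>
       int_differential T (constraint k g h a) (X p) p (e b) 0 = (if a = b then 1 else 0)"
begin

abbreviation "C \<equiv> constraint k g h"
abbreviation "x \<equiv> X p"
abbreviation "dL \<equiv> int_differential T L x p"
abbreviation "dC a \<equiv> int_differential T (C a) x p"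
abbreviation "adm \<equiv> admissible T M a0 aT k g l h"
abbreviation "V \<equiv> value_function T M a0 aT L k g l h"

sublocale obj: regular_integrand T r M P L x p \<xi>
  by (rule regular) simp

lemma con: "a < k + l \<Longrightarrow> regular_integrand T r M P (C a) x p \<xi>"
  using constraint_mem[of a k l g h] by (intro regular) auto

lemmas T = obj.T

lemma eC1: "b < k + l \<Longrightarrow> e b \<in> C1_space T"
  using e by (simp add: C1_space_00D)

lemma p_P: "p \<in> P"
  using obj.ball_P obj.r by auto

lemma le_V:
  assumes "y \<in> adm q" "q \<in> P"
  shows "int_functional T L y q \<le> V q"
  using assms solution[OF assms(2)] value_function_eq[OF solution[OF assms(2)]]
  unfolding is_solution_def by auto

lemma V_eq: "q \<in> P \<Longrightarrow> V q = int_functional T L (X q) q"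
  by (rule value_function_eq[OF solution])

lemma X_adm: "q \<in> P \<Longrightarrow> X q \<in> adm q"
  using solution unfolding is_solution_def by blast

lemma constraint_values:
  "a < k \<Longrightarrow> q \<in> P \<Longrightarrow> int_functional T (C a) (X q) q \<ge> 0"
  "k \<le> a \<Longrightarrow> a < k + l \<Longrightarrow> q \<in> P \<Longrightarrow> int_functional T (C a) (X q) q = 0"
  using X_adm[unfolded admissible_iff_constraint] by auto

lemma admissible_step:
  assumes w: "w \<in> C1_space_00 T" and tube: "obj.in_tube (\<lambda>t. x t + s *\<^sub>R w t) q"
    and "\<And>a. a < k \<Longrightarrow> int_functional T (C a) (\<lambda>t. x t + s *\<^sub>R w t) q \<ge> 0"
    and "\<And>a. k \<le> a \<Longrightarrow> a < k + l \<Longrightarrow> int_functional T (C a) (\<lambda>t. x t + s *\<^sub>R w t) q = 0"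
  shows "(\<lambda>t. x t + s *\<^sub>R w t) \<in> adm q"
proof -
  have "x t + s *\<^sub>R w t \<in> M" if "t \<in> {0..T}" for t
    using tube obj.tube_M[OF that] that unfolding obj.in_tube_def by (force simp: dist_norm norm_minus_commute)
  then have "(\<lambda>t. x t + s *\<^sub>R w t) \<in> C1_into T M"
    using tube unfolding C1_into_def obj.in_tube_def by auto
  moreover have "x 0 = a0" "x T = aT" using X_adm[OF p_P] by (auto simp: admissible_def)
  ultimately show ?thesis
    using assms unfolding admissible_iff_constraint by (simp add: C1_space_00_def)
qed

text \<open>
  The constraints take prescribed values exactly, not only to first order, although they are
  differentiable at \<open>x\<close> only: this replaces the implicit function theorem.
\<close>

lemma exact_steps:
  assumes v: "v \<in> C1_space_00 T"
  obtains s w where "\<And>m. 0 < s m" "s \<longlonglongrightarrow> 0" "\<And>m. w m \<in> C1_space_00 T"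
    "(\<lambda>m. C1_norm T (\<lambda>t. w m t - v t)) \<longlonglongrightarrow> 0"
    "\<And>m. obj.in_tube (\<lambda>t. x t + s m *\<^sub>R w m t) (p + s m *\<^sub>R \<omega>)"
    "\<And>m a. a < k + l \<Longrightarrow> int_functional T (C a) (\<lambda>t. x t + s m *\<^sub>R w m t) (p + s m *\<^sub>R \<omega>)
       = int_functional T (C a) x p + s m * dC a v \<omega>"
proof -
  note v1 = C1_space_00D[OF v]
  \<comment> \<open>The prescribed direction \<open>v\<close>, corrected along the dual functions;
    the coefficients \<open>c\<close> are the unknowns.\<close>
  define W where "W c t = v t + (\<Sum>b<k+l. c b *\<^sub>R e b t)" for c :: "nat \<Rightarrow> real" and t
  have W00: "W c \<in> C1_space_00 T" for c
    unfolding W_def by (rule C1_space_00_add_sum[OF T v e])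
  note W1 = C1_space_00D[OF W00]
  have Wdiff: "(\<lambda>m. C1_norm T (\<lambda>t. s *\<^sub>R W (c m) t - s *\<^sub>R W c' t)) \<longlonglongrightarrow> 0"
    if "\<forall>j<k+l. (\<lambda>m. c m j) \<longlonglongrightarrow> c' j" for c c' s
  proof -
    have "(\<lambda>m. C1_norm T (\<lambda>t. \<Sum>b<k+l. (s * (c m b - c' b)) *\<^sub>R e b t)) \<longlonglongrightarrow> 0"
    proof (rule C1_norm_sum_tendsto_0[OF T eC1])
      fix b assume "b < k + l"
      then have "(\<lambda>m. s * (c m b - c' b)) \<longlonglongrightarrow> s * (c' b - c' b)"
        using that by (intro tendsto_intros) auto
      then show "(\<lambda>m. s * (c m b - c' b)) \<longlonglongrightarrow> 0" by simp
    qed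
    moreover have "s *\<^sub>R W (c m) t - s *\<^sub>R W c' t = (\<Sum>b<k+l. (s * (c m b - c' b)) *\<^sub>R e b t)" for m t
      by (simp add: W_def scaleR_add_right scaleR_sum_right sum_subtractf[symmetric] algebra_simps)
    ultimately show ?thesis by simp
  qed
  define B where "B = C1_norm T v + (\<Sum>b<k+l. 2 * C1_norm T (e b))"
  have WB: "C1_norm T (W c) \<le> B" if "\<forall>j<k+l. \<bar>c j\<bar> \<le> 1" for c
  proof -
    have "C1_norm T (\<lambda>t. v t + (\<Sum>b<n. c b *\<^sub>R e b t)) \<le> C1_norm T v + (\<Sum>b<n. 2 * C1_norm T (e b))"
      if "n \<le> k + l" for n
      using that
    proof (induction n)
      case (Suc n)
      have en: "e n \<in> C1_space T" and *: "(\<lambda>t. v t + (\<Sum>b<n. c b *\<^sub>R e b t)) \<in> C1_space T"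
        using Suc.prems v1 eC1 by (auto intro!: C1_space_add(1)[OF T] C1_space_sum[OF T])
      have "C1_norm T (\<lambda>t. c n *\<^sub>R e n t) \<le> \<bar>c n\<bar> * (2 * C1_norm T (e n))"
        by (rule C1_norm_scaleR_le[OF T en])
      also have "\<dots> \<le> 1 * (2 * C1_norm T (e n))"
        using \<open>\<forall>j<k+l. \<bar>c j\<bar> \<le> 1\<close> Suc.prems C1_norm_nonneg[OF T en] by (intro mult_right_mono) auto
      finally show ?case
        using C1_norm_triangle[OF T * C1_space_scaleR(1)[OF T en], of "c n"] Suc
        by (simp add: add.assoc)
    qed simp
    from this[of "k + l"] show ?thesis unfolding W_def B_def by simp
  qed
  have B0: "0 \<le> B"
    using WB[of "\<lambda>_. 0"] C1_norm_nonneg[OF T W1[of "\<lambda>_. 0"]] by simp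
  \<comment> \<open>Below this step size, curve and parameter stay in the tube simultaneously for
    all coefficient vectors of the unit cube.\<close>
  define s0 where "s0 = r / (B + norm \<omega> + 1)"
  have s0: "0 < s0" using obj.r B0 by (simp add: s0_def add_nonneg_pos)
  have tube: "obj.in_tube (\<lambda>t. x t + s *\<^sub>R W c t) (p + s *\<^sub>R \<omega>)"
    if s: "0 < s" "s < s0" and c: "\<forall>j<k+l. \<bar>c j\<bar> \<le> 1" for s c
  proof (rule obj.in_tube_step[OF W1 s(1)])
    have lt: "s * (B + norm \<omega> + 1) < r"
      using s(2) B0 pos_less_divide_eq[of "B + norm \<omega> + 1" s r] by (simp add: s0_def add_nonneg_pos)
    have "s * C1_norm T (W c) \<le> s * (B + norm \<omega> + 1)" "s * norm \<omega> \<le> s * (B + norm \<omega> + 1)"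
      using s B0 WB[OF c] by (auto intro!: mult_left_mono simp: add_increasing2)
    then show "s * C1_norm T (W c) < r" "s * norm \<omega> < r" using lt by linarith+
  qed
  \<comment> \<open>The excess of the difference quotient over the prescribed slope. By duality its
    limit for \<open>s\<close> tending to 0 is the coordinate \<open>c a\<close>, and a zero of it
    is an exact hit of the prescribed value.\<close>
  define f where "f a s c = (1 / s) * (int_functional T (C a) (\<lambda>t. x t + s *\<^sub>R W c t) (p + s *\<^sub>R \<omega>)
      - int_functional T (C a) x p) - dC a v \<omega>" for a s c
  obtain s c where sc: "\<And>m. 0 < s m" "\<And>m. s m < s0" "s \<longlonglongrightarrow> 0"
    "\<And>m j. j < k+l \<Longrightarrow> \<bar>c m j\<bar> \<le> 1" "\<And>j. j < k+l \<Longrightarrow> (\<lambda>m. c m j) \<longlonglongrightarrow> 0"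
    "\<And>m a. a < k+l \<Longrightarrow> f a (s m) (c m) = 0"
  proof (rule zeros_of_perturbed_coordinates[OF s0 zero_less_one, of "k + l" f])
    fix a s and c :: "nat \<Rightarrow> nat \<Rightarrow> real" and c' :: "nat \<Rightarrow> real"
    assume a: "a < k + l" and s: "0 < s" "s < s0"
      and c: "\<forall>m. \<forall>j<k+l. \<bar>c m j\<bar> \<le> 1" "\<forall>j<k+l. \<bar>c' j\<bar> \<le> 1" "\<forall>j<k+l. (\<lambda>m. c m j) \<longlonglongrightarrow> c' j"
    interpret ca: regular_integrand T r M P "C a" x p \<xi> by (rule con[OF a])
    define F where "F c = int_functional T (C a) (\<lambda>t. x t + s *\<^sub>R W c t) (p + s *\<^sub>R \<omega>)" for c
    have z: "(\<lambda>m. (LINT t:{0..T}|lborel. \<xi> t) * (2 * C1_norm T (\<lambda>t. s *\<^sub>R W (c m) t - s *\<^sub>R W c' t))) \<longlonglongrightarrow> 0"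
      using Wdiff[OF c(3)] by (intro tendsto_mult_right_zero)
    have "(\<lambda>m. F (c m) - F c') \<longlonglongrightarrow> 0"
      by (rule Lim_null_comparison[OF always_eventually z])
        (use ca.functional_lipschitz[OF tube[OF s] tube[OF s]] c in \<open>auto simp: F_def\<close>)
    then have "(\<lambda>m. F (c m)) \<longlonglongrightarrow> F c'" by (rule LIM_zero_cancel)
    then show "(\<lambda>m. f a s (c m)) \<longlonglongrightarrow> f a s c'"
      unfolding f_def F_def[symmetric] by (intro tendsto_intros)
  next
    fix a and s :: "nat \<Rightarrow> real" and c :: "nat \<Rightarrow> nat \<Rightarrow> real" and c' :: "nat \<Rightarrow> real"
    assume a: "a < k + l" and s: "\<forall>m. 0 < s m" "s \<longlonglongrightarrow> 0"
      and c: "\<forall>m. \<forall>j<k+l. \<bar>c m j\<bar> \<le> 1" "\<forall>j<k+l. (\<lambda>m. c m j) \<longlonglongrightarrow> c' j"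
    interpret ca: regular_integrand T r M P "C a" x p \<xi> by (rule con[OF a])
    have "(\<lambda>m. C1_norm T (\<lambda>t. W (c m) t - W c' t)) \<longlonglongrightarrow> 0"
      using Wdiff[OF c(2), of 1] by simp
    then have "(\<lambda>m. (1 / s m) * (int_functional T (C a) (\<lambda>t. x t + s m *\<^sub>R W (c m) t) (p + s m *\<^sub>R \<omega>)
      - int_functional T (C a) x p)) \<longlonglongrightarrow> dC a (W c') \<omega>"
      using s by (intro ca.functional_variation W1) auto
    moreover have "dC a (W c') \<omega> = dC a v \<omega> + c' a"
      unfolding W_def using a
      by (subst ca.differential_add_sum[OF v1 eC1]) (simp_all add: dual if_distrib cong: if_cong)
    ultimately have "(\<lambda>m. f a (s m) (c m)) \<longlonglongrightarrow> dC a v \<omega> + c' a - dC a v \<omega>"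
      unfolding f_def by (intro tendsto_intros) simp
    then show "(\<lambda>m. f a (s m) (c m)) \<longlonglongrightarrow> c' a" by simp
  qed blast
  show ?thesis
  proof (rule that[of s "\<lambda>m. W (c m)"])
    show "(\<lambda>m. C1_norm T (\<lambda>t. W (c m) t - v t)) \<longlonglongrightarrow> 0"
      using Wdiff[of c "\<lambda>_. 0" 1] sc(5) by (simp add: W_def)
    show "obj.in_tube (\<lambda>t. x t + s m *\<^sub>R W (c m) t) (p + s m *\<^sub>R \<omega>)" for m
      using sc by (intro tube) auto
    fix m a assume "a < k + l"
    then show "int_functional T (C a) (\<lambda>t. x t + s m *\<^sub>R W (c m) t) (p + s m *\<^sub>R \<omega>)
       = int_functional T (C a) x p + s m * dC a v \<omega>"
      using sc(6)[of a m] sc(1)[of m] by (simp add: f_def field_simps)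
  qed (use sc W00 in auto)
qed

text \<open>Along the curves of \<open>exact_steps\<close> the constraint values are affine in the
  step: equalities stay 0, active inequalities stay nonnegative by the sign of the slope, inactive
  ones by continuity. The curves are thus eventually admissible, and optimality makes the quotients
  of the objective nonpositive.\<close>

lemma no_ascent_direction:
  assumes v: "v \<in> C1_space_00 T"
    and eq: "\<And>a. k \<le> a \<Longrightarrow> a < k + l \<Longrightarrow> dC a v 0 = 0"
    and ineq: "\<And>a. a < k \<Longrightarrow> int_functional T (C a) x p = 0 \<Longrightarrow> dC a v 0 \<ge> 0"
  shows "dL v 0 \<le> 0"
proof -
  obtain s w where s: "\<And>m. 0 < s m" "s \<longlonglongrightarrow> 0" and w: "\<And>m. w m \<in> C1_space_00 T"
    and conv: "(\<lambda>m. C1_norm T (\<lambda>t. w m t - v t)) \<longlonglongrightarrow> 0"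
    and tube: "\<And>m. obj.in_tube (\<lambda>t. x t + s m *\<^sub>R w m t) (p + s m *\<^sub>R 0)"
    and val: "\<And>m a. a < k + l \<Longrightarrow> int_functional T (C a) (\<lambda>t. x t + s m *\<^sub>R w m t) (p + s m *\<^sub>R 0)
       = int_functional T (C a) x p + s m * dC a v 0"
    using exact_steps[OF v, of 0] by blast
  have "eventually (\<lambda>m. int_functional T (C a) x p + s m * dC a v 0 \<ge> 0) sequentially" if "a < k" for a
  proof (cases "int_functional T (C a) x p = 0")
    case True
    then show ?thesis using ineq[OF that True] s by (simp add: less_imp_le)
  next
    case False
    have "(\<lambda>m. int_functional T (C a) x p + s m * dC a v 0) \<longlonglongrightarrow> int_functional T (C a) x p + 0 * dC a v 0"
      by (intro tendsto_intros s)
    then have "eventually (\<lambda>m. int_functional T (C a) x p + s m * dC a v 0 > 0) sequentially"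
      by (rule order_tendstoD(1)) (use False constraint_values(1)[OF that p_P] in auto)
    then show ?thesis by eventually_elim simp
  qed
  then have "eventually (\<lambda>m. \<forall>a\<in>{..<k}. int_functional T (C a) x p + s m * dC a v 0 \<ge> 0) sequentially"
    by (intro eventually_ball_finite) auto
  then have "eventually (\<lambda>m. (1 / s m) * (int_functional T L (\<lambda>t. x t + s m *\<^sub>R w m t) (p + s m *\<^sub>R 0)
      - int_functional T L x p) \<le> 0) sequentially"
  proof eventually_elim
    case (elim m)
    have "(\<lambda>t. x t + s m *\<^sub>R w m t) \<in> adm (p + s m *\<^sub>R 0)"
    proof (rule admissible_step[OF w tube])
      show "0 \<le> int_functional T (C a) (\<lambda>t. x t + s m *\<^sub>R w m t) (p + s m *\<^sub>R 0)" if "a < k" for a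
        using elim that by (simp only: val trans_less_add1 lessThan_iff)
      show "int_functional T (C a) (\<lambda>t. x t + s m *\<^sub>R w m t) (p + s m *\<^sub>R 0) = 0" if "k \<le> a" "a < k + l" for a
        using val[OF that(2), of m] eq[OF that] constraint_values(2)[OF that p_P] by simp
    qed
    then have "int_functional T L (\<lambda>t. x t + s m *\<^sub>R w m t) p \<le> int_functional T L x p"
      using le_V[OF _ p_P] V_eq[OF p_P] by simp
    then show ?case using s(1)[of m] by (simp add: divide_nonpos_pos)
  qed
  with obj.functional_variation[OF C1_space_00D[OF w] C1_space_00D[OF v] conv s, where \<omega> = 0]
  show ?thesis by (rule tendsto_upperbound) simp
qed

text \<open>Forced by duality: the stationarity equation tested with \<open>e a\<close> contains no
  other multiplier.\<close>

definition mult :: "nat \<Rightarrow> real" where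
  "mult a = - dL (e a) 0"

text \<open>Subtracting from a multiple of \<open>v\<close> its components along the dual functions
  annihilates every constraint differential, so the result is no ascent direction; the signs 1 and
  -1 together give equality.\<close>

lemma stationary:
  assumes v: "v \<in> C1_space_00 T"
  shows "dL v 0 + (\<Sum>a<k+l. mult a * dC a v 0) = 0"
proof -
  have le: "s * (dL v 0 + (\<Sum>a<k+l. mult a * dC a v 0)) \<le> 0" for s
  proof -
    define u where "u t = s *\<^sub>R v t + (\<Sum>b<k+l. (- s * dC b v 0) *\<^sub>R e b t)" for t
    have sv: "(\<lambda>t. s *\<^sub>R v t) \<in> C1_space_00 T"
      using v C1_space_scaleR(1)[OF T, of v s] by (simp add: C1_space_00_def)
    have u: "u \<in> C1_space_00 T"
      unfolding u_def by (rule C1_space_00_add_sum[OF T sv e])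
    have du: "int_differential T \<psi> x p u 0 = s * int_differential T \<psi> x p v 0
        + (\<Sum>b<k+l. (- s * dC b v 0) * int_differential T \<psi> x p (e b) 0)"
      if "regular_integrand T r M P \<psi> x p \<xi>" for \<psi>
    proof -
      interpret q: regular_integrand T r M P \<psi> x p \<xi> by (rule that)
      show ?thesis
        unfolding u_def using q.differential_scaleR[OF C1_space_00D[OF v], of s 0]
        by (subst q.differential_add_sum[OF C1_space_00D[OF sv] eC1]) simp_all
    qed
    have "dC a u 0 = 0" if "a < k + l" for a
      using du[OF con[OF that]] that by (simp add: dual if_distrib cong: if_cong)
    then have "dL u 0 \<le> 0" by (intro no_ascent_direction[OF u]) auto
    then show ?thesis
      using du[OF obj.regular_integrand_axioms]
      by (simp add: mult_def algebra_simps sum_distrib_left)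
  qed
  from le[of 1] le[of "-1"] show ?thesis by simp
qed

text \<open>Moving along \<open>e a\<close> raises the inequality \<open>a\<close> to first order
  and leaves the other constraints unchanged, so it cannot raise the objective.\<close>

lemma mult_nonneg: "a < k \<Longrightarrow> mult a \<ge> 0"
  unfolding mult_def using no_ascent_direction[OF e[of a]] dual by simp

text \<open>If the inequality is inactive, the reversed direction \<open>- e a\<close> is permitted
  too, and it gives the opposite sign.\<close>

lemma mult_slack:
  assumes "a < k"
  shows "mult a * int_functional T (C a) x p = 0"
proof (cases "int_functional T (C a) x p = 0")
  case False
  define u where "u = (\<lambda>t. (- 1) *\<^sub>R e a t)"
  have u: "u \<in> C1_space_00 T"
    using e[of a] assms C1_space_scaleR(1)[OF T eC1[of a], of "-1"] by (simp add: C1_space_00_def u_def)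
  have du: "int_differential T \<psi> x p u 0 = - int_differential T \<psi> x p (e a) 0"
    if "regular_integrand T r M P \<psi> x p \<xi>" for \<psi>
    using regular_integrand.differential_scaleR[OF that eC1[of a], of "-1" 0] assms unfolding u_def by simp
  have "dL u 0 \<le> 0"
    by (rule no_ascent_direction[OF u]) (use du[OF con] dual[of _ a] assms False in auto)
  then have "mult a \<le> 0" using du[OF obj.regular_integrand_axioms] by (simp add: mult_def)
  then show ?thesis using mult_nonneg[OF assms] by simp
qed simp

lemma C1_hadamard_differential_unique:
  assumes "has_hadamard_differential_on_C1 T \<Phi> y D" "has_hadamard_differential_on_C1 T \<Phi> y D'" "v \<in> C1_space T"
  shows "D v = D' v"
proof -
  have *: "\<forall>m. (0::real) < 1 / real (Suc m)" "(\<lambda>m. 1 / real (Suc m)) \<longlonglongrightarrow> 0"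
    using LIMSEQ_Suc[OF lim_1_over_n] by simp_all
  have 0: "(\<lambda>m::nat. C1_norm T (\<lambda>t. v t - v t)) \<longlonglongrightarrow> 0"
    by (simp add: C1_norm_zero[OF T])
  have lim: "(\<lambda>m. (1 / (1 / real (Suc m))) * (\<Phi> (\<lambda>t. y t + (1 / real (Suc m)) *\<^sub>R v t) - \<Phi> y)) \<longlonglongrightarrow> E v"
    if "has_hadamard_differential_on_C1 T \<Phi> y E" for E
    using that[unfolded has_hadamard_differential_on_C1_def has_hadamard_variation_on_C1_def,
        THEN conjunct1, rule_format, OF assms(3), of "\<lambda>m. 1 / real (Suc m)" "\<lambda>m. v"] * 0 assms(3) by blast
  show ?thesis by (rule LIMSEQ_unique[OF lim[OF assms(1)] lim[OF assms(2)]])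
qed

lemma C_shift: "i \<in> {1..k} \<Longrightarrow> C (i - 1) = g i" "j \<in> {1..l} \<Longrightarrow> C (k + j - 1) = h j"
  unfolding constraint_def by auto

lemma the_KKT: "the_KKT_multipliers T L k g l h p x (\<lambda>i. mult (i - 1)) (\<lambda>j. mult (k + j - 1))"
  unfolding the_KKT_multipliers_def
proof (intro conjI allI impI)
  show "KKT_multipliers T L k g l h p x (\<lambda>i. mult (i - 1)) (\<lambda>j. mult (k + j - 1))"
    unfolding KKT_multipliers_def
  proof (rule conjI)
    show "\<forall>i\<in>{1..k}. 0 \<le> mult (i - 1) \<and> mult (i - 1) * int_functional T (g i) x p = 0"
    proof
      fix i assume i: "i \<in> {1..k}"
      then show "0 \<le> mult (i - 1) \<and> mult (i - 1) * int_functional T (g i) x p = 0"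
        using mult_nonneg[of "i - 1"] mult_slack[of "i - 1"] C_shift(1)[OF i] by auto
    qed
    show "\<exists>DJ DG DH.
        has_hadamard_differential_on_C1 T (\<lambda>y. int_functional T L y p) x DJ \<and>
        (\<forall>i\<in>{1..k}. has_hadamard_differential_on_C1 T (\<lambda>y. int_functional T (g i) y p) x (DG i)) \<and>
        (\<forall>j\<in>{1..l}. has_hadamard_differential_on_C1 T (\<lambda>y. int_functional T (h j) y p) x (DH j)) \<and>
        (\<forall>\<eta>\<in>C1_space_00 T. DJ \<eta> + (\<Sum>i=1..k. mult (i - 1) * DG i \<eta>)
           + (\<Sum>j=1..l. mult (k + j - 1) * DH j \<eta>) = 0)"
    proof (rule exI[of _ "\<lambda>v. dL v 0"], rule exI[of _ "\<lambda>i v. int_differential T (g i) x p v 0"],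
        rule exI[of _ "\<lambda>i v. int_differential T (h i) x p v 0"], intro conjI ballI)
      fix \<eta> :: "real \<Rightarrow> real ^ 'n" assume "\<eta> \<in> C1_space_00 T"
      from stationary[OF this, unfolded sum_constraint[of mult "\<lambda>\<psi>. int_differential T \<psi> x p \<eta> 0" k g h l]]
      show "dL \<eta> 0 + (\<Sum>i=1..k. mult (i - 1) * int_differential T (g i) x p \<eta> 0)
           + (\<Sum>j=1..l. mult (k + j - 1) * int_differential T (h j) x p \<eta> 0) = 0"
        by (simp only: add.assoc)
    qed (auto intro!: regular_integrand.has_hadamard_differential_on_C1_functional regular)
  qed
next
  fix lam' mu' assume KKT: "KKT_multipliers T L k g l h p x lam' mu'"
  then obtain DJ DG DH where D:
    "has_hadamard_differential_on_C1 T (\<lambda>y. int_functional T L y p) x DJ"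
    "\<forall>i\<in>{1..k}. has_hadamard_differential_on_C1 T (\<lambda>y. int_functional T (g i) y p) x (DG i)"
    "\<forall>j\<in>{1..l}. has_hadamard_differential_on_C1 T (\<lambda>y. int_functional T (h j) y p) x (DH j)"
    and stat: "\<forall>\<eta>\<in>C1_space_00 T. DJ \<eta> + (\<Sum>i=1..k. lam' i * DG i \<eta>) + (\<Sum>j=1..l. mu' j * DH j \<eta>) = 0"
    unfolding KKT_multipliers_def by blast
  define \<nu> where "\<nu> a = constraint k lam' mu' a" for a
  have \<nu>: "\<nu> (i - 1) = lam' i" if "i \<in> {1..k}" for i
    using that by (auto simp: \<nu>_def constraint_def)
  have \<nu>': "\<nu> (k + i - 1) = mu' i" if "i \<in> {1..l}" for i
    using that by (auto simp: \<nu>_def constraint_def)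
  have eq: "dL v 0 + (\<Sum>a<k+l. \<nu> a * dC a v 0) = 0" if v: "v \<in> C1_space_00 T" for v
  proof -
    note v1 = C1_space_00D[OF v]
    have DJ: "DJ v = dL v 0"
      using C1_hadamard_differential_unique[OF D(1) obj.has_hadamard_differential_on_C1_functional v1] .
    have DG: "DG i v = int_differential T (g i) x p v 0" if "i \<in> {1..k}" for i
    proof -
      have "regular_integrand T r M P (g i) x p \<xi>" using that by (intro regular) auto
      from C1_hadamard_differential_unique[OF D(2)[rule_format, OF that]
          regular_integrand.has_hadamard_differential_on_C1_functional[OF this] v1]
      show ?thesis .
    qed
    have DH: "DH i v = int_differential T (h i) x p v 0" if "i \<in> {1..l}" for i
    proof -
      have "regular_integrand T r M P (h i) x p \<xi>" using that by (intro regular) auto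
      from C1_hadamard_differential_unique[OF D(3)[rule_format, OF that]
          regular_integrand.has_hadamard_differential_on_C1_functional[OF this] v1]
      show ?thesis .
    qed
    have "(\<Sum>i=1..k. lam' i * DG i v) = (\<Sum>i=1..k. \<nu> (i - 1) * int_differential T (g i) x p v 0)"
      by (intro sum.cong refl) (simp only: \<nu> DG)
    moreover have "(\<Sum>j=1..l. mu' j * DH j v)
        = (\<Sum>j=1..l. \<nu> (k + j - 1) * int_differential T (h j) x p v 0)"
      by (intro sum.cong refl) (simp only: \<nu>' DH)
    moreover note stat[rule_format, OF v] DJ
    ultimately show ?thesis
      unfolding sum_constraint[of \<nu> "\<lambda>\<psi>. int_differential T \<psi> x p v 0" k g h l] by linarith
  qed
  \<comment> \<open>Uniqueness: duality reduces the stationarity equation at \<open>e b\<close> to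
    the single unknown \<open>\<nu> b\<close>.\<close>
  have "\<nu> b = mult b" if "b < k + l" for b
    using eq[OF e[OF that]] that by (simp add: dual mult_def if_distrib cong: if_cong)
  then have \<nu>_mult: "\<And>b. b < k + l \<Longrightarrow> \<nu> b = mult b" .
  show "\<forall>i\<in>{1..k}. lam' i = mult (i - 1)"
  proof
    fix i assume i: "i \<in> {1..k}"
    then show "lam' i = mult (i - 1)" using \<nu>[OF i] \<nu>_mult[of "i - 1"] by auto
  qed
  show "\<forall>j\<in>{1..l}. mu' j = mult (k + j - 1)"
  proof
    fix i assume i: "i \<in> {1..l}"
    then show "mu' i = mult (k + i - 1)" using \<nu>'[OF i] \<nu>_mult[of "k + i - 1"] by auto
  qed
qed

text \<open>The derivative of the Lagrangian in the parameter, with the curve and the multipliers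
  held fixed.\<close>

definition envelope :: "'y \<Rightarrow> real" where
  "envelope \<omega> = dL (\<lambda>t. 0) \<omega> + (\<Sum>a<k+l. mult a * dC a (\<lambda>t. 0) \<omega>)"

lemma envelope_rhs_eq:
  "envelope_rhs T L k g l h p x (\<lambda>i. mult (i - 1)) (\<lambda>j. mult (k + j - 1)) \<omega> = envelope \<omega>"
proof -
  have "(LINT t:{0..T}|lborel. DH4_along T \<psi> x p \<omega> t) = int_differential T \<psi> x p (\<lambda>t. 0) \<omega>"
    if "\<psi> \<in> {L} \<union> g ` {1..k} \<union> h ` {1..l}" for \<psi>
    using regular_integrand.integral_DH4_along[OF regular[OF that]] .
  then show ?thesis
    unfolding envelope_def envelope_rhs_def
      sum_constraint[of mult "\<lambda>\<psi>. int_differential T \<psi> x p (\<lambda>t. 0) \<omega>" k g h l]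
    by (auto simp: add.assoc intro!: arg_cong2[of _ _ _ _ "(+)"] sum.cong)
qed

lemma linear_envelope:
  "envelope (\<omega> + \<omega>') = envelope \<omega> + envelope \<omega>'" "envelope (c *\<^sub>R \<omega>) = c * envelope \<omega>"
proof -
  have add: "int_differential T \<psi> x p (\<lambda>t. 0) (\<omega> + \<omega>') = int_differential T \<psi> x p (\<lambda>t. 0) \<omega> + int_differential T \<psi> x p (\<lambda>t. 0) \<omega>'"
    and scale: "int_differential T \<psi> x p (\<lambda>t. 0) (c *\<^sub>R \<omega>) = c * int_differential T \<psi> x p (\<lambda>t. 0) \<omega>"
    if "regular_integrand T r M P \<psi> x p \<xi>" for \<psi> \<omega> \<omega>' c
    using regular_integrand.differential_add[OF that C1_space_const[of 0] C1_space_const[of 0], of \<omega> \<omega>']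
      regular_integrand.differential_scaleR[OF that C1_space_const[of 0], of c \<omega>] by simp_all
  show "envelope (\<omega> + \<omega>') = envelope \<omega> + envelope \<omega>'"
    unfolding envelope_def
    by (simp add: add[OF obj.regular_integrand_axioms] add[OF con] sum.distrib algebra_simps cong: sum.cong_simp)
  show "envelope (c *\<^sub>R \<omega>) = c * envelope \<omega>"
    unfolding envelope_def
    by (simp add: scale[OF obj.regular_integrand_axioms] scale[OF con] sum_distrib_left algebra_simps cong: sum.cong_simp)
qed

lemma bounded_linear_envelope: "bounded_linear envelope"
proof (rule bounded_linear_intro[where K = "(LINT t:{0..T}|lborel. \<xi> t) * (1 + (\<Sum>a<k+l. \<bar>mult a\<bar>))"])
  fix \<omega>
  have b: "\<bar>int_differential T \<psi> x p (\<lambda>t. 0) \<omega>\<bar> \<le> (LINT t:{0..T}|lborel. \<xi> t) * norm \<omega>"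
    if "regular_integrand T r M P \<psi> x p \<xi>" for \<psi>
    using regular_integrand.differential_bound[OF that C1_space_const[of 0], of \<omega>] by (simp add: C1_norm_zero[OF T])
  have "\<bar>\<Sum>a<k+l. mult a * dC a (\<lambda>t. 0) \<omega>\<bar> \<le> (\<Sum>a<k+l. \<bar>mult a\<bar> * ((LINT t:{0..T}|lborel. \<xi> t) * norm \<omega>))"
    by (rule order_trans[OF sum_abs sum_mono]) (use b[OF con] in \<open>auto simp: abs_mult intro!: mult_left_mono\<close>)
  also have "\<dots> = norm \<omega> * ((LINT t:{0..T}|lborel. \<xi> t) * (\<Sum>a<k+l. \<bar>mult a\<bar>))"
    by (simp add: sum_distrib_right[symmetric] mult.commute)
  finally show "norm (envelope \<omega>) \<le> norm \<omega> * ((LINT t:{0..T}|lborel. \<xi> t) * (1 + (\<Sum>a<k+l. \<bar>mult a\<bar>)))"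
    using b[OF obj.regular_integrand_axioms]
    by (simp add: envelope_def algebra_simps)
qed (simp_all add: linear_envelope)

text \<open>The limit exists and equals \<open>dL d \<omega>\<close>, because the value is the
  objective along the solutions and their quotients converge to \<open>d\<close>. It remains to
  identify \<open>dL d \<omega>\<close> with the envelope expression, by two inequalities.\<close>

theorem envelope_variation:
  assumes d: "has_gateaux_variation_into_C1 T X p \<omega> d"
  shows "has_gateaux_variation V p \<omega> (envelope \<omega>)"
proof -
  define b where "b = r / (norm \<omega> + 1)"
  have b: "0 < b" using obj.r by (simp add: b_def add_nonneg_pos)
  have inP: "p + \<theta> *\<^sub>R \<omega> \<in> P" if "0 < \<theta>" "\<theta> < b" for \<theta>
  proof -
    have "\<theta> * norm \<omega> \<le> \<theta> * (norm \<omega> + 1)" using that by simp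
    also have "\<dots> < r"
      using that(2) pos_less_divide_eq[of "norm \<omega> + 1" \<theta> r] by (simp add: b_def add_nonneg_pos)
    finally show ?thesis using obj.ball_P that by (auto simp: subset_iff dist_norm)
  qed
  define w where "w \<theta> = (\<lambda>t. (1 / \<theta>) *\<^sub>R (X (p + \<theta> *\<^sub>R \<omega>) t - x t))" for \<theta>
  have dC1: "d \<in> C1_space T" using d by (simp add: has_gateaux_variation_into_C1_def)
  have XC1: "X q \<in> C1_space T" if "q \<in> P" for q
    using X_adm[OF that] by (simp add: admissible_def C1_into_def)
  have w: "w \<theta> \<in> C1_space_00 T" if "0 < \<theta>" "\<theta> < b" for \<theta>
    using X_adm[OF inP[OF that]] X_adm[OF p_P]
      C1_space_scaleR(1)[OF T C1_space_diff(1)[OF T XC1[OF inP[OF that]] XC1[OF p_P]], of "1 / \<theta>"]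
    by (simp add: C1_space_00_def w_def admissible_def)
  have Xw: "X (p + \<theta> *\<^sub>R \<omega>) = (\<lambda>t. x t + \<theta> *\<^sub>R w \<theta> t)" if "0 < \<theta>" for \<theta>
    using that by (auto simp: w_def)
  have seq: "(\<lambda>m. (1 / S m) * (int_functional T \<psi> (X (p + S m *\<^sub>R \<omega>)) (p + S m *\<^sub>R \<omega>) - int_functional T \<psi> x p))
      \<longlonglongrightarrow> int_differential T \<psi> x p d \<omega>"
    and seq_norm: "(\<lambda>m. C1_norm T (\<lambda>t. w (S m) t - d t)) \<longlonglongrightarrow> 0"
    if "regular_integrand T r M P \<psi> x p \<xi>" and S: "\<And>m. 0 < S m" "\<And>m. S m < b" "S \<longlonglongrightarrow> 0" for \<psi> S
  proof -
    have "filterlim S (at_right 0) sequentially"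
      unfolding filterlim_at using S(3) by (auto intro!: always_eventually simp: S(1) less_imp_neq[OF S(1), symmetric])
    with d show n: "(\<lambda>m. C1_norm T (\<lambda>t. w (S m) t - d t)) \<longlonglongrightarrow> 0"
      unfolding has_gateaux_variation_into_C1_def w_def by (auto intro: filterlim_compose)
    show "(\<lambda>m. (1 / S m) * (int_functional T \<psi> (X (p + S m *\<^sub>R \<omega>)) (p + S m *\<^sub>R \<omega>) - int_functional T \<psi> x p))
      \<longlonglongrightarrow> int_differential T \<psi> x p d \<omega>"
      using regular_integrand.functional_variation[OF that(1) C1_space_00D[OF w[OF S(1,2)]] dC1 n S(1,3), of \<omega>]
      by (simp add: Xw[OF S(1)])
  qed
  have lim: "has_gateaux_variation V p \<omega> (dL d \<omega>)"
    unfolding has_gateaux_variation_def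
  proof (rule tendsto_at_right_sequentially[OF b])
    fix S :: "nat \<Rightarrow> real" assume S: "\<And>n. 0 < S n" "\<And>n. S n < b" "S \<longlonglongrightarrow> 0"
    show "(\<lambda>n. (1 / S n) *\<^sub>R (V (p + S n *\<^sub>R \<omega>) - V p)) \<longlonglongrightarrow> dL d \<omega>"
      using seq(1)[OF obj.regular_integrand_axioms S]
      by (simp add: V_eq[OF inP[OF S(1,2)]] V_eq[OF p_P])
  qed
  define S where "S m = b / real (Suc (Suc m))" for m
  have S: "0 < S m" "S m < b" for m
    using b by (simp_all add: S_def field_simps add_pos_nonneg)
  have S0: "S \<longlonglongrightarrow> 0" unfolding S_def using LIMSEQ_Suc[OF LIMSEQ_Suc[OF lim_const_over_n]] .
  \<comment> \<open>All solutions share their boundary values, so the quotients vanish at both ends,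
    and so does their limit; this makes \<open>stationary\<close> applicable to
    \<open>d\<close>.\<close>
  have d00: "d \<in> C1_space_00 T"
  proof -
    have w0: "w (S m) 0 = 0" "w (S m) T = 0" for m using w[OF S] by (auto simp: C1_space_00_def)
    have "(\<lambda>m. w (S m) t) \<longlonglongrightarrow> d t" if "t \<in> {0..T}" for t
      using C1_convergence_pointwise(1)[OF T C1_space_00D[OF w[OF S]] dC1
          seq_norm[OF obj.regular_integrand_axioms S S0] that] .
    from this[of 0] this[of T] show ?thesis
      using w0 T dC1 by (simp add: C1_space_00_def LIMSEQ_const_iff)
  qed
  \<comment> \<open>For an active inequality the quotients are nonnegative values divided by the
    step; for an inactive one the multiplier is 0; for an equality the quotients are identically
    0.\<close>
  have dCd: "mult a * dC a d \<omega> \<ge> 0" if a: "a < k + l" for a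
  proof (cases "a < k")
    case True
    show ?thesis
    proof (cases "int_functional T (C a) x p = 0")
      case act: True
      have "0 \<le> dC a d \<omega>"
        by (rule LIMSEQ_le_const[OF seq(1)[OF con[OF a] S S0]])
          (use act constraint_values(1)[OF True inP[OF S]] S(1) in \<open>auto intro!: divide_nonneg_pos\<close>)
      then show ?thesis using mult_nonneg[OF True] by simp
    next
      case False
      then show ?thesis using mult_slack[OF True] by simp
    qed
  next
    case False
    then have "(\<lambda>m::nat. 0::real) \<longlonglongrightarrow> dC a d \<omega>"
      using seq(1)[OF con[OF a] S S0] constraint_values(2)[of a, OF _ a inP[OF S]]
        constraint_values(2)[of a, OF _ a p_P] by simp
    then show ?thesis by (simp add: LIMSEQ_const_iff)
  qed
  have split: "int_differential T \<psi> x p d \<omega> = int_differential T \<psi> x p d 0 + int_differential T \<psi> x p (\<lambda>t. 0) \<omega>"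
    if "regular_integrand T r M P \<psi> x p \<xi>" for \<psi>
    by (rule regular_integrand.differential_split[OF that dC1])
  have "(\<Sum>a<k+l. mult a * dC a d \<omega>) = (\<Sum>a<k+l. mult a * dC a d 0) + (\<Sum>a<k+l. mult a * dC a (\<lambda>t. 0) \<omega>)"
    by (simp add: split[OF con] sum.distrib algebra_simps cong: sum.cong_simp)
  moreover have "0 \<le> (\<Sum>a<k+l. mult a * dC a d \<omega>)"
    using dCd by (intro sum_nonneg) auto
  ultimately have upper: "dL d \<omega> \<le> envelope \<omega>"
    using stationary[OF d00] split[OF obj.regular_integrand_axioms] unfolding envelope_def by linarith
  \<comment> \<open>Chosen to cancel the first-order effect of the parameter on every constraint.
    \<open>exact_steps\<close> then leaves each constraint value exactly as it is at
    \<open>p\<close>, so the competitors are admissible at the perturbed parameter. The leading 0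
    fits the shape of \<open>differential_add_sum\<close>.\<close>
  define v where "v t = 0 + (\<Sum>b<k+l. (- dC b (\<lambda>t. 0) \<omega>) *\<^sub>R e b t)" for t
  have z00: "(\<lambda>t. 0) \<in> C1_space_00 T" by (simp add: C1_space_00_def C1_space_const)
  have v: "v \<in> C1_space_00 T"
    unfolding v_def by (rule C1_space_00_add_sum[OF T z00 e])
  have dv: "int_differential T \<psi> x p v \<omega> = int_differential T \<psi> x p (\<lambda>t. 0) \<omega>
      + (\<Sum>b<k+l. (- dC b (\<lambda>t. 0) \<omega>) * int_differential T \<psi> x p (e b) 0)"
    if "regular_integrand T r M P \<psi> x p \<xi>" for \<psi>
    unfolding v_def by (rule regular_integrand.differential_add_sum[OF that C1_space_const eC1])
  have dCv: "dC a v \<omega> = 0" if "a < k + l" for a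
    using dv[OF con[OF that]] that by (simp add: dual if_distrib cong: if_cong)
  have dLv: "dL v \<omega> = envelope \<omega>"
    using dv[OF obj.regular_integrand_axioms] by (simp add: envelope_def mult_def algebra_simps)
  obtain s u where s: "\<And>m. 0 < s m" "s \<longlonglongrightarrow> 0" and u: "\<And>m. u m \<in> C1_space_00 T"
    and conv: "(\<lambda>m. C1_norm T (\<lambda>t. u m t - v t)) \<longlonglongrightarrow> 0"
    and tube: "\<And>m. obj.in_tube (\<lambda>t. x t + s m *\<^sub>R u m t) (p + s m *\<^sub>R \<omega>)"
    and val: "\<And>m a. a < k + l \<Longrightarrow> int_functional T (C a) (\<lambda>t. x t + s m *\<^sub>R u m t) (p + s m *\<^sub>R \<omega>)
       = int_functional T (C a) x p + s m * dC a v \<omega>"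
    using exact_steps[OF v, of \<omega>] by blast
  have "int_functional T L (\<lambda>t. x t + s m *\<^sub>R u m t) (p + s m *\<^sub>R \<omega>) \<le> V (p + s m *\<^sub>R \<omega>)" for m
  proof (rule le_V)
    show "(\<lambda>t. x t + s m *\<^sub>R u m t) \<in> adm (p + s m *\<^sub>R \<omega>)"
    proof (rule admissible_step[OF u tube])
      show "0 \<le> int_functional T (C a) (\<lambda>t. x t + s m *\<^sub>R u m t) (p + s m *\<^sub>R \<omega>)" if "a < k" for a
        using val[of a m] dCv[of a] constraint_values(1)[OF that p_P] that by simp
      show "int_functional T (C a) (\<lambda>t. x t + s m *\<^sub>R u m t) (p + s m *\<^sub>R \<omega>) = 0" if "k \<le> a" "a < k + l" for a
        using val[OF that(2), of m] dCv[OF that(2)] constraint_values(2)[OF that p_P] by simp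
    qed
    show "p + s m *\<^sub>R \<omega> \<in> P" using tube[of m] obj.ball_P unfolding obj.in_tube_def by auto
  qed
  then have le: "(1 / s m) * (int_functional T L (\<lambda>t. x t + s m *\<^sub>R u m t) (p + s m *\<^sub>R \<omega>) - int_functional T L x p)
      \<le> (1 / s m) *\<^sub>R (V (p + s m *\<^sub>R \<omega>) - V p)" for m
    using s(1)[of m] V_eq[OF p_P] by (simp add: divide_right_mono)
  have "filterlim s (at_right 0) sequentially"
    unfolding filterlim_at using s(2) by (auto intro!: always_eventually simp: s(1) less_imp_neq[OF s(1), symmetric])
  with lim have "(\<lambda>m. (1 / s m) *\<^sub>R (V (p + s m *\<^sub>R \<omega>) - V p)) \<longlonglongrightarrow> dL d \<omega>"
    unfolding has_gateaux_variation_def by (rule filterlim_compose)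
  moreover have "(\<lambda>m. (1 / s m) * (int_functional T L (\<lambda>t. x t + s m *\<^sub>R u m t) (p + s m *\<^sub>R \<omega>) - int_functional T L x p))
      \<longlonglongrightarrow> envelope \<omega>"
    using obj.functional_variation[OF C1_space_00D[OF u] C1_space_00D[OF v] conv s, of \<omega>] dLv by simp
  ultimately have "envelope \<omega> \<le> dL d \<omega>"
    using le by (intro LIMSEQ_le) auto
  with upper lim show ?thesis by simp
qed

theorem envelope_gateaux:
  assumes "\<And>\<omega>. \<exists>d. has_gateaux_variation_into_C1 T X p \<omega> d"
  shows "has_gateaux_differential V p (Blinfun envelope)"
  unfolding has_gateaux_differential_def bounded_linear_Blinfun_apply[OF bounded_linear_envelope]
  using assms envelope_variation by blast

end

section \<open>The du Bois-Reymond lemma for integrable functions\<close>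

text \<open>Integration by parts against the primitive of a function that is merely integrable, done
  by exchanging the order of integration over the triangle \<open>s \<le> t\<close>.\<close>

lemma fubini_triangle:
  fixes p w :: "real \<Rightarrow> real"
  assumes p: "set_integrable lborel {0..T} p" and w: "set_integrable lborel {0..T} w"
  shows "set_integrable lborel {0..T} (\<lambda>t. w t * (LINT s:{0..t}|lborel. p s))"
    and "(LINT s:{0..T}|lborel. p s * (LINT t:{s..T}|lborel. w t))
      = (LINT t:{0..T}|lborel. w t * (LINT s:{0..t}|lborel. p s))"
proof -
  define a where "a s = indicator {0..T} s * p s" for s
  define b where "b t = indicator {0..T} t * w t" for t
  have a: "integrable lborel a" and b: "integrable lborel b"
    using p w unfolding a_def b_def set_integrable_def by simp_all
  have [measurable]: "a \<in> borel_measurable borel" "b \<in> borel_measurable borel"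
    using a b by (auto dest: borel_measurable_integrable)
  define F where "F s t = indicator {z. fst z \<le> snd z} (s, t) * (a s * b t)" for s t :: real
  have ab: "integrable (lborel \<Otimes>\<^sub>M lborel) (\<lambda>(s, t). a s * b t)"
  proof (rule lborel_pair.Fubini_integrable)
    show "integrable lborel (\<lambda>s. LINT t|lborel. norm (case (s, t) of (s, t) \<Rightarrow> a s * b t))"
      using a b by (simp add: abs_mult)
    show "AE s in lborel. integrable lborel (\<lambda>t. case (s, t) of (s, t) \<Rightarrow> a s * b t)"
      using b by simp
  qed measurable
  have "{z \<in> space (lborel \<Otimes>\<^sub>M lborel). fst z \<le> snd z} \<in> sets (lborel \<Otimes>\<^sub>M lborel :: (real \<times> real) measure)"
    by measurable
  then have tri: "{z. fst z \<le> snd z} \<in> sets (lborel \<Otimes>\<^sub>M lborel :: (real \<times> real) measure)"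
    by (simp add: space_pair_measure)
  have "(\<lambda>(s, t). F s t) = (\<lambda>z. indicator {z. fst z \<le> snd z} z *\<^sub>R (case z of (s, t) \<Rightarrow> a s * b t))"
    by (auto simp: F_def fun_eq_iff)
  then have F: "integrable (lborel \<Otimes>\<^sub>M lborel) (\<lambda>(s, t). F s t)"
    using integrable_mult_indicator[OF tri ab] by simp
  have Fs: "(LINT s|lborel. F s t) = indicator {0..T} t * (w t * (LINT s:{0..t}|lborel. p s))" for t
  proof (cases "t \<in> {0..T}")
    case True
    have "F s t = w t * (indicator {0..t} s * p s)" for s
      using True by (auto simp: F_def a_def b_def indicator_def)
    then show ?thesis using True by (simp add: set_lebesgue_integral_def)
  qed (simp add: F_def b_def)
  have Ft: "(LINT t|lborel. F s t) = indicator {0..T} s * (p s * (LINT t:{s..T}|lborel. w t))" for s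
  proof (cases "s \<in> {0..T}")
    case True
    have "F s t = p s * (indicator {s..T} t * w t)" for t
      using True by (auto simp: F_def a_def b_def indicator_def)
    then show ?thesis using True by (simp add: set_lebesgue_integral_def)
  qed (simp add: F_def a_def)
  show "set_integrable lborel {0..T} (\<lambda>t. w t * (LINT s:{0..t}|lborel. p s))"
    using lborel_pair.integrable_snd[OF F] unfolding Fs set_integrable_def by simp
  show "(LINT s:{0..T}|lborel. p s * (LINT t:{s..T}|lborel. w t))
      = (LINT t:{0..T}|lborel. w t * (LINT s:{0..t}|lborel. p s))"
    using lborel_pair.Fubini_integral[OF F] unfolding Fs Ft set_lebesgue_integral_def by simp
qed

text \<open>Continuous ramps approximate indicators of half lines, so the integral over each half
  line vanishes; half lines are stable under intersection and generate the Borel sets, so the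
  integral vanishes over each Borel set.\<close>

lemma AE_zero_if_orthogonal_to_continuous:
  fixes f :: "real \<Rightarrow> real"
  assumes f: "set_integrable lborel {0..T} f"
    and orth: "\<And>w. continuous_on {0..T} w \<Longrightarrow> (LINT t:{0..T}|lborel. f t * w t) = 0"
  shows "AE t in lborel. t \<in> {0..T} \<longrightarrow> f t = 0"
proof -
  define F where "F t = indicator {0..T} t * f t" for t
  have F: "integrable lborel F" using f by (simp add: F_def[abs_def] set_integrable_def)
  have FA: "set_integrable lborel A F" if "A \<in> sets borel" for A
    using integrable_mult_indicator[OF _ F, of A] that by (simp add: set_integrable_def)
  have below: "(LINT t:{..<b}|lborel. F t) = 0" for b
  proof -
    \<comment> \<open>A ramp of slope \<open>- n\<close> ending at \<open>b\<close>: it is 0 from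
      \<open>b\<close> on and 1 up to \<open>b - 1 / n\<close>.\<close>
    define w where "w n t = max 0 (min 1 (real n * (b - t)))" for n t
    have "(\<lambda>n. LINT t|lborel. w n t * F t) \<longlonglongrightarrow> (LINT t|lborel. indicator {..<b} t * F t)"
    proof (rule integral_dominated_convergence[where w = "\<lambda>t. \<bar>F t\<bar>"])
      show "AE t in lborel. (\<lambda>n. w n t * F t) \<longlonglongrightarrow> indicator {..<b} t * F t"
      proof (rule AE_I2)
        fix t
        have "(\<lambda>n. w n t) \<longlonglongrightarrow> indicator {..<b} t"
        proof (cases "t < b")
          case True
          obtain N :: nat where N: "1 / (b - t) < real N" using reals_Archimedean2 by blast
          have "w n t = 1" if "n \<ge> N" for n
          proof -
            have "1 / (b - t) < real n" using N that by linarith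
            then have "1 < real n * (b - t)" using True by (simp add: pos_divide_less_eq)
            then show ?thesis by (simp add: w_def)
          qed
          then have "eventually (\<lambda>n. w n t = 1) sequentially" by (auto simp: eventually_sequentially)
          then show ?thesis using True by (simp add: tendsto_eventually)
        next
          case False
          then have "real n * (b - t) \<le> 0" for n by (simp add: mult_nonneg_nonpos)
          then have "w n t = 0" for n unfolding w_def by (intro max_absorb1 min.coboundedI2)
          then show ?thesis using False by simp
        qed
        then show "(\<lambda>n. w n t * F t) \<longlonglongrightarrow> indicator {..<b} t * F t" by (intro tendsto_intros)
      qed
      show "AE t in lborel. norm (w n t * F t) \<le> \<bar>F t\<bar>" for n
        by (intro AE_I2) (auto simp: w_def abs_mult intro!: mult_left_le_one_le)
    qed (use F in \<open>auto simp: w_def dest: borel_measurable_integrable\<close>)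
    moreover have "(LINT t|lborel. w n t * F t) = 0" for n
    proof -
      have "continuous_on {0..T} (w n)" unfolding w_def by (intro continuous_intros)
      from orth[OF this] show ?thesis
        by (simp add: set_lebesgue_integral_def F_def mult.assoc mult.left_commute mult.commute)
    qed
    ultimately have "(LINT t|lborel. indicator {..<b} t * F t) = 0" by (simp add: LIMSEQ_const_iff)
    then show ?thesis by (simp add: set_lebesgue_integral_def)
  qed
  \<comment> \<open>Needed for complements in the induction over Borel sets; \<open>T + 1\<close>
    gives an open half line containing the whole support.\<close>
  have total: "(LINT t|lborel. F t) = 0"
  proof -
    have "(\<lambda>t. indicator {..<T + 1} t *\<^sub>R F t) = F" by (auto simp: F_def indicator_def)
    then show ?thesis using below[of "T + 1"] unfolding set_lebesgue_integral_def by simp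
  qed
  have "AE t in lborel. F t = 0"
  proof (rule density_unique_real[OF F])
    fix A :: "real set" assume "A \<in> sets lborel"
    then have A: "A \<in> sigma_sets UNIV (range lessThan)" by (simp add: borel_Iio)
    have sub: "range lessThan \<subseteq> Pow (UNIV :: real set)" by simp
    have "{..<a} \<inter> {..<b} = {..<min a b}" for a b :: real by auto
    then have "Int_stable (range (lessThan :: real \<Rightarrow> real set))"
      by (auto simp: Int_stable_def)
    then have "(LINT t:A|lborel. F t) = 0"
      using sub A
    proof (induction rule: sigma_sets_induct_disjoint)
      case (basic A)
      then show ?case using below by auto
    next
      case empty
      then show ?case by (simp add: set_lebesgue_integral_def)
    next
      case (compl A)
      then have A: "A \<in> sets borel" by (simp add: borel_Iio)
      have "indicator (UNIV - A) t *\<^sub>R F t = F t - indicator A t *\<^sub>R F t" for t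
        by (auto simp: indicator_def)
      then show ?case
        using compl total F FA[OF A]
        by (simp add: set_lebesgue_integral_def set_integrable_def del: Compl_eq_Diff_UNIV)
    next
      case (union A)
      then have "\<And>i. A i \<in> sets borel" by (auto simp: borel_Iio)
      then show ?case
        using union by (subst lebesgue_integral_countable_add) (auto simp: disjoint_family_on_def intro!: FA)
    qed
    then show "(LINT t:A|lborel. F t) = (LINT t:A|lborel. 0)" by simp
  qed simp
  then show ?thesis by eventually_elim (auto simp: F_def)
qed

text \<open>An arbitrary continuous function, minus its mean, is the derivative of an admissible
  test function. Integration by parts then shows that \<open>q\<close> minus the primitive of
  \<open>p\<close>, minus its own mean \<open>c\<close>, is orthogonal to all continuous
  functions.\<close>

lemma du_bois_reymond:
  fixes p q :: "real \<Rightarrow> real"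
  assumes T: "T > 0"
    and p: "set_integrable lborel {0..T} p" and q: "set_integrable lborel {0..T} q"
    and orth: "\<And>\<eta>. \<eta> \<in> C1_space_00 T \<Longrightarrow> (LINT t:{0..T}|lborel. p t * \<eta> t + q t * deriv_on T \<eta> t) = 0"
  obtains c where "AE t in lborel. t \<in> {0..T} \<longrightarrow> q t = (LINT s:{0..t}|lborel. p s) + c"
proof -
  define R where "R t = (LINT s:{0..t}|lborel. p s)" for t
  have one: "set_integrable lborel {0..T} (\<lambda>t. 1 :: real)"
    by (intro borel_integrable_atLeastAtMost') auto
  have R: "set_integrable lborel {0..T} R"
    using fubini_triangle(1)[OF p one] by (simp add: R_def[abs_def])
  define c where "c = (LINT t:{0..T}|lborel. q t - R t) / T"
  have qR: "set_integrable lborel {0..T} (\<lambda>t. q t - R t)"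
    using q R by (rule set_integral_diff(1))
  have cw: "set_integrable lborel {0..T} (\<lambda>t. u t * w t)"
    if u: "set_integrable lborel {0..T} u" and w: "continuous_on {0..T} w" for u w :: "real \<Rightarrow> real"
  proof -
    obtain B where B: "\<And>t. t \<in> {0..T} \<Longrightarrow> norm (w t) \<le> B"
      using compact_imp_bounded[OF compact_continuous_image[OF w]] unfolding bounded_iff by blast
    have m: "set_borel_measurable lborel {0..T} (\<lambda>t. u t * w t)"
    proof -
      have "(\<lambda>t. indicator {0..T} t *\<^sub>R u t) \<in> borel_measurable lborel"
        using u unfolding set_integrable_def by (rule borel_measurable_integrable)
      moreover have "(\<lambda>t. indicator {0..T} t *\<^sub>R w t) \<in> borel_measurable lborel"
        using borel_measurable_continuous_on_indicator[OF _ w] by simp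
      ultimately have "(\<lambda>t. (indicator {0..T} t *\<^sub>R u t) * (indicator {0..T} t *\<^sub>R w t)) \<in> borel_measurable lborel"
        by measurable
      also have "(\<lambda>t. (indicator {0..T} t *\<^sub>R u t) * (indicator {0..T} t *\<^sub>R w t)) = (\<lambda>t. indicator {0..T} t *\<^sub>R (u t * w t))"
        by (auto simp: indicator_def)
      finally show ?thesis unfolding set_borel_measurable_def .
    qed
    have "set_integrable lborel {0..T} (\<lambda>t. u t * B)" using u by simp
    then show ?thesis
      by (rule set_integrable_bound[OF _ m])
        (use B in \<open>force intro!: AE_I2 mult_left_mono simp: abs_mult\<close>)
  qed
  have "(LINT t:{0..T}|lborel. (q t - R t - c) * w t) = 0" if w: "continuous_on {0..T} w" for w
  proof -
    define m where "m = integral {0..T} w / T"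
    have w_int: "set_integrable lborel {0..T} w" using w by (rule borel_integrable_atLeastAtMost')
    have mw: "(LINT t:{0..T}|lborel. w t) = m * T"
      using set_borel_integral_eq_integral(2)[OF w_int] T by (simp add: m_def)
    \<comment> \<open>The mean is removed so that the primitive \<eta> vanishes at \<open>T\<close>
      as well as at 0.\<close>
    define w1 where "w1 t = w t - m" for t
    have w1: "continuous_on {0..T} w1" unfolding w1_def by (intro continuous_intros w)
    have w1_int: "set_integrable lborel {0..T} w1" using w1 by (rule borel_integrable_atLeastAtMost')
    define \<eta> where "\<eta> t = integral {0..t} w1" for t
    have d: "(\<eta> has_vector_derivative w1 t) (at t within {0..T})" if "t \<in> {0..T}" for t
      unfolding \<eta>_def by (rule integral_has_vector_derivative[OF w1 that])
    have w1_total: "(LINT t:{0..T}|lborel. w1 t) = 0"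
      unfolding w1_def using mw T set_integral_diff(2)[OF w_int, of "\<lambda>t. m"]
      by (simp add: borel_integrable_atLeastAtMost' set_lebesgue_integral_def)
    have tail: "(LINT t:{s..T}|lborel. w1 t) = - \<eta> s" if s: "s \<in> {0..T}" for s
    proof -
      have "integral {0..s} w1 + integral {s..T} w1 = integral {0..T} w1"
        using s by (intro Henstock_Kurzweil_Integration.integral_combine integrable_continuous_interval w1) auto
      moreover have "(LINT t:{s..T}|lborel. w1 t) = integral {s..T} w1"
        using s by (intro set_borel_integral_eq_integral(2) set_integrable_subset[OF w1_int]) auto
      moreover have "integral {0..T} w1 = 0"
        using w1_total set_borel_integral_eq_integral(2)[OF w1_int] by simp
      ultimately show ?thesis by (simp add: \<eta>_def)
    qed
    have "\<eta> T = 0" "\<eta> 0 = 0"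
      using w1_total set_borel_integral_eq_integral(2)[OF w1_int] by (simp_all add: \<eta>_def)
    then have \<eta>: "\<eta> \<in> C1_space_00 T"
      using C1_spaceI[OF d w1] by (simp add: C1_space_00_def)
    have p\<eta>: "set_integrable lborel {0..T} (\<lambda>t. p t * \<eta> t)"
      by (rule cw[OF p C1_space_continuous_on[OF C1_space_00D[OF \<eta>]]])
    have "0 = (LINT t:{0..T}|lborel. p t * \<eta> t + q t * deriv_on T \<eta> t)" using orth[OF \<eta>] by simp
    also have "\<dots> = (LINT t:{0..T}|lborel. p t * \<eta> t + q t * w1 t)"
      by (rule set_lebesgue_integral_cong) (use deriv_on_eqI[OF T _ d] in auto)
    also have "\<dots> = (LINT t:{0..T}|lborel. p t * \<eta> t) + (LINT t:{0..T}|lborel. q t * w1 t)"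
      by (rule set_integral_add(2)[OF p\<eta> cw[OF q w1]])
    also have "(LINT t:{0..T}|lborel. p t * \<eta> t) = - (LINT t:{0..T}|lborel. p t * (LINT u:{t..T}|lborel. w1 u))"
    proof -
      have "(LINT t:{0..T}|lborel. p t * \<eta> t) = (LINT t:{0..T}|lborel. - (p t * (LINT u:{t..T}|lborel. w1 u)))"
        by (rule set_lebesgue_integral_cong) (use tail in auto)
      then show ?thesis by (simp add: set_lebesgue_integral_def)
    qed
    also have "(LINT t:{0..T}|lborel. p t * (LINT u:{t..T}|lborel. w1 u)) = (LINT t:{0..T}|lborel. w1 t * R t)"
      unfolding R_def by (rule fubini_triangle(2)[OF p w1_int])
    also have "- (LINT t:{0..T}|lborel. w1 t * R t) + (LINT t:{0..T}|lborel. q t * w1 t)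
        = (LINT t:{0..T}|lborel. q t * w1 t - R t * w1 t)"
      by (subst set_integral_diff(2)[OF cw[OF q w1] cw[OF R w1]]) (simp add: mult.commute)
    also have "\<dots> = (LINT t:{0..T}|lborel. (q t - R t) * w t - m * (q t - R t))"
      by (rule set_lebesgue_integral_cong) (auto simp: w1_def algebra_simps)
    also have "\<dots> = (LINT t:{0..T}|lborel. (q t - R t) * w t) - m * (LINT t:{0..T}|lborel. q t - R t)"
      by (subst set_integral_diff(2)[OF cw[OF qR w]]) (use qR in simp_all)
    \<comment> \<open>Both corrections equal the product of the integrals of \<open>w\<close> and of
      \<open>q - R\<close>, divided by \<open>T\<close>; the mean taken off \<open>w\<close> is
      thereby passed to \<open>q - R\<close>.\<close>
    also have "\<dots> = (LINT t:{0..T}|lborel. (q t - R t) * w t) - c * (LINT t:{0..T}|lborel. w t)"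
      using T by (simp add: mw c_def)
    also have "\<dots> = (LINT t:{0..T}|lborel. (q t - R t) * w t - c * w t)"
      by (subst set_integral_diff(2)[OF cw[OF qR w]]) (use w_int in simp_all)
    also have "\<dots> = (LINT t:{0..T}|lborel. (q t - R t - c) * w t)"
      by (simp add: algebra_simps)
    finally show ?thesis by simp
  qed
  moreover have "set_integrable lborel {0..T} (\<lambda>t. q t - R t - c)"
    by (intro set_integral_diff(1) qR borel_integrable_atLeastAtMost') auto
  ultimately have "AE t in lborel. t \<in> {0..T} \<longrightarrow> q t - R t - c = 0"
    by (intro AE_zero_if_orthogonal_to_continuous)
  then have "AE t in lborel. t \<in> {0..T} \<longrightarrow> q t = (LINT s:{0..t}|lborel. p s) + c"
    by eventually_elim (auto simp: R_def)
  then show ?thesis by (rule that)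
qed

lemma C1_space_00_scale_vector:
  fixes \<eta> :: "real \<Rightarrow> real" and v :: "'a::real_normed_vector"
  assumes T: "T > 0" and "\<eta> \<in> C1_space_00 T"
  shows "(\<lambda>t. \<eta> t *\<^sub>R v) \<in> C1_space_00 T"
    and "t \<in> {0..T} \<Longrightarrow> deriv_on T (\<lambda>t. \<eta> t *\<^sub>R v) t = deriv_on T \<eta> t *\<^sub>R v"
proof -
  note \<eta> = C1_space_00D[OF assms(2)]
  have *: "((\<lambda>t. \<eta> t *\<^sub>R v) has_vector_derivative deriv_on T \<eta> t *\<^sub>R v) (at t within {0..T})"
    if "t \<in> {0..T}" for t
    using bounded_linear.has_vector_derivative[OF bounded_linear_scaleR_left
        has_vector_derivative_deriv_on[OF T \<eta> that]] .
  have "(\<lambda>t. \<eta> t *\<^sub>R v) \<in> C1_space T"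
    by (rule C1_spaceI[OF *]) (auto intro!: continuous_intros continuous_on_deriv_on T \<eta>)
  then show "(\<lambda>t. \<eta> t *\<^sub>R v) \<in> C1_space_00 T"
    using assms(2) by (simp add: C1_space_00_def)
  show "t \<in> {0..T} \<Longrightarrow> deriv_on T (\<lambda>t. \<eta> t *\<^sub>R v) t = deriv_on T \<eta> t *\<^sub>R v"
    by (rule deriv_on_eqI[OF T _ *])
qed

text \<open>A combination of the differentials that vanishes on the test functions is the weak form
  of an Euler-Lagrange equation. Testing with scalar functions times a fixed vector and applying
  \<open>du_bois_reymond\<close> yields its integrated form, which (Con) excludes for nonzero
  coefficients.\<close>

lemma constraints_independent:
  fixes g h :: "nat \<Rightarrow> ('n::finite, 'y::real_normed_vector) integrand"
  assumes regular: "\<And>a. a < k + l \<Longrightarrow> regular_integrand T r M P (constraint k g h a) x p \<xi>"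
    and T: "T > 0"
    and Con: "\<forall>(lam :: nat \<Rightarrow> real) (mu :: nat \<Rightarrow> real).
         (\<exists>i\<in>{1..k}. lam i \<noteq> 0) \<or> (\<exists>j\<in>{1..l}. mu j \<noteq> 0) \<longrightarrow>
         \<not> (\<exists>c :: (real ^ 'n) \<Rightarrow>\<^sub>L real.
              AE t in lborel. t \<in> {0..T} \<longrightarrow>
                (\<forall>e :: real ^ 'n.
                   blinfun_apply (DH3 (combined_integrand k g l h lam mu) t (x t) (deriv_on T x t) p) e
                   = (LINT s:{0..t}|lborel.
                        blinfun_apply (DH2 (combined_integrand k g l h lam mu) s (x s) (deriv_on T x s) p) e)
                     + blinfun_apply c e))"
    and vanish: "\<forall>v\<in>C1_space_00 T. (\<Sum>a<k+l. \<nu> a * int_differential T (constraint k g h a) x p v 0) = 0"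
  shows "\<forall>a<k+l. \<nu> a = 0"
proof (rule ccontr)
  assume nz: "\<not> (\<forall>a<k+l. \<nu> a = 0)"
  let ?C = "constraint k g h"
  define lam mu where "lam i = \<nu> (i - 1)" and "mu j = \<nu> (k + j - 1)" for i j :: nat
  define D where "D a t = DH234 (?C a) t (x t) (deriv_on T x t) p" for a t
  obtain a where a: "a < k + l" "\<nu> a \<noteq> 0" using nz by blast
  have "(\<exists>i\<in>{1..k}. lam i \<noteq> 0) \<or> (\<exists>j\<in>{1..l}. mu j \<noteq> 0)"
  proof (cases "a < k")
    case True
    then have "Suc a \<in> {1..k}" "lam (Suc a) \<noteq> 0" using a by (auto simp: lam_def)
    then show ?thesis by blast
  next
    case False
    then have "Suc (a - k) \<in> {1..l}" "mu (Suc (a - k)) \<noteq> 0" using a by (auto simp: mu_def)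
    then show ?thesis by blast
  qed
  note no_c = Con[rule_format, OF this]
  let ?\<psi> = "combined_integrand k g l h lam mu"
  have comb: "?\<psi> t u v q = (\<Sum>a<k+l. \<nu> a *\<^sub>R ?C a t u v q)" for t u v q
    using sum_constraint[of \<nu> "\<lambda>\<psi>. \<psi> t u v q" k g h l]
    by (simp add: combined_integrand_def lam_def mu_def)
  \<comment> \<open>Written as sums of joint differentials, for which integrability is known;
    \<open>DH2\<close> and \<open>DH3\<close> below identify them with the partial differentials of
    the combined integrand.\<close>
  define A B where "A t v = (\<Sum>a<k+l. \<nu> a * D a t (v, 0, 0))" and "B t v = (\<Sum>a<k+l. \<nu> a * D a t (0, v, 0))"
    for t and v :: "real ^ 'n"
  have bl: "bounded_linear (\<lambda>u::real^'n. (u, 0 :: real^'n, 0 :: 'y))"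
    "bounded_linear (\<lambda>u::real^'n. (0 :: real^'n, u, 0 :: 'y))"
    by (auto intro!: bounded_linear_intros)
  have DH2: "DH2 ?\<psi> t (x t) (deriv_on T x t) p v = A t v" if t: "t \<in> {0..T}" for t v
  proof -
    have "has_hadamard_differential (\<lambda>u. \<Sum>a<k+l. \<nu> a *\<^sub>R ?C a t u (deriv_on T x t) p) (x t)
        (\<Sum>a<k+l. \<nu> a *\<^sub>R (D a t o\<^sub>L Blinfun (\<lambda>u. (u, 0, 0))))"
      unfolding D_def using regular_integrand.has_DH2[OF regular t]
      by (intro has_hadamard_differential_sum has_hadamard_differential_scaleR) auto
    then show ?thesis
      unfolding DH2_def comb
      by (simp add: hadamard_differential_eqI A_def blinfun.sum_left blinfun.scaleR_left
          bounded_linear_Blinfun_apply[OF bl(1)])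
  qed
  have DH3: "DH3 ?\<psi> t (x t) (deriv_on T x t) p v = B t v" if t: "t \<in> {0..T}" for t v
  proof -
    have "has_hadamard_differential (\<lambda>u. \<Sum>a<k+l. \<nu> a *\<^sub>R ?C a t (x t) u p) (deriv_on T x t)
        (\<Sum>a<k+l. \<nu> a *\<^sub>R (D a t o\<^sub>L Blinfun (\<lambda>u. (0, u, 0))))"
      unfolding D_def using regular_integrand.has_DH3[OF regular t]
      by (intro has_hadamard_differential_sum has_hadamard_differential_scaleR) auto
    then show ?thesis
      unfolding DH3_def comb
      by (simp add: hadamard_differential_eqI B_def blinfun.sum_left blinfun.scaleR_left
          bounded_linear_Blinfun_apply[OF bl(2)])
  qed
  have sum_int: "set_integrable lborel {0..T} (\<lambda>t. \<Sum>a<k+l. \<nu> a * D a t (y t, z t, 0))"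
    and sum_eq: "(LINT t:{0..T}|lborel. \<Sum>a<k+l. \<nu> a * D a t (y t, z t, 0))
      = (\<Sum>a<k+l. \<nu> a * (LINT t:{0..T}|lborel. D a t (y t, z t, 0)))"
    if "continuous_on {0..T} y" "continuous_on {0..T} z" for y z
  proof -
    have i: "set_integrable lborel {0..T} (\<lambda>t. \<nu> a * D a t (y t, z t, 0))" if "a < k + l" for a
      using regular_integrand.integrable_D[OF regular[OF that] \<open>continuous_on {0..T} y\<close> \<open>continuous_on {0..T} z\<close>]
      unfolding D_def by simp
    then show "set_integrable lborel {0..T} (\<lambda>t. \<Sum>a<k+l. \<nu> a * D a t (y t, z t, 0))"
      unfolding set_integrable_def scaleR_sum_right
      by (intro Bochner_Integration.integrable_sum) (auto simp: set_integrable_def)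
    have "(LINT t:{0..T}|lborel. \<Sum>a<k+l. \<nu> a * D a t (y t, z t, 0))
      = (\<Sum>a<k+l. (LINT t:{0..T}|lborel. \<nu> a * D a t (y t, z t, 0)))"
      unfolding set_lebesgue_integral_def scaleR_sum_right
      by (rule Bochner_Integration.integral_sum) (use i in \<open>auto simp: set_integrable_def\<close>)
    then show "(LINT t:{0..T}|lborel. \<Sum>a<k+l. \<nu> a * D a t (y t, z t, 0))
      = (\<Sum>a<k+l. \<nu> a * (LINT t:{0..T}|lborel. D a t (y t, z t, 0)))" by simp
  qed
  have A_int: "set_integrable lborel {0..T} (\<lambda>t. A t v)" and B_int: "set_integrable lborel {0..T} (\<lambda>t. B t v)" for v
    unfolding A_def B_def using sum_int[of "\<lambda>_. v" "\<lambda>_. 0"] sum_int[of "\<lambda>_. 0" "\<lambda>_. v"] by simp_all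
  have "\<exists>c. AE t in lborel. t \<in> {0..T} \<longrightarrow> B t v = (LINT s:{0..t}|lborel. A s v) + c" for v
  proof (rule du_bois_reymond[OF T A_int[of v] B_int[of v]])
    fix \<eta> :: "real \<Rightarrow> real" assume \<eta>: "\<eta> \<in> C1_space_00 T"
    note \<eta>v = C1_space_00_scale_vector[OF T \<eta>, where v = v]
    note \<eta>C = C1_space_00D[OF \<eta>]
    have "(LINT t:{0..T}|lborel. A t v * \<eta> t + B t v * deriv_on T \<eta> t)
        = (LINT t:{0..T}|lborel. \<Sum>a<k+l. \<nu> a * D a t (\<eta> t *\<^sub>R v, deriv_on T \<eta> t *\<^sub>R v, 0))"
    proof (rule set_lebesgue_integral_cong, simp, intro allI impI)
      fix t
      have "D a t (\<eta> t *\<^sub>R v, deriv_on T \<eta> t *\<^sub>R v, 0) = \<eta> t * D a t (v, 0, 0) + deriv_on T \<eta> t * D a t (0, v, 0)" for a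
        using blinfun.add_right[of "D a t" "\<eta> t *\<^sub>R (v, 0, 0)" "deriv_on T \<eta> t *\<^sub>R (0, v, 0)"]
        by (simp add: blinfun.scaleR_right del: scaleR_Pair) simp
      then show "A t v * \<eta> t + B t v * deriv_on T \<eta> t = (\<Sum>a<k+l. \<nu> a * D a t (\<eta> t *\<^sub>R v, deriv_on T \<eta> t *\<^sub>R v, 0))"
        by (simp add: A_def B_def sum_distrib_left sum.distrib algebra_simps)
    qed
    also have "\<dots> = (\<Sum>a<k+l. \<nu> a * (LINT t:{0..T}|lborel. D a t (\<eta> t *\<^sub>R v, deriv_on T \<eta> t *\<^sub>R v, 0)))"
      by (intro sum_eq continuous_intros C1_space_continuous_on[OF \<eta>C] continuous_on_deriv_on[OF T \<eta>C])
    also have "\<dots> = (\<Sum>a<k+l. \<nu> a * int_differential T (?C a) x p (\<lambda>t. \<eta> t *\<^sub>R v) 0)"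
      unfolding int_differential_def D_def
      by (intro sum.cong refl arg_cong2[of _ _ _ _ "(*)"] set_lebesgue_integral_cong) (auto simp: \<eta>v(2))
    also have "\<dots> = 0" using vanish \<eta>v(1) by blast
    finally show "(LINT t:{0..T}|lborel. A t v * \<eta> t + B t v * deriv_on T \<eta> t) = 0" .
  qed blast
  then have "\<exists>c. \<forall>v. AE t in lborel. t \<in> {0..T} \<longrightarrow> B t v = (LINT s:{0..t}|lborel. A s v) + c v"
    by (intro choice allI)
  then obtain c where c: "\<And>v. AE t in lborel. t \<in> {0..T} \<longrightarrow> B t v = (LINT s:{0..t}|lborel. A s v) + c v"
    by blast
  define G where "G t v = B t v - (LINT s:{0..t}|lborel. A s v)" for t v
  have DP: "D a t (v + w, 0, 0) = D a t (v, 0, 0) + D a t (w, 0, 0)"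
    "D a t (0, v + w, 0) = D a t (0, v, 0) + D a t (0, w, 0)"
    "D a t (s *\<^sub>R v, 0, 0) = s * D a t (v, 0, 0)" "D a t (0, s *\<^sub>R v, 0) = s * D a t (0, v, 0)" for a t v w s
    using blinfun.add_right[of "D a t" "(v, 0, 0)" "(w, 0, 0)"] blinfun.add_right[of "D a t" "(0, v, 0)" "(0, w, 0)"]
      blinfun.scaleR_right[of "D a t" s "(v, 0, 0)"] blinfun.scaleR_right[of "D a t" s "(0, v, 0)"] by simp_all
  have AB: "A t (v + w) = A t v + A t w" "B t (v + w) = B t v + B t w"
    "A t (s *\<^sub>R v) = s * A t v" "B t (s *\<^sub>R v) = s * B t v" for t v w s
    by (simp_all add: A_def B_def DP sum.distrib sum_distrib_left algebra_simps)
  have lin: "linear (G t)" if t: "t \<in> {0..T}" for t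
  proof (rule linearI)
    have "set_integrable lborel {0..t} (\<lambda>s. A s v)" for v
      using t by (intro set_integrable_subset[OF A_int]) auto
    then show "G t (v + w) = G t v + G t w" for v w
      by (simp add: G_def AB set_integral_add(2))
    show "G t (s *\<^sub>R v) = s *\<^sub>R G t v" for s v
      by (simp add: G_def AB algebra_simps)
  qed
  \<comment> \<open>The exceptional null set depends on \<open>v\<close>, and \<open>c\<close> is
    not known to be linear. Hence only basis vectors are used, which gives one null set; linearity
    of \<open>G t\<close> extends the equation to all vectors, with the linear form built from the
    values \<open>c b\<close>.\<close>
  have "AE t in lborel. \<forall>b\<in>Basis. t \<in> {0..T} \<longrightarrow> B t b = (LINT s:{0..t}|lborel. A s b) + c b"
    using c by (intro AE_finite_allI) auto
  then have "AE t in lborel. t \<in> {0..T} \<longrightarrow>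
      (\<forall>v. DH3 ?\<psi> t (x t) (deriv_on T x t) p v = (LINT s:{0..t}|lborel. DH2 ?\<psi> s (x s) (deriv_on T x s) p v)
        + Blinfun (\<lambda>v. \<Sum>b\<in>Basis. (v \<bullet> b) * c b) v)"
  proof eventually_elim
    case (elim t)
    show ?case
    proof (intro impI allI)
      fix v assume t: "t \<in> {0..T}"
      have bc: "bounded_linear (\<lambda>v::real^'n. \<Sum>b\<in>Basis. (v \<bullet> b) * c b)"
        by (intro bounded_linear_intros)
      have "G t v = G t (\<Sum>b\<in>Basis. (v \<bullet> b) *\<^sub>R b)" by (simp add: euclidean_representation)
      also have "\<dots> = (\<Sum>b\<in>Basis. (v \<bullet> b) * G t b)"
        by (simp add: linear_sum[OF lin[OF t]] linear_scale[OF lin[OF t]])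
      also have "\<dots> = (\<Sum>b\<in>Basis. (v \<bullet> b) * c b)"
        using elim t by (intro sum.cong refl) (auto simp: G_def)
      finally have "B t v = (LINT s:{0..t}|lborel. A s v) + (\<Sum>b\<in>Basis. (v \<bullet> b) * c b)"
        by (simp add: G_def algebra_simps)
      moreover have "(LINT s:{0..t}|lborel. DH2 ?\<psi> s (x s) (deriv_on T x s) p v) = (LINT s:{0..t}|lborel. A s v)"
        by (rule set_lebesgue_integral_cong) (use t DH2 in auto)
      ultimately show "DH3 ?\<psi> t (x t) (deriv_on T x t) p v = (LINT s:{0..t}|lborel. DH2 ?\<psi> s (x s) (deriv_on T x s) p v)
        + Blinfun (\<lambda>v. \<Sum>b\<in>Basis. (v \<bullet> b) * c b) v"
        by (simp add: DH3[OF t] bounded_linear_Blinfun_apply[OF bc])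
    qed
  qed
  then show False using no_c by blast
qed

section \<open>Continuous differentiability\<close>

text \<open>
  Linear systems close to the identity, without determinants: the number of unknowns is a variable.
\<close>

lemma l1_bound_near_identity:
  fixes \<nu> :: "nat \<Rightarrow> real" and A :: "nat \<Rightarrow> nat \<Rightarrow> real"
  assumes "(\<Sum>a<N. \<Sum>b<N. \<bar>A a b - (if a = b then 1 else 0)\<bar>) \<le> 1 / 2"
  shows "(\<Sum>a<N. \<bar>\<nu> a\<bar>) \<le> 2 * (\<Sum>b<N. \<bar>\<Sum>a<N. \<nu> a * A a b\<bar>)"
proof -
  define E where "E a b = A a b - (if a = b then 1 else 0)" for a b
  define S where "S = (\<Sum>a<N. \<bar>\<nu> a\<bar>)"
  have "\<bar>\<nu> b\<bar> \<le> \<bar>\<Sum>a<N. \<nu> a * A a b\<bar> + (\<Sum>a<N. S * \<bar>E a b\<bar>)" if "b < N" for b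
  proof -
    have "(\<Sum>a<N. \<nu> a * A a b) = (\<Sum>a<N. \<nu> a * E a b) + (\<Sum>a<N. if a = b then \<nu> a else 0)"
      by (subst sum.distrib[symmetric]) (intro sum.cong refl, simp add: E_def algebra_simps)
    then have "\<nu> b = (\<Sum>a<N. \<nu> a * A a b) - (\<Sum>a<N. \<nu> a * E a b)"
      using that by simp
    moreover have "\<bar>\<Sum>a<N. \<nu> a * E a b\<bar> \<le> (\<Sum>a<N. S * \<bar>E a b\<bar>)"
    proof (rule order_trans[OF sum_abs sum_mono])
      fix a assume "a \<in> {..<N}"
      then have "\<bar>\<nu> a\<bar> \<le> S" unfolding S_def by (intro member_le_sum) auto
      then show "\<bar>\<nu> a * E a b\<bar> \<le> S * \<bar>E a b\<bar>" by (simp add: abs_mult mult_right_mono)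
    qed
    ultimately show ?thesis by linarith
  qed
  then have "S \<le> (\<Sum>b<N. \<bar>\<Sum>a<N. \<nu> a * A a b\<bar> + (\<Sum>a<N. S * \<bar>E a b\<bar>))"
    unfolding S_def[of] by (intro sum_mono) auto
  also have "\<dots> = (\<Sum>b<N. \<bar>\<Sum>a<N. \<nu> a * A a b\<bar>) + S * (\<Sum>a<N. \<Sum>b<N. \<bar>E a b\<bar>)"
  proof -
    have "(\<Sum>b<N. \<Sum>a<N. S * \<bar>E a b\<bar>) = S * (\<Sum>a<N. \<Sum>b<N. \<bar>E a b\<bar>)"
      by (subst sum.swap) (simp add: sum_distrib_left)
    then show ?thesis by (simp add: sum.distrib)
  qed
  \<comment> \<open>At most half of \<open>S\<close> remains on the right and is absorbed by the
    left, whence the factor 2.\<close>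
  also have "S * (\<Sum>a<N. \<Sum>b<N. \<bar>E a b\<bar>) \<le> S * (1 / 2)"
    using assms unfolding E_def S_def by (intro mult_left_mono sum_nonneg) auto
  finally show ?thesis unfolding S_def by linarith
qed

text \<open>In an infinite-dimensional space the norm of a functional need not be attained;
  convergence in the dual norm is therefore tested on vectors that are maximal up to an
  error.\<close>

lemma blinfun_norm_near_maximizer:
  fixes f :: "'a::real_normed_vector \<Rightarrow>\<^sub>L real"
  assumes "\<epsilon> > 0"
  obtains \<omega> where "norm \<omega> \<le> 1" "norm f \<le> \<bar>f \<omega>\<bar> + \<epsilon>"
proof (rule ccontr)
  assume "\<not> thesis"
  with that have *: "\<And>\<omega>. norm \<omega> \<le> 1 \<Longrightarrow> \<bar>f \<omega>\<bar> < norm f - \<epsilon>" by force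
  have pos: "0 < norm f - \<epsilon>" using *[of 0] by simp
  have "norm f \<le> norm f - \<epsilon>"
  proof (rule norm_blinfun_bound)
    fix v
    show "norm (f v) \<le> (norm f - \<epsilon>) * norm v"
    proof (cases "v = 0")
      case False
      then have "\<bar>f ((1 / norm v) *\<^sub>R v)\<bar> < norm f - \<epsilon>" by (intro *) simp
      then show ?thesis using False by (simp add: blinfun.scaleR_right field_simps)
    qed simp
  qed (use pos in simp)
  then show False using assms by simp
qed

text \<open>The mean value theorem on the segment from \<open>q\<close> bounds the remainder by the
  oscillation of \<open>DV\<close>. It needs two-sided derivatives along lines, while the Gateaux
  variations are one-sided.\<close>

lemma continuous_gateaux_imp_has_derivative:
  fixes V :: "'e::real_normed_vector \<Rightarrow> real" and DV :: "'e \<Rightarrow> 'e \<Rightarrow>\<^sub>L real"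
  assumes U: "open U"
    and G: "\<And>q. q \<in> U \<Longrightarrow> has_gateaux_differential V q (DV q)"
    and cont: "continuous_on U DV" and q: "q \<in> U"
  shows "(V has_derivative DV q) (at q)"
  unfolding has_derivative_at_alt
proof (intro conjI allI impI)
  fix \<epsilon> :: real assume \<epsilon>: "\<epsilon> > 0"
  have line: "((\<lambda>\<theta>. V (z + \<theta> *\<^sub>R v)) has_real_derivative DV (z + s *\<^sub>R v) v) (at s)"
    if "z + s *\<^sub>R v \<in> U" for z v s
  proof -
    define w where "w = z + s *\<^sub>R v"
    have r: "((\<lambda>\<theta>. (1 / \<theta>) * (V (w + \<theta> *\<^sub>R u) - V w)) \<longlongrightarrow> DV w u) (at_right 0)" for u
      using G[OF that] unfolding has_gateaux_differential_def has_gateaux_variation_def w_def by simp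
    \<comment> \<open>The left derivative in direction \<open>v\<close> is minus the right
      derivative in direction \<open>- v\<close>; linearity of the differential makes the two sides
      agree.\<close>
    have "((\<lambda>\<theta>. - ((1 / \<theta>) * (V (w + \<theta> *\<^sub>R (- v)) - V w))) \<longlongrightarrow> - DV w (- v)) (at_right 0)"
      by (intro tendsto_minus r)
    then have l: "((\<lambda>\<theta>. (1 / \<theta>) * (V (w + \<theta> *\<^sub>R v) - V w)) \<longlongrightarrow> DV w v) (at_left 0)"
      unfolding at_left_minus[of 0] filterlim_filtermap by (simp add: blinfun.minus_right)
    have "((\<lambda>\<theta>. (1 / \<theta>) * (V (w + \<theta> *\<^sub>R v) - V w)) \<longlongrightarrow> DV w v) (at 0)"
      using l r[of v] by (simp add: filterlim_at_split)
    then show ?thesis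
      unfolding DERIV_def by (simp add: w_def algebra_simps divide_inverse mult.commute)
  qed
  obtain d where d: "d > 0" "ball q d \<subseteq> U" using U q openE by blast
  obtain d' where d': "d' > 0" "\<And>z. z \<in> U \<Longrightarrow> dist z q < d' \<Longrightarrow> dist (DV z) (DV q) < \<epsilon>"
    using cont q \<epsilon> unfolding continuous_on_iff by blast
  show "\<exists>d>0. \<forall>y. norm (y - q) < d \<longrightarrow> norm (V y - V q - DV q (y - q)) \<le> \<epsilon> * norm (y - q)"
  proof (intro exI[of _ "min d d'"] conjI allI impI)
    fix y assume y: "norm (y - q) < min d d'"
    define v where "v = y - q"
    have inU: "q + s *\<^sub>R v \<in> U" and near: "dist (q + s *\<^sub>R v) q < d'" if "0 \<le> s" "s \<le> 1" for s
    proof -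
      have "norm (s *\<^sub>R v) \<le> norm v" using that by (simp add: mult_left_le_one_le)
      then have "norm (s *\<^sub>R v) < min d d'" using y unfolding v_def by (rule le_less_trans)
      then show "q + s *\<^sub>R v \<in> U" "dist (q + s *\<^sub>R v) q < d'"
        using d(2) by (auto simp: dist_norm subset_iff)
    qed
    obtain s where s: "0 < s" "s < 1" "V (q + 1 *\<^sub>R v) - V (q + 0 *\<^sub>R v) = (1 - 0) * DV (q + s *\<^sub>R v) v"
      using MVT2[of 0 1 "\<lambda>\<theta>. V (q + \<theta> *\<^sub>R v)" "\<lambda>s. DV (q + s *\<^sub>R v) v"] line inU by auto
    have "V y - V q - DV q (y - q) = (DV (q + s *\<^sub>R v) - DV q) v"
      using s(3) by (simp add: v_def blinfun.diff_left)
    also have "norm \<dots> \<le> norm (DV (q + s *\<^sub>R v) - DV q) * norm v"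
      by (rule norm_blinfun)
    also have "\<dots> \<le> \<epsilon> * norm v"
      using d'(2)[OF inU near] s by (intro mult_right_mono) (auto simp: dist_norm less_imp_le)
    finally show "norm (V y - V q - DV q (y - q)) \<le> \<epsilon> * norm (y - q)" by (simp add: v_def)
  qed (use d d' in auto)
qed (rule blinfun.bounded_linear_right)

section \<open>The problem of the theorem, and transfer of its hypotheses to neighbouring
  parameters\<close>

locale envelope_problem =
  fixes T \<rho> :: real
    and M :: "(real ^ 'n::finite) set"
    and a0 aT :: "real ^ 'n"
    and L :: "('n, 'y::real_normed_vector) integrand"
    and k l :: nat
    and g h :: "nat \<Rightarrow> ('n, 'y) integrand"
    and \<pi>0 :: 'y
    and P :: "'y set"
    and x :: "'y \<Rightarrow> real \<Rightarrow> real ^ 'n"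
    and \<xi> :: "real \<Rightarrow> real"
  assumes T: "T > 0"
    and solution: "\<And>\<pi>. \<pi> \<in> P \<Longrightarrow> is_solution T M a0 aT L k g l h \<pi> (x \<pi>)"
    and x_cont: "C1_continuous_at T x \<pi>0"
    and \<rho>: "\<rho> > 0" and ball_P: "ball \<pi>0 \<rho> \<subseteq> P"
    and tube_M: "\<And>t. t \<in> {0..T} \<Longrightarrow> ball (x \<pi>0 t) \<rho> \<subseteq> M"
    and xi_nonneg: "\<And>t. t \<in> {0..T} \<Longrightarrow> \<xi> t \<ge> 0" and xi: "set_integrable lborel {0..T} \<xi>"
    and lipschitz: "\<And>\<psi> t u u1 v v1 \<pi> \<pi>1. \<psi> \<in> {L} \<union> g ` {1..k} \<union> h ` {1..l} \<Longrightarrow> t \<in> {0..T} \<Longrightarrow>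
         u \<in> ball (x \<pi>0 t) \<rho> \<Longrightarrow> u1 \<in> ball (x \<pi>0 t) \<rho> \<Longrightarrow>
         v \<in> ball (deriv_on T (x \<pi>0) t) \<rho> \<Longrightarrow> v1 \<in> ball (deriv_on T (x \<pi>0) t) \<rho> \<Longrightarrow>
         \<pi> \<in> ball \<pi>0 \<rho> \<Longrightarrow> \<pi>1 \<in> ball \<pi>0 \<rho> \<Longrightarrow>
           \<bar>\<psi> t u v \<pi> - \<psi> t u1 v1 \<pi>1\<bar> \<le> \<xi> t * (norm (u - u1) + norm (v - v1) + norm (\<pi> - \<pi>1))"
    and cont: "\<And>\<psi>. \<psi> \<in> {L} \<union> g ` {1..k} \<union> h ` {1..l} \<Longrightarrow>
         continuous_on ({0..T} \<times> M \<times> UNIV \<times> P) (\<lambda>(t, u, v, \<pi>). \<psi> t u v \<pi>)"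
    and DH234_exists: "\<And>\<psi> t \<pi>. \<psi> \<in> {L} \<union> g ` {1..k} \<union> h ` {1..l} \<Longrightarrow> t \<in> {0..T} \<Longrightarrow> \<pi> \<in> P \<Longrightarrow>
         \<exists>D. has_DH234 \<psi> t (x \<pi> t) (deriv_on T (x \<pi>) t) \<pi> D"
    and Con: "\<forall>(lam :: nat \<Rightarrow> real) (mu :: nat \<Rightarrow> real).
         (\<exists>i\<in>{1..k}. lam i \<noteq> 0) \<or> (\<exists>j\<in>{1..l}. mu j \<noteq> 0) \<longrightarrow>
         \<not> (\<exists>c :: (real ^ 'n) \<Rightarrow>\<^sub>L real.
              AE t in lborel. t \<in> {0..T} \<longrightarrow>
                (\<forall>e :: real ^ 'n.
                   blinfun_apply (DH3 (combined_integrand k g l h lam mu)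
                                    t (x \<pi>0 t) (deriv_on T (x \<pi>0) t) \<pi>0) e
                   = (LINT s:{0..t}|lborel.
                        blinfun_apply (DH2 (combined_integrand k g l h lam mu)
                                         s (x \<pi>0 s) (deriv_on T (x \<pi>0) s) \<pi>0) e)
                     + blinfun_apply c e))"
begin

abbreviation "C \<equiv> constraint k g h"
abbreviation "integrands \<equiv> {L} \<union> g ` {1..k} \<union> h ` {1..l}"
abbreviation "V \<equiv> value_function T M a0 aT L k g l h"
abbreviation "diff \<psi> q \<equiv> int_differential T \<psi> (x q) q"

text \<open>Half the radius is spent on moving the centre: balls of radius \<open>\<rho> / 2\<close>
  around the solution at \<open>q\<close> lie in the balls of radius \<rho> around the one at
  \<open>\<pi>0\<close>. The Lipschitz bound is thus inherited with the same \<xi>.\<close>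

definition near :: "'y \<Rightarrow> bool" where
  "near q \<longleftrightarrow> q \<in> ball \<pi>0 (\<rho> / 2) \<and> C1_norm T (\<lambda>t. x q t - x \<pi>0 t) < \<rho> / 2"

lemma near_ball: "near q \<Longrightarrow> q \<in> ball \<pi>0 \<rho>"
  using \<rho> by (auto simp: near_def)

lemma near_P: "near q \<Longrightarrow> q \<in> P"
  using near_ball ball_P by blast

lemma near_\<pi>0: "near \<pi>0"
  using \<rho> C1_norm_zero[OF T, where 'a = "real ^ 'n"] by (simp add: near_def)

lemma eventually_near:
  obtains \<delta> where "\<delta> > 0" "\<And>q. q \<in> ball \<pi>0 \<delta> \<Longrightarrow> near q"
proof -
  have "eventually (\<lambda>q. C1_norm T (\<lambda>t. x q t - x \<pi>0 t) < \<rho> / 2) (at \<pi>0)"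
    using x_cont \<rho> unfolding C1_continuous_at_def by (intro order_tendstoD(2)[of _ 0]) auto
  then obtain d where d: "d > 0" "\<And>q. q \<noteq> \<pi>0 \<Longrightarrow> dist q \<pi>0 < d \<Longrightarrow> C1_norm T (\<lambda>t. x q t - x \<pi>0 t) < \<rho> / 2"
    unfolding eventually_at by auto
  show ?thesis
  proof (rule that[of "min d (\<rho> / 2)"])
    fix q assume "q \<in> ball \<pi>0 (min d (\<rho> / 2))"
    then show "near q"
      using d(2)[of q] near_\<pi>0 by (cases "q = \<pi>0") (auto simp: near_def dist_commute)
  qed (use d \<rho> in auto)
qed

lemma x_C1: "q \<in> P \<Longrightarrow> x q \<in> C1_space T"
  using solution[of q] by (simp add: is_solution_def admissible_def C1_into_def)

lemma regular_near:
  assumes q: "near q" and \<psi>: "\<psi> \<in> integrands"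
  shows "regular_integrand T (\<rho> / 2) M P \<psi> (x q) q \<xi>"
proof
  note d = C1_space_diff[OF T x_C1[OF near_P[OF q]] x_C1[OF near_P[OF near_\<pi>0]]]
  have dx: "norm (x q t - x \<pi>0 t) < \<rho> / 2" and dx': "norm (deriv_on T (x q) t - deriv_on T (x \<pi>0) t) < \<rho> / 2"
    if "t \<in> {0..T}" for t
    using norm_le_C1_norm(1)[OF T d(1) that] norm_deriv_on_le_C1_norm[OF T d(1) that] d(2)[OF that] q
    by (auto simp: near_def)
  have b: "u \<in> ball c \<rho>" if "u \<in> ball c' (\<rho> / 2)" "norm (c' - c) < \<rho> / 2" for u c c' :: "'z::real_normed_vector"
    using that norm_triangle_ineq4[of "c - c'" "u - c'"] by (simp add: dist_norm norm_minus_commute)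
  have bx: "ball (x q t) (\<rho> / 2) \<subseteq> ball (x \<pi>0 t) \<rho>" "ball (deriv_on T (x q) t) (\<rho> / 2) \<subseteq> ball (deriv_on T (x \<pi>0) t) \<rho>"
    if "t \<in> {0..T}" for t
    using dx[OF that] dx'[OF that] b by blast+
  have bq: "ball q (\<rho> / 2) \<subseteq> ball \<pi>0 \<rho>"
    using q b[of _ q \<pi>0] by (auto simp: near_def dist_norm norm_minus_commute)
  show "ball (x q t) (\<rho> / 2) \<subseteq> M" if "t \<in> {0..T}" for t
    using bx(1)[OF that] tube_M[OF that] by blast
  show "ball q (\<rho> / 2) \<subseteq> P" using bq ball_P by blast
  show "\<bar>\<psi> t u v p - \<psi> t u1 v1 p1\<bar> \<le> \<xi> t * (norm (u - u1) + norm (v - v1) + norm (p - p1))"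
    if "t \<in> {0..T}" "u \<in> ball (x q t) (\<rho> / 2)" "u1 \<in> ball (x q t) (\<rho> / 2)"
      "v \<in> ball (deriv_on T (x q) t) (\<rho> / 2)" "v1 \<in> ball (deriv_on T (x q) t) (\<rho> / 2)"
      "p \<in> ball q (\<rho> / 2)" "p1 \<in> ball q (\<rho> / 2)" for t u u1 v v1 p p1
    using that bx[OF that(1)] bq by (intro lipschitz[OF \<psi>]) auto
qed (use T \<rho> x_C1 near_P[OF q] cont[OF \<psi>] xi xi_nonneg DH234_exists[OF \<psi>] in auto)

lemma C_mem: "a < k + l \<Longrightarrow> C a \<in> integrands"
  using constraint_mem[of a k l g h] by auto

text \<open>Independence is left as a hypothesis because it has two sources: (Con) at the reference
  parameter, and a perturbation argument at its neighbours.\<close>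

lemma independent_near:
  assumes q: "near q"
    and indep: "\<And>\<nu>. \<forall>v\<in>C1_space_00 T. (\<Sum>a<k+l. \<nu> a * diff (C a) q v 0) = 0 \<Longrightarrow> \<forall>a<k+l. \<nu> a = 0"
  shows "\<exists>e. independent_constraints T (\<rho> / 2) M P a0 aT L k l g h x q \<xi> e"
proof -
  have "\<exists>e. (\<forall>b<k+l. e b \<in> C1_space_00 T) \<and>
      (\<forall>a<k+l. \<forall>b<k+l. diff (C a) q (e b) 0 = (if a = b then 1 else 0))"
  proof (rule dual_basis[OF _ _ _ _ _ indep])
    show "(\<lambda>t. v t + w t) \<in> C1_space_00 T" if "v \<in> C1_space_00 T" "w \<in> C1_space_00 T"
      for v w :: "real \<Rightarrow> real ^ 'n"
      using that C1_space_add(1)[OF T, of v w] by (simp add: C1_space_00_def)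
    show "(\<lambda>t. c *\<^sub>R v t) \<in> C1_space_00 T" if "v \<in> C1_space_00 T" for c and v :: "real \<Rightarrow> real ^ 'n"
      using that C1_space_scaleR(1)[OF T, of v c] by (simp add: C1_space_00_def)
    show "(\<lambda>t. 0) \<in> C1_space_00 T" by (simp add: C1_space_00_def C1_space_const)
    fix a assume "a < k + l"
    then interpret ca: regular_integrand T "\<rho> / 2" M P "C a" "x q" q \<xi>
      by (intro regular_near q C_mem)
    show "diff (C a) q (\<lambda>t. v t + w t) 0 = diff (C a) q v 0 + diff (C a) q w 0"
      if "v \<in> C1_space_00 T" "w \<in> C1_space_00 T" for v w
      using ca.differential_add[of v w 0 0] that by (simp add: C1_space_00D)
    show "diff (C a) q (\<lambda>t. c *\<^sub>R v t) 0 = c * diff (C a) q v 0" if "v \<in> C1_space_00 T" for c v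
      using ca.differential_scaleR[of v c 0] that by (simp add: C1_space_00D)
  qed
  then obtain e where e: "\<And>b. b < k + l \<Longrightarrow> e b \<in> C1_space_00 T"
    "\<And>a b. a < k + l \<Longrightarrow> b < k + l \<Longrightarrow> diff (C a) q (e b) 0 = (if a = b then 1 else 0)" by blast
  have "independent_constraints T (\<rho> / 2) M P a0 aT L k l g h x q \<xi> e"
    by (rule independent_constraints.intro) (use regular_near[OF q] solution e in auto)
  then show ?thesis by blast
qed

lemma independent_\<pi>0: "\<exists>e. independent_constraints T (\<rho> / 2) M P a0 aT L k l g h x \<pi>0 \<xi> e"
  by (rule independent_near[OF near_\<pi>0])
    (rule constraints_independent[OF regular_near[OF near_\<pi>0 C_mem] T Con])

lemma envelope_directional:
  assumes "has_gateaux_variation_into_C1 T x \<pi>0 \<omega> d"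
  shows "\<forall>\<psi>\<in>integrands. set_integrable lborel {0..T} (DH4_along T \<psi> (x \<pi>0) \<pi>0 \<omega>)"
    and "\<exists>lam mu. the_KKT_multipliers T L k g l h \<pi>0 (x \<pi>0) lam mu \<and>
          has_gateaux_variation V \<pi>0 \<omega> (envelope_rhs T L k g l h \<pi>0 (x \<pi>0) lam mu \<omega>)"
proof -
  obtain e where "independent_constraints T (\<rho> / 2) M P a0 aT L k l g h x \<pi>0 \<xi> e"
    using independent_\<pi>0 by blast
  then interpret ic: independent_constraints T "\<rho> / 2" M P a0 aT L k l g h x \<pi>0 \<xi> e .
  show "\<forall>\<psi>\<in>integrands. set_integrable lborel {0..T} (DH4_along T \<psi> (x \<pi>0) \<pi>0 \<omega>)"
    using regular_integrand.integrable_DH4_along[OF ic.regular] by blast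
  show "\<exists>lam mu. the_KKT_multipliers T L k g l h \<pi>0 (x \<pi>0) lam mu \<and>
          has_gateaux_variation V \<pi>0 \<omega> (envelope_rhs T L k g l h \<pi>0 (x \<pi>0) lam mu \<omega>)"
    using ic.the_KKT ic.envelope_variation[OF assms] ic.envelope_rhs_eq by metis
qed

lemma envelope_gateaux:
  assumes "\<forall>\<omega>. \<exists>d. has_gateaux_variation_into_C1 T x \<pi>0 \<omega> d"
  shows "\<exists>lam mu DV. the_KKT_multipliers T L k g l h \<pi>0 (x \<pi>0) lam mu \<and>
          has_gateaux_differential V \<pi>0 DV \<and>
          (\<forall>\<omega>. blinfun_apply DV \<omega> = envelope_rhs T L k g l h \<pi>0 (x \<pi>0) lam mu \<omega>)"
proof -
  obtain e where "independent_constraints T (\<rho> / 2) M P a0 aT L k l g h x \<pi>0 \<xi> e"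
    using independent_\<pi>0 by blast
  then interpret ic: independent_constraints T "\<rho> / 2" M P a0 aT L k l g h x \<pi>0 \<xi> e .
  show ?thesis
    using ic.the_KKT ic.envelope_gateaux assms ic.envelope_rhs_eq
      bounded_linear_Blinfun_apply[OF ic.bounded_linear_envelope] by metis
qed

end

section \<open>Continuous dependence of differentials and multipliers on the parameter\<close>

locale C1_envelope_problem = envelope_problem +
  assumes x_variation: "\<And>\<pi> \<omega>. \<pi> \<in> P \<Longrightarrow> \<exists>d. has_gateaux_variation_into_C1 T x \<pi> \<omega> d"
    and DH234_cont: "\<And>\<psi> t. \<psi> \<in> {L} \<union> g ` {1..k} \<union> h ` {1..l} \<Longrightarrow> t \<in> {0..T} \<Longrightarrow>
         continuous_on (ball \<pi>0 \<rho>) (\<lambda>\<pi>. DH234 \<psi> t (x \<pi> t) (deriv_on T (x \<pi>) t) \<pi>)"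
begin

text \<open>Uniformity over the unit ball of parameter directions, expressed by letting the
  direction vary with \<open>n\<close>; it is what continuity of the derivative in the dual norm
  requires. At each time the pointwise differentials converge in operator norm, and
  \<open>D_bound\<close> provides a common majorant.\<close>

lemma diff_uniformly_convergent:
  assumes q: "\<And>n. near (q n)" and p: "near p" and lim: "q \<longlonglongrightarrow> p"
    and v: "v \<in> C1_space T" and \<omega>: "\<And>n. norm (\<omega> n) \<le> 1" and \<psi>: "\<psi> \<in> integrands"
  shows "(\<lambda>n. diff \<psi> (q n) v (\<omega> n) - diff \<psi> p v (\<omega> n)) \<longlonglongrightarrow> 0"
proof -
  define D where "D n t = DH234 \<psi> t (x (q n) t) (deriv_on T (x (q n)) t) (q n)" for n t
  define E where "E t = DH234 \<psi> t (x p t) (deriv_on T (x p) t) p" for t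
  define K where "K = 2 * C1_norm T v + 1"
  define z where "z n t = (v t, deriv_on T v t, \<omega> n)" for n t
  have Dz: "set_integrable lborel {0..T} (\<lambda>t. D n t (z n t))"
    "\<bar>D n t (z n t)\<bar> \<le> \<xi> t * K" if "t \<in> {0..T}" for n t
  proof -
    interpret r: regular_integrand T "\<rho> / 2" M P \<psi> "x (q n)" "q n" \<xi> by (rule regular_near[OF q \<psi>])
    show "set_integrable lborel {0..T} (\<lambda>t. D n t (z n t))"
      unfolding D_def z_def by (rule r.integrable_differential[OF v])
    show "\<bar>D n t (z n t)\<bar> \<le> \<xi> t * K"
      unfolding D_def z_def K_def
      using norm_le_C1_norm(1)[OF T v that] norm_deriv_on_le_C1_norm[OF T v that] \<omega>[of n]
      by (intro order_trans[OF r.D_bound[OF that]] mult_left_mono xi_nonneg that) simp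
  qed
  have Ez: "set_integrable lborel {0..T} (\<lambda>t. E t (z n t))"
    "\<bar>E t (z n t)\<bar> \<le> \<xi> t * K" if "t \<in> {0..T}" for n t
  proof -
    interpret r: regular_integrand T "\<rho> / 2" M P \<psi> "x p" p \<xi> by (rule regular_near[OF p \<psi>])
    show "set_integrable lborel {0..T} (\<lambda>t. E t (z n t))"
      unfolding E_def z_def by (rule r.integrable_differential[OF v])
    show "\<bar>E t (z n t)\<bar> \<le> \<xi> t * K"
      unfolding E_def z_def K_def
      using norm_le_C1_norm(1)[OF T v that] norm_deriv_on_le_C1_norm[OF T v that] \<omega>[of n]
      by (intro order_trans[OF r.D_bound[OF that]] mult_left_mono xi_nonneg that) simp
  qed
  have z_le: "norm (z n t) \<le> K" if "t \<in> {0..T}" for n t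
    using norm_le_C1_norm(1)[OF T v that] norm_deriv_on_le_C1_norm[OF T v that] \<omega>[of n]
      norm_Pair_le[of "v t" "(deriv_on T v t, \<omega> n)"] norm_Pair_le[of "deriv_on T v t" "\<omega> n"]
    unfolding z_def K_def by linarith
  \<comment> \<open>The integrability claims in \<open>Dz\<close> and \<open>Ez\<close> carry the
    premise on \<open>t\<close> shared with the pointwise bounds; any point of the interval
    discharges it.\<close>
  have "0 \<in> {0..T}" using T by simp
  note int = Dz(1)[OF this] Ez(1)[OF this]
  have "(\<lambda>n. LINT t|lborel. indicator {0..T} t *\<^sub>R (D n t (z n t) - E t (z n t))) \<longlonglongrightarrow> integral\<^sup>L (lborel :: real measure) (\<lambda>_. 0)"
  proof (rule integral_dominated_convergence[of "\<lambda>_. 0" lborel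
        "\<lambda>n t. indicator {0..T} t *\<^sub>R (D n t (z n t) - E t (z n t))"
        "\<lambda>t. indicator {0..T} t *\<^sub>R (\<xi> t * (2 * K))"])
    show "integrable lborel (\<lambda>t. indicator {0..T} t *\<^sub>R (\<xi> t * (2 * K)))"
      using set_integrable_mult_left[of "2 * K"] xi unfolding set_integrable_def by blast
    show "(\<lambda>t. indicator {0..T} t *\<^sub>R (D n t (z n t) - E t (z n t))) \<in> borel_measurable lborel" for n
      using set_integral_diff(1)[OF int(1)[of n] int(2)[of n]] unfolding set_integrable_def
      by (rule borel_measurable_integrable)
    show "AE t in lborel. norm (indicator {0..T} t *\<^sub>R (D n t (z n t) - E t (z n t)))
        \<le> indicator {0..T} t *\<^sub>R (\<xi> t * (2 * K))" for n
    proof (rule AE_I2)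
      fix t
      show "norm (indicator {0..T} t *\<^sub>R (D n t (z n t) - E t (z n t))) \<le> indicator {0..T} t *\<^sub>R (\<xi> t * (2 * K))"
        using Dz(2)[of t n] Ez(2)[of t n] by (cases "t \<in> {0..T}") auto
    qed
    show "AE t in lborel. (\<lambda>n. indicator {0..T} t *\<^sub>R (D n t (z n t) - E t (z n t))) \<longlonglongrightarrow> 0"
    proof (rule AE_I2)
      fix t
      show "(\<lambda>n. indicator {0..T} t *\<^sub>R (D n t (z n t) - E t (z n t))) \<longlonglongrightarrow> 0"
      proof (cases "t \<in> {0..T}")
        case t: True
        have "(\<lambda>n. D n t) \<longlonglongrightarrow> E t"
            unfolding D_def E_def
          by (rule continuous_on_tendsto_compose[OF DH234_cont[OF \<psi> t] lim near_ball[OF p]])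
            (use near_ball[OF q] in \<open>auto intro!: always_eventually\<close>)
        then have "(\<lambda>n. norm (D n t - E t) * K) \<longlonglongrightarrow> 0 * K"
          by (intro tendsto_mult tendsto_const tendsto_norm_zero LIM_zero)
        then have "(\<lambda>n. norm (D n t - E t) * K) \<longlonglongrightarrow> 0" by simp
        then have "(\<lambda>n. D n t (z n t) - E t (z n t)) \<longlonglongrightarrow> 0"
        proof (rule Lim_null_comparison[rotated], intro always_eventually allI)
          fix n
          have "norm ((D n t - E t) (z n t)) \<le> norm (D n t - E t) * norm (z n t)"
            by (rule norm_blinfun)
          also have "\<dots> \<le> norm (D n t - E t) * K" using z_le[OF t] by (intro mult_left_mono) auto
          finally show "norm (D n t (z n t) - E t (z n t)) \<le> norm (D n t - E t) * K"
            by (simp add: blinfun.diff_left)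
        qed
        then show ?thesis using t by simp
      qed simp
    qed
  qed auto
  moreover have "diff \<psi> (q n) v (\<omega> n) - diff \<psi> p v (\<omega> n)
      = (LINT t|lborel. indicator {0..T} t *\<^sub>R (D n t (z n t) - E t (z n t)))" for n
    using set_integral_diff(2)[OF int(1)[of n] int(2)[of n]]
    unfolding int_differential_def D_def E_def z_def set_lebesgue_integral_def by simp
  ultimately show ?thesis by simp
qed

lemma diff_tendsto:
  assumes "\<And>n. near (q n)" "near p" "q \<longlonglongrightarrow> p" "v \<in> C1_space T" "\<psi> \<in> integrands"
  shows "(\<lambda>n. diff \<psi> (q n) v 0) \<longlonglongrightarrow> diff \<psi> p v 0"
  by (rule LIM_zero_cancel[OF diff_uniformly_convergent[OF assms(1-4) _ assms(5)]]) simp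

text \<open>Independence survives near the reference parameter because the old dual functions are
  still almost dual there. This makes the envelope formula available on a whole neighbourhood, and
  continuity of its right-hand side turns Gateaux into Frechet differentiability.\<close>

theorem envelope_C1:
  shows "\<exists>U DV lam mu. open U \<and> \<pi>0 \<in> U \<and> U \<subseteq> P \<and>
          (\<forall>\<pi>\<in>U. (V has_derivative blinfun_apply (DV \<pi>)) (at \<pi>)) \<and>
          continuous_on U DV \<and>
          (\<forall>\<pi>\<in>U. the_KKT_multipliers T L k g l h \<pi> (x \<pi>) (lam \<pi>) (mu \<pi>) \<and>
             (\<forall>\<psi>\<in>integrands. \<forall>\<omega>. set_integrable lborel {0..T} (DH4_along T \<psi> (x \<pi>) \<pi> \<omega>)) \<and>
             (\<forall>\<omega>. blinfun_apply (DV \<pi>) \<omega>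
                  = envelope_rhs T L k g l h \<pi> (x \<pi>) (lam \<pi>) (mu \<pi>) \<omega>))"
proof -
  define N where "N = k + l"
  obtain e0 where "independent_constraints T (\<rho> / 2) M P a0 aT L k l g h x \<pi>0 \<xi> e0"
    using independent_\<pi>0 by blast
  then interpret ic0: independent_constraints T "\<rho> / 2" M P a0 aT L k l g h x \<pi>0 \<xi> e0 .
  obtain \<delta> where \<delta>: "\<delta> > 0" "\<And>q. q \<in> ball \<pi>0 \<delta> \<Longrightarrow> near q" using eventually_near by blast
  \<comment> \<open>The distance of the matrix of constraint differentials on the old basis from the
    identity. It is 0 at \<open>\<pi>0\<close>; the threshold \<open>1 / 2\<close> used for
    \<open>U\<close> is that of \<open>l1_bound_near_identity\<close>.\<close>
  define defect where "defect q = (\<Sum>a<N. \<Sum>b<N. \<bar>diff (C a) q (e0 b) 0 - (if a = b then 1 else 0)\<bar>)" for q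
  have "continuous_on (ball \<pi>0 \<delta>) (\<lambda>q. diff (C a) q (e0 b) 0)" if "a < N" "b < N" for a b
    unfolding continuous_on_sequentially o_def
  proof (intro allI ballI impI)
    fix q p assume p: "p \<in> ball \<pi>0 \<delta>" and q: "(\<forall>n. q n \<in> ball \<pi>0 \<delta>) \<and> q \<longlonglongrightarrow> p"
    have "e0 b \<in> C1_space T" "C a \<in> integrands"
      using that by (simp_all only: N_def ic0.eC1 C_mem)
    with p q \<delta>(2) show "(\<lambda>n. diff (C a) (q n) (e0 b) 0) \<longlonglongrightarrow> diff (C a) p (e0 b) 0"
      by (intro diff_tendsto) blast+
  qed
  then have cd: "continuous_on (ball \<pi>0 \<delta>) defect"
    unfolding defect_def by (intro continuous_intros) auto
  define U where "U = ball \<pi>0 \<delta> \<inter> defect -` {..<1/2}"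
  have "open U" unfolding U_def by (intro continuous_open_preimage cd) auto
  have "defect \<pi>0 = 0" unfolding defect_def N_def using ic0.dual by (intro sum.neutral ballI) auto
  then have "\<pi>0 \<in> U" using \<delta> by (simp add: U_def)
  have nearU: "near q" if "q \<in> U" for q using that \<delta>(2) by (simp add: U_def)
  have "\<exists>e. independent_constraints T (\<rho> / 2) M P a0 aT L k l g h x q \<xi> e" if q: "q \<in> U" for q
  proof (rule independent_near[OF nearU[OF q]])
    fix \<nu> assume 0: "\<forall>v\<in>C1_space_00 T. (\<Sum>a<k+l. \<nu> a * diff (C a) q v 0) = 0"
    have "(\<Sum>a<N. \<bar>\<nu> a\<bar>) \<le> 2 * (\<Sum>b<N. \<bar>\<Sum>a<N. \<nu> a * diff (C a) q (e0 b) 0\<bar>)"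
      using q by (intro l1_bound_near_identity) (auto simp: U_def defect_def)
    also have "\<dots> = 0" using 0 ic0.e by (simp add: N_def)
    finally have "(\<Sum>a<N. \<bar>\<nu> a\<bar>) = 0" by (intro antisym sum_nonneg) auto
    then show "\<forall>a<k+l. \<nu> a = 0" by (simp add: sum_nonneg_eq_0_iff N_def)
  qed
  then obtain E where ic: "\<And>q. q \<in> U \<Longrightarrow> independent_constraints T (\<rho> / 2) M P a0 aT L k l g h x q \<xi> (E q)"
    by metis
  \<comment> \<open>Copies of the multipliers and of the envelope as functions of the parameter:
    continuity compares different points, whereas each instance of the locale is tied to
    one.\<close>
  define \<nu> where "\<nu> q a = - diff L q (E q a) 0" for q a
  define env where "env q \<omega> = diff L q (\<lambda>t. 0) \<omega> + (\<Sum>a<N. \<nu> q a * diff (C a) q (\<lambda>t. 0) \<omega>)" for q \<omega>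
  have mult_eq: "independent_constraints.mult T L x q (E q) = \<nu> q" if "q \<in> U" for q
    using independent_constraints.mult_def[OF ic[OF that]] by (auto simp: \<nu>_def)
  have env_eq: "independent_constraints.envelope T L k l g h x q (E q) = env q" if "q \<in> U" for q
    using independent_constraints.envelope_def[OF ic[OF that]] mult_eq[OF that] by (auto simp: env_def N_def)
  define DV where "DV q = Blinfun (env q)" for q
  have DV: "blinfun_apply (DV q) = env q" if "q \<in> U" for q
    unfolding DV_def
    using bounded_linear_Blinfun_apply independent_constraints.bounded_linear_envelope[OF ic[OF that]] env_eq[OF that]
    by metis
  have gat: "has_gateaux_differential V q (DV q)" if "q \<in> U" for q
    using independent_constraints.envelope_gateaux[OF ic[OF that]] x_variation[OF near_P[OF nearU[OF that]]]
    unfolding DV_def env_eq[OF that] by blast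
  \<comment> \<open>The basis \<open>E q\<close> is an arbitrary choice for each \<open>q\<close>,
    so continuity cannot be read off the formula for \<nu>. The stationarity equations at
    \<open>q n\<close> are tested on the fixed basis \<open>E p\<close> instead, which gives a
    linear system for the multipliers whose matrix tends to the identity.\<close>
  have \<nu>_lim: "(\<lambda>n. \<nu> (q n) a) \<longlonglongrightarrow> \<nu> p a"
    if q: "\<And>n. q n \<in> U" and p: "p \<in> U" and lim: "q \<longlonglongrightarrow> p" and a: "a < N" for q p a
  proof -
    interpret ip: independent_constraints T "\<rho> / 2" M P a0 aT L k l g h x p \<xi> "E p" by (rule ic[OF p])
    define A where "A n a b = diff (C a) (q n) (E p b) 0" for n a b
    have A_lim: "(\<lambda>n. A n a b) \<longlonglongrightarrow> (if a = b then 1 else 0)" if "a < N" "b < N" for a b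
      using diff_tendsto[OF nearU[OF q] nearU[OF p] lim ip.eC1[of b] C_mem[of a]] ip.dual[of a b] that
      by (simp add: A_def N_def)
    define \<epsilon> where "\<epsilon> n = (\<Sum>a<N. \<Sum>b<N. \<bar>A n a b - (if a = b then 1 else 0)\<bar>)" for n
    have "\<epsilon> \<longlonglongrightarrow> (\<Sum>a<N. \<Sum>b<N. \<bar>(if a = b then 1 else 0) - (if a = b then 1 else 0)\<bar>)"
      unfolding \<epsilon>_def by (intro tendsto_sum tendsto_rabs tendsto_diff tendsto_const A_lim) auto
    then have "\<epsilon> \<longlonglongrightarrow> 0" by simp
    then have ev: "eventually (\<lambda>n. \<epsilon> n < 1 / 2) sequentially" by (rule order_tendstoD(2)) simp
    \<comment> \<open>The residual left when the limit multipliers \<open>\<nu> p\<close> are put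
      into the system at \<open>q n\<close>; by \<open>l1_bound_near_identity\<close> it controls
      the error of the multipliers.\<close>
    define y where "y n b = - diff L (q n) (E p b) 0 - (\<Sum>a<N. \<nu> p a * A n a b)" for n b
    have y_eq: "(\<Sum>a<N. (\<nu> (q n) a - \<nu> p a) * A n a b) = y n b" if b: "b < N" for n b
    proof -
      have "diff L (q n) (E p b) 0 + (\<Sum>a<N. \<nu> (q n) a * A n a b) = 0"
        using independent_constraints.stationary[OF ic[OF q] ip.e[of b], of n] b
        by (simp add: mult_eq[OF q] A_def N_def)
      then show ?thesis by (simp add: y_def left_diff_distrib sum_subtractf)
    qed
    have y_lim: "(\<lambda>n. \<bar>y n b\<bar>) \<longlonglongrightarrow> 0" if b: "b < N" for b
    proof -
      have "(\<lambda>n. y n b) \<longlonglongrightarrow> - diff L p (E p b) 0 - (\<Sum>a<N. \<nu> p a * (if a = b then 1 else 0))"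
        unfolding y_def using b ip.eC1
        by (intro tendsto_intros A_lim diff_tendsto nearU q p lim) (auto simp: N_def)
      moreover have "- diff L p (E p b) 0 - (\<Sum>a<N. \<nu> p a * (if a = b then 1 else 0)) = 0"
        using b by (simp add: \<nu>_def if_distrib cong: if_cong)
      ultimately show ?thesis by (simp add: tendsto_rabs_zero)
    qed
    have "(\<lambda>n. 2 * (\<Sum>b<N. \<bar>y n b\<bar>)) \<longlonglongrightarrow> 2 * (\<Sum>b<N. 0)"
      by (intro tendsto_intros y_lim) auto
    then have "(\<lambda>n. 2 * (\<Sum>b<N. \<bar>y n b\<bar>)) \<longlonglongrightarrow> 0" by simp
    then have "(\<lambda>n. \<nu> (q n) a - \<nu> p a) \<longlonglongrightarrow> 0"
    proof (rule Lim_null_comparison[rotated])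
      show "eventually (\<lambda>n. norm (\<nu> (q n) a - \<nu> p a) \<le> 2 * (\<Sum>b<N. \<bar>y n b\<bar>)) sequentially"
        using ev
      proof eventually_elim
        case (elim n)
        have "\<bar>\<nu> (q n) a - \<nu> p a\<bar> \<le> (\<Sum>a<N. \<bar>\<nu> (q n) a - \<nu> p a\<bar>)"
          using a by (intro member_le_sum) auto
        also have "\<dots> \<le> 2 * (\<Sum>b<N. \<bar>\<Sum>a<N. (\<nu> (q n) a - \<nu> p a) * A n a b\<bar>)"
          using elim by (intro l1_bound_near_identity) (simp add: \<epsilon>_def)
        also have "\<dots> = 2 * (\<Sum>b<N. \<bar>y n b\<bar>)" by (simp add: y_eq)
        finally show ?case by simp
      qed
    qed
    then show ?thesis by (rule LIM_zero_cancel)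
  qed
  have cDV: "continuous_on U DV"
    unfolding continuous_on_sequentially
  proof (intro allI ballI impI)
    fix q p assume p: "p \<in> U" and "(\<forall>n. q n \<in> U) \<and> q \<longlonglongrightarrow> p"
    then have q: "\<And>n. q n \<in> U" and lim: "q \<longlonglongrightarrow> p" by auto
    \<comment> \<open>Almost maximizing directions reduce convergence in the dual norm to
      convergence of a scalar sequence.\<close>
    have "\<exists>\<omega>. norm \<omega> \<le> 1 \<and> norm (DV (q n) - DV p) \<le> \<bar>(DV (q n) - DV p) \<omega>\<bar> + 1 / real (Suc n)" for n
      using blinfun_norm_near_maximizer[of "1 / real (Suc n)" "DV (q n) - DV p"] by auto
    then obtain \<omega> where \<omega>: "\<And>n. norm (\<omega> n) \<le> 1"
      "\<And>n. norm (DV (q n) - DV p) \<le> \<bar>(DV (q n) - DV p) (\<omega> n)\<bar> + 1 / real (Suc n)" by metis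
    have d0: "(\<lambda>n. diff \<psi> (q n) (\<lambda>t. 0) (\<omega> n) - diff \<psi> p (\<lambda>t. 0) (\<omega> n)) \<longlonglongrightarrow> 0" if "\<psi> \<in> integrands" for \<psi>
      using diff_uniformly_convergent[OF nearU[OF q] nearU[OF p] lim C1_space_const \<omega>(1) that] .
    have bnd: "\<bar>diff (C a) r (\<lambda>t. 0) (\<omega> n)\<bar> \<le> (LINT t:{0..T}|lborel. \<xi> t)" if "a < N" "r \<in> U" for a r n
    proof -
      interpret ca: regular_integrand T "\<rho> / 2" M P "C a" "x r" r \<xi>
        using that by (intro regular_near nearU C_mem) (simp_all add: N_def)
      have "0 \<le> (LINT t:{0..T}|lborel. \<xi> t)"
        unfolding set_lebesgue_integral_def using xi_nonneg
        by (intro integral_nonneg_AE AE_I2) (auto simp: indicator_def)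
      then have "(LINT t:{0..T}|lborel. \<xi> t) * norm (\<omega> n) \<le> (LINT t:{0..T}|lborel. \<xi> t) * 1"
        using \<omega>(1)[of n] by (intro mult_left_mono)
      then show ?thesis
        using ca.differential_bound[OF C1_space_const[of 0], of "\<omega> n"] by (simp add: C1_norm_zero[OF T])
    qed
    \<comment> \<open>The difference of products is split in two: the multiplier difference tends to
      0 against the factor bounded by \<open>bnd\<close>, and the other factor converges by
      \<open>d0\<close> with the multiplier fixed at \<open>p\<close>.\<close>
    have term_lim: "(\<lambda>n. \<nu> (q n) a * diff (C a) (q n) (\<lambda>t. 0) (\<omega> n) - \<nu> p a * diff (C a) p (\<lambda>t. 0) (\<omega> n)) \<longlonglongrightarrow> 0"
      if a: "a < N" for a
    proof -
      have "(\<lambda>n. \<bar>\<nu> (q n) a - \<nu> p a\<bar> * (LINT t:{0..T}|lborel. \<xi> t)) \<longlonglongrightarrow> 0"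
        using \<nu>_lim[OF q p lim a] by (intro tendsto_mult_left_zero tendsto_rabs_zero LIM_zero)
      then have "(\<lambda>n. (\<nu> (q n) a - \<nu> p a) * diff (C a) (q n) (\<lambda>t. 0) (\<omega> n)) \<longlonglongrightarrow> 0"
        by (rule Lim_null_comparison[rotated])
          (use bnd[OF a q] in \<open>auto simp: abs_mult intro!: always_eventually mult_left_mono\<close>)
      moreover have "(\<lambda>n. \<nu> p a * (diff (C a) (q n) (\<lambda>t. 0) (\<omega> n) - diff (C a) p (\<lambda>t. 0) (\<omega> n))) \<longlonglongrightarrow> 0"
        using d0[OF C_mem[of a]] a by (intro tendsto_mult_right_zero) (simp add: N_def)
      ultimately have "(\<lambda>n. (\<nu> (q n) a - \<nu> p a) * diff (C a) (q n) (\<lambda>t. 0) (\<omega> n)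
          + \<nu> p a * (diff (C a) (q n) (\<lambda>t. 0) (\<omega> n) - diff (C a) p (\<lambda>t. 0) (\<omega> n))) \<longlonglongrightarrow> 0 + 0"
        by (rule tendsto_add)
      then show ?thesis by (simp add: algebra_simps)
    qed
    have "(\<lambda>n. (diff L (q n) (\<lambda>t. 0) (\<omega> n) - diff L p (\<lambda>t. 0) (\<omega> n)) +
        (\<Sum>a<N. \<nu> (q n) a * diff (C a) (q n) (\<lambda>t. 0) (\<omega> n) - \<nu> p a * diff (C a) p (\<lambda>t. 0) (\<omega> n)))
        \<longlonglongrightarrow> 0 + (\<Sum>a<N. 0)"
      by (intro tendsto_add tendsto_sum d0 term_lim) auto
    moreover have "(DV (q n) - DV p) (\<omega> n) = (diff L (q n) (\<lambda>t. 0) (\<omega> n) - diff L p (\<lambda>t. 0) (\<omega> n)) +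
        (\<Sum>a<N. \<nu> (q n) a * diff (C a) (q n) (\<lambda>t. 0) (\<omega> n) - \<nu> p a * diff (C a) p (\<lambda>t. 0) (\<omega> n))" for n
      by (simp add: blinfun.diff_left DV[OF q] DV[OF p] env_def sum_subtractf)
    ultimately have "(\<lambda>n. (DV (q n) - DV p) (\<omega> n)) \<longlonglongrightarrow> 0" by simp
    then have "(\<lambda>n. \<bar>(DV (q n) - DV p) (\<omega> n)\<bar> + 1 / real (Suc n)) \<longlonglongrightarrow> 0 + 0"
      by (intro tendsto_add tendsto_rabs_zero LIMSEQ_Suc[OF lim_1_over_n])
    then have "(\<lambda>n. \<bar>(DV (q n) - DV p) (\<omega> n)\<bar> + 1 / real (Suc n)) \<longlonglongrightarrow> 0" by simp
    then have "(\<lambda>n. DV (q n) - DV p) \<longlonglongrightarrow> 0"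
      by (rule Lim_null_comparison[rotated]) (use \<omega>(2) in \<open>auto intro!: always_eventually\<close>)
    then show "(DV \<circ> q) \<longlonglongrightarrow> DV p" unfolding o_def by (rule LIM_zero_cancel)
  qed
  show ?thesis
  proof (rule exI[of _ U], rule exI[of _ DV], rule exI[of _ "\<lambda>q i. \<nu> q (i - 1)"],
      rule exI[of _ "\<lambda>q j. \<nu> q (k + j - 1)"], intro conjI ballI allI)
    show "U \<subseteq> P" using nearU near_P by blast
    fix q assume q: "q \<in> U"
    show "(V has_derivative DV q) (at q)"
      by (rule continuous_gateaux_imp_has_derivative[OF \<open>open U\<close> gat cDV q])
    show "the_KKT_multipliers T L k g l h q (x q) (\<lambda>i. \<nu> q (i - 1)) (\<lambda>j. \<nu> q (k + j - 1))"
      using independent_constraints.the_KKT[OF ic[OF q]] by (simp add: mult_eq[OF q])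
    fix \<psi> \<omega> assume "\<psi> \<in> integrands"
    then show "set_integrable lborel {0..T} (DH4_along T \<psi> (x q) q \<omega>)"
      by (rule regular_integrand.integrable_DH4_along[OF regular_near[OF nearU[OF q]]])
  next
    fix q \<omega> assume q: "q \<in> U"
    show "DV q \<omega> = envelope_rhs T L k g l h q (x q) (\<lambda>i. \<nu> q (i - 1)) (\<lambda>j. \<nu> q (k + j - 1)) \<omega>"
      using independent_constraints.envelope_rhs_eq[OF ic[OF q]] by (simp add: mult_eq[OF q] env_eq[OF q] DV[OF q])
  qed (fact \<open>open U\<close> \<open>\<pi>0 \<in> U\<close> cDV)+
qed

end

theorem theorem5p1:
  fixes T \<rho> :: real
    and M :: "(real ^ 'n::finite) set"
    and a0 aT :: "real ^ 'n"
    and L :: "('n, 'y::real_normed_vector) integrand"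
    and k l :: nat
    and g h :: "nat \<Rightarrow> ('n, 'y) integrand"
    and \<I> :: "('n, 'y) integrand set"
    and V :: "'y \<Rightarrow> real"
    and \<pi>0 :: 'y
    and P :: "'y set"
    and x :: "'y \<Rightarrow> real \<Rightarrow> real ^ 'n"
    and \<xi> :: "real \<Rightarrow> real"
  assumes T: "T > 0" and M: "open M" and ends: "a0 \<in> M" "aT \<in> M"
    and \<I>: "\<I> = {L} \<union> g ` {1..k} \<union> h ` {1..l}"
    and V: "V = value_function T M a0 aT L k g l h"
    and Sol1: "open P" "\<pi>0 \<in> P"
      "\<forall>\<pi>\<in>P. is_solution T M a0 aT L k g l h \<pi> (x \<pi>)"
      "C1_continuous_at T x \<pi>0"
    and Int1: "\<rho> > 0" "ball \<pi>0 \<rho> \<subseteq> P" "\<forall>t\<in>{0..T}. ball (x \<pi>0 t) \<rho> \<subseteq> M"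
      "\<forall>t\<in>{0..T}. \<xi> t \<ge> 0" "set_integrable lborel {0..T} \<xi>"
      "\<forall>\<psi>\<in>\<I>. \<forall>t\<in>{0..T}.
         \<forall>u\<in>ball (x \<pi>0 t) \<rho>. \<forall>u1\<in>ball (x \<pi>0 t) \<rho>.
         \<forall>v\<in>ball (deriv_on T (x \<pi>0) t) \<rho>. \<forall>v1\<in>ball (deriv_on T (x \<pi>0) t) \<rho>.
         \<forall>\<pi>\<in>ball \<pi>0 \<rho>. \<forall>\<pi>1\<in>ball \<pi>0 \<rho>.
           \<bar>\<psi> t u v \<pi> - \<psi> t u1 v1 \<pi>1\<bar>
             \<le> \<xi> t * (norm (u - u1) + norm (v - v1) + norm (\<pi> - \<pi>1))"
    and Int2:
      "\<forall>\<psi>\<in>\<I>. continuous_on ({0..T} \<times> M \<times> UNIV \<times> P) (\<lambda>(t, u, v, \<pi>). \<psi> t u v \<pi>)"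
      "\<forall>\<psi>\<in>\<I>. \<forall>t\<in>{0..T}. \<forall>\<pi>\<in>P. \<exists>D. has_DH234 \<psi> t (x \<pi> t) (deriv_on T (x \<pi>) t) \<pi> D"
    and Int3:
      "\<forall>\<psi>\<in>\<I>. \<forall>t\<in>{0..T}.
         continuous_on (ball \<pi>0 \<rho>) (\<lambda>\<pi>. DH23 \<psi> t (x \<pi> t) (deriv_on T (x \<pi>) t) \<pi>)"
    and Con: \<comment> \<open>the integral and the equation in the dual of R^n are evaluated at every vector e\<close>
      "\<forall>(lam :: nat \<Rightarrow> real) (mu :: nat \<Rightarrow> real).
         (\<exists>i\<in>{1..k}. lam i \<noteq> 0) \<or> (\<exists>j\<in>{1..l}. mu j \<noteq> 0) \<longrightarrow>
         \<not> (\<exists>c :: (real ^ 'n) \<Rightarrow>\<^sub>L real.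
              AE t in lborel. t \<in> {0..T} \<longrightarrow>
                (\<forall>e :: real ^ 'n.
                   blinfun_apply (DH3 (combined_integrand k g l h lam mu)
                                    t (x \<pi>0 t) (deriv_on T (x \<pi>0) t) \<pi>0) e
                   = (LINT s:{0..t}|lborel.
                        blinfun_apply (DH2 (combined_integrand k g l h lam mu)
                                         s (x \<pi>0 s) (deriv_on T (x \<pi>0) s) \<pi>0) e)
                     + blinfun_apply c e))"
  shows
    \<comment> \<open>(I)\<close>
    "(\<forall>\<omega>. (\<exists>d. has_gateaux_variation_into_C1 T x \<pi>0 \<omega> d) \<longrightarrow>
       (\<forall>\<psi>\<in>\<I>. set_integrable lborel {0..T} (DH4_along T \<psi> (x \<pi>0) \<pi>0 \<omega>)) \<and>
       (\<exists>lam mu. the_KKT_multipliers T L k g l h \<pi>0 (x \<pi>0) lam mu \<and>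
          has_gateaux_variation V \<pi>0 \<omega> (envelope_rhs T L k g l h \<pi>0 (x \<pi>0) lam mu \<omega>)))
     \<and>
     \<comment> \<open>(II)\<close>
     ((\<forall>\<omega>. \<exists>d. has_gateaux_variation_into_C1 T x \<pi>0 \<omega> d) \<longrightarrow>
       (\<forall>\<psi>\<in>\<I>. \<forall>\<omega>. set_integrable lborel {0..T} (DH4_along T \<psi> (x \<pi>0) \<pi>0 \<omega>)) \<and>
       (\<exists>lam mu DV. the_KKT_multipliers T L k g l h \<pi>0 (x \<pi>0) lam mu \<and>
          has_gateaux_differential V \<pi>0 DV \<and>
          (\<forall>\<omega>. blinfun_apply DV \<omega> = envelope_rhs T L k g l h \<pi>0 (x \<pi>0) lam mu \<omega>)))
     \<and>
     \<comment> \<open>(III)\<close>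
     ((\<forall>\<pi>\<in>P. \<forall>\<omega>. \<exists>d. has_gateaux_variation_into_C1 T x \<pi> \<omega> d) \<and>
      (\<forall>\<psi>\<in>\<I>. \<forall>t\<in>{0..T}.
         continuous_on (ball \<pi>0 \<rho>) (\<lambda>\<pi>. DH234 \<psi> t (x \<pi> t) (deriv_on T (x \<pi>) t) \<pi>)) \<and>
      (\<forall>\<psi>\<in>\<I>. \<forall>\<pi>\<in>ball \<pi>0 \<rho>.
         (\<lambda>t. DH234 \<psi> t (x \<pi> t) (deriv_on T (x \<pi>) t) \<pi>)
           \<in> borel_measurable (restrict_space borel {0..T})) \<longrightarrow>
       (\<exists>U DV lam mu. open U \<and> \<pi>0 \<in> U \<and> U \<subseteq> P \<and>
          (\<forall>\<pi>\<in>U. (V has_derivative blinfun_apply (DV \<pi>)) (at \<pi>)) \<and>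
          continuous_on U DV \<and>
          (\<forall>\<pi>\<in>U. the_KKT_multipliers T L k g l h \<pi> (x \<pi>) (lam \<pi>) (mu \<pi>) \<and>
             (\<forall>\<psi>\<in>\<I>. \<forall>\<omega>. set_integrable lborel {0..T} (DH4_along T \<psi> (x \<pi>) \<pi> \<omega>)) \<and>
             (\<forall>\<omega>. blinfun_apply (DV \<pi>) \<omega>
                  = envelope_rhs T L k g l h \<pi> (x \<pi>) (lam \<pi>) (mu \<pi>) \<omega>))))"
proof -
  interpret ep: envelope_problem T \<rho> M a0 aT L k l g h \<pi>0 P x \<xi>
    by (rule envelope_problem.intro)
      (use T Sol1(3,4) Int1(1-5) Int1(6)[unfolded \<I>] Int2[unfolded \<I>] Con in blast)+
  show ?thesis
  proof (intro conjI impI allI)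
    fix \<omega> assume "\<exists>d. has_gateaux_variation_into_C1 T x \<pi>0 \<omega> d"
    then obtain d where d: "has_gateaux_variation_into_C1 T x \<pi>0 \<omega> d" ..
    show "\<forall>\<psi>\<in>\<I>. set_integrable lborel {0..T} (DH4_along T \<psi> (x \<pi>0) \<pi>0 \<omega>)"
      unfolding \<I> by (rule ep.envelope_directional(1)[OF d])
    show "\<exists>lam mu. the_KKT_multipliers T L k g l h \<pi>0 (x \<pi>0) lam mu \<and>
          has_gateaux_variation V \<pi>0 \<omega> (envelope_rhs T L k g l h \<pi>0 (x \<pi>0) lam mu \<omega>)"
      unfolding V by (rule ep.envelope_directional(2)[OF d])
  next
    assume all: "\<forall>\<omega>. \<exists>d. has_gateaux_variation_into_C1 T x \<pi>0 \<omega> d"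
    then show "\<forall>\<psi>\<in>\<I>. \<forall>\<omega>. set_integrable lborel {0..T} (DH4_along T \<psi> (x \<pi>0) \<pi>0 \<omega>)"
      unfolding \<I> using ep.envelope_directional(1) by blast
    show "\<exists>lam mu DV. the_KKT_multipliers T L k g l h \<pi>0 (x \<pi>0) lam mu \<and>
          has_gateaux_differential V \<pi>0 DV \<and>
          (\<forall>\<omega>. blinfun_apply DV \<omega> = envelope_rhs T L k g l h \<pi>0 (x \<pi>0) lam mu \<omega>)"
      unfolding V by (rule ep.envelope_gateaux[OF all])
  next
    assume III: "(\<forall>\<pi>\<in>P. \<forall>\<omega>. \<exists>d. has_gateaux_variation_into_C1 T x \<pi> \<omega> d) \<and>
      (\<forall>\<psi>\<in>\<I>. \<forall>t\<in>{0..T}.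
         continuous_on (ball \<pi>0 \<rho>) (\<lambda>\<pi>. DH234 \<psi> t (x \<pi> t) (deriv_on T (x \<pi>) t) \<pi>)) \<and>
      (\<forall>\<psi>\<in>\<I>. \<forall>\<pi>\<in>ball \<pi>0 \<rho>.
         (\<lambda>t. DH234 \<psi> t (x \<pi> t) (deriv_on T (x \<pi>) t) \<pi>)
           \<in> borel_measurable (restrict_space borel {0..T}))"
    interpret cp: C1_envelope_problem T \<rho> M a0 aT L k l g h \<pi>0 P x \<xi>
      by (unfold_locales) (use III[unfolded \<I>] in blast)+
    show "\<exists>U DV lam mu. open U \<and> \<pi>0 \<in> U \<and> U \<subseteq> P \<and>
          (\<forall>\<pi>\<in>U. (V has_derivative blinfun_apply (DV \<pi>)) (at \<pi>)) \<and>
          continuous_on U DV \<and>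
          (\<forall>\<pi>\<in>U. the_KKT_multipliers T L k g l h \<pi> (x \<pi>) (lam \<pi>) (mu \<pi>) \<and>
             (\<forall>\<psi>\<in>\<I>. \<forall>\<omega>. set_integrable lborel {0..T} (DH4_along T \<psi> (x \<pi>) \<pi> \<omega>)) \<and>
             (\<forall>\<omega>. blinfun_apply (DV \<pi>) \<omega>
                  = envelope_rhs T L k g l h \<pi> (x \<pi>) (lam \<pi>) (mu \<pi>) \<omega>))"
      unfolding V \<I> by (rule cp.envelope_C1)
  qed
qed

end
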